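(* Let $\Theta=(T,\{K_t\},\{\Sigma_e\},\{\phi_e\})$ be a tree system of metric compacta and let $\mathcal E=(\{\hat K_t\},\{\delta_e\})$ be a family of extended spaces and maps for $\Theta$ which is fine. Let $S_{\mathcal E}=(\{\hat K_F:F\in\mathcal F_T\},\{h_{F_1F_2}:F_1\subset F_2\})$ be the associated inverse system. Then $\lim\Theta$ is homeomorphic to the inverse limit $\varprojlim S_{\mathcal E}$; more precisely, the map sending a thread $(x_F)$ that eventually stabilizes at a point $y\in K_t$ to $y$, and a non-stabilizing thread to the corresponding end of $T$, is a homeomorphism $\varprojlim S_{\mathcal E}\to\lim\Theta$.
   Context: Trees: for a tree $T$, $V_T$ is its vertex set and $O_T$ its set of oriented edges; each $e\in O_T$ has initial vertex $\alpha(e)$, terminal vertex $\omega(e)$, and $\bar e$ denotes the oppositely oriented edge; $N_t=\{e\in O_T:\alpha(e)=t\}$. $\mathcal F_T$ is the poset (under inclusion) of finite subtrees of $T$. A family of subsets of a compact metric space is null if for every $\epsilon>0$ only finitely many of its members have diameter $\ge\epsilon$. A tree system of metric compacta is a tuple $\Theta=(T,\{K_t\},\{\Sigma_e\},\{\phi_e\})$ where $T$ is a countable tree, each $K_t$ is a compact metric space, each $\Sigma_e$ is a nonempty compact subset of $K_{\alpha(e)}$, each $\phi_e:\Sigma_e\to\Sigma_{\bar e}$ is a homeomorphism with $\phi_{\bar e}=\phi_e^{-1}$, and for each $t$ the family $\{\Sigma_e:e\in N_t\}$ consists of pairwise disjoint sets and is null in $K_t$. Limit: $E_T$ is the set of ends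 of $T$; $\#\Theta$ is the quotient of $\bigsqcup_tK_t$ by $x\sim\phi_e(x)$; as a set $\lim\Theta=\#\Theta\sqcup E_T$. For a finite subtree $F$, $K_F$ is the quotient of $\bigsqcup_{t\in V_F}K_t$ by $x\sim\phi_e(x)$ for edges $e$ of $F$; $N_F=\{e:\alpha(e)\in V_F,\omega(e)\notin V_F\}$; $U\subset K_F$ is saturated if each $\Sigma_e$ ($e\in N_F$) is contained in or disjoint from $U$; for saturated $U$, $G(U)$ is the union of $U$, of all $K_t$ ($t\notin V_F$) such that the shortest path from $F$ to $t$ starts with some $e\in N_F$ with $\Sigma_e\subset U$, and of all ends represented by rays starting in $F$, leaving $F$ immediately through such an edge $e$. The topology on $\lim\Theta$ has basis all $G(U)$ with $U$ open and saturated in some $K_F$. Extended spaces and maps: suppose for each $e\in O_T$ we are given a compact metric space $\Delta_e$, a compact subspace $S_e\subset\Delta_e$ and a homeomorphism $\varphi_e:S_e\to\Sigma_e$. For $t\in V_T$, the extended space $\hat K_t$ is the limit of the tree system over the star tree spanned by $t$ and its neighbours, with constituent spaces $K_t$ at $t$ and $\Delta_e$ at $\omega(e)$ ($e\in N_t$), peripheral subspaces $\Sigma_e\subset K_t$ and $S_e\subset\Delta_e$, connecting maps $\varphi_e^{-1}$ and $\varphi_e$. Thus $K_t$ and each $\Delta_e$ ($e\in N_t$) are subspaces of $\hat K_t$, with $S_e$ identified with $\Sigma_e$. Put $\hat K_e=\hat K_{\omega(e)}\setminus(\Delta_{\bar e}\setminus S_{\bar e})$. A family of extended spaces and maps is $\mathcal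 E=(\{\hat K_t\},\{\delta_e\})$ with continuous maps $\delta_e:\hat K_e\to\Delta_e$ whose restriction to $\Sigma_{\bar e}$ equals $\phi_{\bar e}$ (viewing $\Sigma_e=S_e\subset\Delta_e$). For $F\in\mathcal F_T$, $\hat K_F$ is the quotient of $\bigsqcup_{t\in V_F}\big[\hat K_t\setminus\bigcup_{e\in N_t\cap O_F}(\Delta_e\setminus S_e)\big]$ by $x\sim\phi_e(x)$, $e\in O_F$, $x\in\Sigma_e$. If $V_{F_2}=V_{F_1}\cup\{t\}$ and $e$ is the edge of $F_2$ with $\omega(e)=t$, then $h_{F_1F_2}:\hat K_{F_2}\to\hat K_{F_1}$ is the identity on $\hat K_{F_1}\setminus(\Delta_e\setminus S_e)$ and equals $\delta_e$ on $\hat K_e$; general $h_{F_1F_2}$ ($F_1\subset F_2$) are compositions of such maps along a chain of subtrees adding one vertex at a time (independent of the chain). The associated inverse system is $S_{\mathcal E}=(\{\hat K_F\},\{h_{F_1F_2}\})$ indexed by $\mathcal F_T$. For an embedded path $\gamma=(e_1,\dots,e_m)$ in $T$, $m\ge2$, let $\delta_\gamma=\delta_{e_1}\circ\dots\circ\delta_{e_{m-1}}|_{\Delta_{e_m}}:\Delta_{e_m}\to\Delta_{e_1}$ (note $\Delta_{e_{i+1}}\subset\hat K_{e_i}$). $\mathcal E$ is fine if for every $e\in O_T$ the family of sets $\delta_\gamma(\Delta_{e_m})$, over all such paths $\gamma$ with $e_1=e$, is null in $\Delta_e$. *)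

theory Defs
  imports "HOL-Analysis.Analysis"
begin

text \<open>A tree is given by a vertex set V and a symmetric irreflexive adjacency relation E.
  Oriented edges are pairs (u,w) with E u w; alpha = fst, omega = snd.\<close>

type_synonym 'v edge = "'v \<times> 'v"

definition rev_e :: "'v edge \<Rightarrow> 'v edge" where
  "rev_e e = (snd e, fst e)"

definition oedges :: "'v set \<Rightarrow> ('v \<Rightarrow> 'v \<Rightarrow> bool) \<Rightarrow> 'v edge set" where
  "oedges W E = {(u, w). u \<in> W \<and> w \<in> W \<and> E u w}"

definition nbr_edges :: "'v set \<Rightarrow> ('v \<Rightarrow> 'v \<Rightarrow> bool) \<Rightarrow> 'v \<Rightarrow> 'v edge set" where
  "nbr_edges W E t = {e \<in> oedges W E. fst e = t}"

definition vpath :: "('v \<Rightarrow> 'v \<Rightarrow> bool) \<Rightarrow> 'v list \<Rightarrow> bool" where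
  "vpath E p \<longleftrightarrow> p \<noteq> [] \<and> distinct p \<and> (\<forall>i. Suc i < length p \<longrightarrow> E (p ! i) (p ! Suc i))"

definition is_tree :: "'v set \<Rightarrow> ('v \<Rightarrow> 'v \<Rightarrow> bool) \<Rightarrow> bool" where
  "is_tree V E \<longleftrightarrow> V \<noteq> {} \<and> (\<forall>u w. E u w \<longrightarrow> u \<in> V \<and> w \<in> V) \<and> (\<forall>u w. E u w \<longleftrightarrow> E w u)
     \<and> (\<forall>u. \<not> E u u) \<and> (\<forall>u\<in>V. \<forall>w\<in>V. \<exists>!p. vpath E p \<and> hd p = u \<and> last p = w)"

text \<open>Finite subtrees, identified with their (finite, nonempty, connected) vertex sets;
  the edges of a subtree F are the edges of T with both endpoints in F (oedges F E).\<close>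
definition subtrees :: "'v set \<Rightarrow> ('v \<Rightarrow> 'v \<Rightarrow> bool) \<Rightarrow> 'v set set" where
  "subtrees V E = {F. finite F \<and> F \<noteq> {} \<and> F \<subseteq> V \<and>
      (\<forall>u\<in>F. \<forall>w\<in>F. \<exists>p. vpath E p \<and> hd p = u \<and> last p = w \<and> set p \<subseteq> F)}"

definition out_edges :: "'v set \<Rightarrow> ('v \<Rightarrow> 'v \<Rightarrow> bool) \<Rightarrow> 'v set \<Rightarrow> 'v edge set" where
  "out_edges V E F = {e \<in> oedges V E. fst e \<in> F \<and> snd e \<notin> F}"

definition is_ray :: "'v set \<Rightarrow> ('v \<Rightarrow> 'v \<Rightarrow> bool) \<Rightarrow> (nat \<Rightarrow> 'v) \<Rightarrow> bool" where
  "is_ray V E r \<longleftrightarrow> inj r \<and> (\<forall>n. r n \<in> V \<and> E (r n) (r (Suc n)))"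

definition tree_ends :: "'v set \<Rightarrow> ('v \<Rightarrow> 'v \<Rightarrow> bool) \<Rightarrow> (nat \<Rightarrow> 'v) set set" where
  "tree_ends V E = {{r'. is_ray V E r' \<and> (\<exists>i j. \<forall>n. r' (i + n) = r (j + n))} | r. is_ray V E r}"

text \<open>The shortest path from F to s starts with the edge e.\<close>
definition exits_to :: "('v \<Rightarrow> 'v \<Rightarrow> bool) \<Rightarrow> 'v set \<Rightarrow> 'v edge \<Rightarrow> 'v \<Rightarrow> bool" where
  "exits_to E F e s \<longleftrightarrow> (\<exists>p. vpath E p \<and> 2 \<le> length p \<and> hd p = fst e \<and> p ! 1 = snd e
       \<and> last p = s \<and> set (tl p) \<inter> F = {})"

definition exits_to_end :: "'v set \<Rightarrow> 'v edge \<Rightarrow> (nat \<Rightarrow> 'v) set \<Rightarrow> bool" where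
  "exits_to_end F e xi \<longleftrightarrow> (\<exists>r\<in>xi. r 0 = fst e \<and> r 1 = snd e \<and> (\<forall>n\<ge>1. r n \<notin> F))"

definition glue_eq :: "'p set \<Rightarrow> ('p \<times> 'p) set \<Rightarrow> ('p \<times> 'p) set" where
  "glue_eq A P = {(x, y). x \<in> A \<and> y \<in> A \<and> (x, y) \<in> (P \<union> P\<inverse>)\<^sup>*}"

definition quot_top :: "'p topology \<Rightarrow> ('p \<times> 'p) set \<Rightarrow> 'p set topology" where
  "quot_top X R = topology_generated_by {U. U \<subseteq> topspace X // R \<and> openin X (\<Union>U)}"

definition mdiam :: "'a metric \<Rightarrow> 'a set \<Rightarrow> real" where
  "mdiam m A = (SUP p\<in>A \<times> A. mdist m (fst p) (snd p))"

definition null_family :: "'a metric \<Rightarrow> 'i set \<Rightarrow> ('i \<Rightarrow> 'a set) \<Rightarrow> bool" where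
  "null_family m I A \<longleftrightarrow> (\<forall>\<epsilon>>0. finite {i \<in> I. mdiam m (A i) \<ge> \<epsilon>})"

definition ts_raw :: "'v set \<Rightarrow> ('v \<Rightarrow> 'c topology) \<Rightarrow> ('v \<times> 'c) set" where
  "ts_raw W K = Sigma W (\<lambda>t. topspace (K t))"

definition ts_glue :: "'v edge set \<Rightarrow> ('v edge \<Rightarrow> 'c set) \<Rightarrow> ('v edge \<Rightarrow> 'c \<Rightarrow> 'c)
     \<Rightarrow> (('v \<times> 'c) \<times> ('v \<times> 'c)) set" where
  "ts_glue Oe Sg phi = {((fst e, x), (snd e, phi e x)) | e x. e \<in> Oe \<and> x \<in> Sg e}"

definition ts_rel :: "'v set \<Rightarrow> ('v \<Rightarrow> 'v \<Rightarrow> bool) \<Rightarrow> ('v \<Rightarrow> 'c topology) \<Rightarrow> ('v edge \<Rightarrow> 'c set)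
     \<Rightarrow> ('v edge \<Rightarrow> 'c \<Rightarrow> 'c) \<Rightarrow> (('v \<times> 'c) \<times> ('v \<times> 'c)) set" where
  "ts_rel W E K Sg phi = glue_eq (ts_raw W K) (ts_glue (oedges W E) Sg phi)"

definition ts_KF :: "('v \<Rightarrow> 'v \<Rightarrow> bool) \<Rightarrow> ('v \<Rightarrow> 'c topology) \<Rightarrow> ('v edge \<Rightarrow> 'c set)
     \<Rightarrow> ('v edge \<Rightarrow> 'c \<Rightarrow> 'c) \<Rightarrow> 'v set \<Rightarrow> ('v \<times> 'c) set topology" where
  "ts_KF E K Sg phi F = quot_top (sum_topology K F) (ts_rel F E K Sg phi)"

definition ts_saturated :: "'v set \<Rightarrow> ('v \<Rightarrow> 'v \<Rightarrow> bool) \<Rightarrow> ('v \<Rightarrow> 'c topology) \<Rightarrow> ('v edge \<Rightarrow> 'c set)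
     \<Rightarrow> ('v edge \<Rightarrow> 'c \<Rightarrow> 'c) \<Rightarrow> 'v set \<Rightarrow> ('v \<times> 'c) set set \<Rightarrow> bool" where
  "ts_saturated V E K Sg phi F U \<longleftrightarrow> (\<forall>e \<in> out_edges V E F.
      (\<forall>x\<in>Sg e. ts_rel F E K Sg phi `` {(fst e, x)} \<in> U) \<or>
      (\<forall>x\<in>Sg e. ts_rel F E K Sg phi `` {(fst e, x)} \<notin> U))"

definition ts_G :: "'v set \<Rightarrow> ('v \<Rightarrow> 'v \<Rightarrow> bool) \<Rightarrow> ('v \<Rightarrow> 'c topology) \<Rightarrow> ('v edge \<Rightarrow> 'c set)
     \<Rightarrow> ('v edge \<Rightarrow> 'c \<Rightarrow> 'c) \<Rightarrow> 'v set \<Rightarrow> ('v \<times> 'c) set set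
     \<Rightarrow> (('v \<times> 'c) set + (nat \<Rightarrow> 'v) set) set" where
  "ts_G V E K Sg phi F U =
    (let good = {e \<in> out_edges V E F. (\<forall>x\<in>Sg e. ts_rel F E K Sg phi `` {(fst e, x)} \<in> U)}
     in Inl ` {c \<in> ts_raw V K // ts_rel V E K Sg phi.
                 \<exists>r\<in>c. (fst r \<in> F \<and> ts_rel F E K Sg phi `` {r} \<in> U) \<or> (\<exists>e\<in>good. exits_to E F e (fst r))}
        \<union> Inr ` {xi \<in> tree_ends V E. \<exists>e\<in>good. exits_to_end F e xi})"

definition ts_lim :: "'v set \<Rightarrow> ('v \<Rightarrow> 'v \<Rightarrow> bool) \<Rightarrow> ('v \<Rightarrow> 'c topology) \<Rightarrow> ('v edge \<Rightarrow> 'c set)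
     \<Rightarrow> ('v edge \<Rightarrow> 'c \<Rightarrow> 'c) \<Rightarrow> (('v \<times> 'c) set + (nat \<Rightarrow> 'v) set) topology" where
  "ts_lim V E K Sg phi = topology_generated_by
     {ts_G V E K Sg phi F U | F U. F \<in> subtrees V E \<and> openin (ts_KF E K Sg phi F) U
                                   \<and> ts_saturated V E K Sg phi F U}"

definition star_V :: "('v \<Rightarrow> 'v \<Rightarrow> bool) \<Rightarrow> 'v \<Rightarrow> 'v set" where
  "star_V E t = insert t {s. E t s}"

definition star_E :: "('v \<Rightarrow> 'v \<Rightarrow> bool) \<Rightarrow> 'v \<Rightarrow> 'v \<Rightarrow> 'v \<Rightarrow> bool" where
  "star_E E t u w \<longleftrightarrow> E u w \<and> (u = t \<or> w = t)"

definition star_K :: "('v \<Rightarrow> 'a metric) \<Rightarrow> ('v edge \<Rightarrow> 'a metric) \<Rightarrow> 'v \<Rightarrow> 'v \<Rightarrow> 'a topology" where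
  "star_K Km D t s = (if s = t then mtopology_of (Km t) else mtopology_of (D (t, s)))"

definition star_Sg :: "('v edge \<Rightarrow> 'a set) \<Rightarrow> ('v edge \<Rightarrow> 'a set) \<Rightarrow> 'v \<Rightarrow> 'v edge \<Rightarrow> 'a set" where
  "star_Sg Sg S t e = (if fst e = t then Sg e else S (rev_e e))"

definition star_phi :: "('v edge \<Rightarrow> 'a set) \<Rightarrow> ('v edge \<Rightarrow> 'a \<Rightarrow> 'a) \<Rightarrow> 'v \<Rightarrow> 'v edge \<Rightarrow> 'a \<Rightarrow> 'a" where
  "star_phi S psi t e = (if fst e = t then inv_into (S e) (psi e) else psi (rev_e e))"

type_synonym ('v, 'a) pt = "('v \<times> 'a) set + (nat \<Rightarrow> 'v) set"

definition hatK :: "('v \<Rightarrow> 'v \<Rightarrow> bool) \<Rightarrow> ('v \<Rightarrow> 'a metric) \<Rightarrow> ('v edge \<Rightarrow> 'a set)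
    \<Rightarrow> ('v edge \<Rightarrow> 'a metric) \<Rightarrow> ('v edge \<Rightarrow> 'a set) \<Rightarrow> ('v edge \<Rightarrow> 'a \<Rightarrow> 'a) \<Rightarrow> 'v \<Rightarrow> ('v, 'a) pt topology" where
  "hatK E Km Sg D S psi t =
     ts_lim (star_V E t) (star_E E t) (star_K Km D t) (star_Sg Sg S t) (star_phi S psi t)"

definition incK :: "('v \<Rightarrow> 'v \<Rightarrow> bool) \<Rightarrow> ('v \<Rightarrow> 'a metric) \<Rightarrow> ('v edge \<Rightarrow> 'a set)
    \<Rightarrow> ('v edge \<Rightarrow> 'a metric) \<Rightarrow> ('v edge \<Rightarrow> 'a set) \<Rightarrow> ('v edge \<Rightarrow> 'a \<Rightarrow> 'a) \<Rightarrow> 'v \<Rightarrow> 'a \<Rightarrow> ('v, 'a) pt" where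
  "incK E Km Sg D S psi t x =
     Inl (ts_rel (star_V E t) (star_E E t) (star_K Km D t) (star_Sg Sg S t) (star_phi S psi t) `` {(t, x)})"

definition incD :: "('v \<Rightarrow> 'v \<Rightarrow> bool) \<Rightarrow> ('v \<Rightarrow> 'a metric) \<Rightarrow> ('v edge \<Rightarrow> 'a set)
    \<Rightarrow> ('v edge \<Rightarrow> 'a metric) \<Rightarrow> ('v edge \<Rightarrow> 'a set) \<Rightarrow> ('v edge \<Rightarrow> 'a \<Rightarrow> 'a) \<Rightarrow> 'v edge \<Rightarrow> 'a \<Rightarrow> ('v, 'a) pt" where
  "incD E Km Sg D S psi e y =
     Inl (ts_rel (star_V E (fst e)) (star_E E (fst e)) (star_K Km D (fst e)) (star_Sg Sg S (fst e))
            (star_phi S psi (fst e)) `` {(snd e, y)})"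

definition hatKe :: "('v \<Rightarrow> 'v \<Rightarrow> bool) \<Rightarrow> ('v \<Rightarrow> 'a metric) \<Rightarrow> ('v edge \<Rightarrow> 'a set)
    \<Rightarrow> ('v edge \<Rightarrow> 'a metric) \<Rightarrow> ('v edge \<Rightarrow> 'a set) \<Rightarrow> ('v edge \<Rightarrow> 'a \<Rightarrow> 'a) \<Rightarrow> 'v edge \<Rightarrow> ('v, 'a) pt set" where
  "hatKe E Km Sg D S psi e =
     topspace (hatK E Km Sg D S psi (snd e))
       - incD E Km Sg D S psi (rev_e e) ` (mspace (D (rev_e e)) - S (rev_e e))"

definition hatKF_part :: "('v \<Rightarrow> 'v \<Rightarrow> bool) \<Rightarrow> ('v \<Rightarrow> 'a metric) \<Rightarrow> ('v edge \<Rightarrow> 'a set)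
    \<Rightarrow> ('v edge \<Rightarrow> 'a metric) \<Rightarrow> ('v edge \<Rightarrow> 'a set) \<Rightarrow> ('v edge \<Rightarrow> 'a \<Rightarrow> 'a) \<Rightarrow> 'v set \<Rightarrow> 'v
    \<Rightarrow> ('v, 'a) pt set" where
  "hatKF_part E Km Sg D S psi F t =
     topspace (hatK E Km Sg D S psi t)
       - (\<Union>e \<in> {e \<in> oedges F E. fst e = t}. incD E Km Sg D S psi e ` (mspace (D e) - S e))"

definition hatKF_rel :: "('v \<Rightarrow> 'v \<Rightarrow> bool) \<Rightarrow> ('v \<Rightarrow> 'a metric) \<Rightarrow> ('v edge \<Rightarrow> 'a set) \<Rightarrow> ('v edge \<Rightarrow> 'a \<Rightarrow> 'a)
    \<Rightarrow> ('v edge \<Rightarrow> 'a metric) \<Rightarrow> ('v edge \<Rightarrow> 'a set) \<Rightarrow> ('v edge \<Rightarrow> 'a \<Rightarrow> 'a) \<Rightarrow> 'v set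
    \<Rightarrow> (('v \<times> ('v, 'a) pt) \<times> ('v \<times> ('v, 'a) pt)) set" where
  "hatKF_rel E Km Sg phi D S psi F =
     glue_eq (Sigma F (hatKF_part E Km Sg D S psi F))
       {((fst e, incK E Km Sg D S psi (fst e) x), (snd e, incK E Km Sg D S psi (snd e) (phi e x))) | e x.
          e \<in> oedges F E \<and> x \<in> Sg e}"

definition hatKF :: "('v \<Rightarrow> 'v \<Rightarrow> bool) \<Rightarrow> ('v \<Rightarrow> 'a metric) \<Rightarrow> ('v edge \<Rightarrow> 'a set) \<Rightarrow> ('v edge \<Rightarrow> 'a \<Rightarrow> 'a)
    \<Rightarrow> ('v edge \<Rightarrow> 'a metric) \<Rightarrow> ('v edge \<Rightarrow> 'a set) \<Rightarrow> ('v edge \<Rightarrow> 'a \<Rightarrow> 'a) \<Rightarrow> 'v set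
    \<Rightarrow> ('v \<times> ('v, 'a) pt) set topology" where
  "hatKF E Km Sg phi D S psi F =
     quot_top (sum_topology (\<lambda>t. subtopology (hatK E Km Sg D S psi t) (hatKF_part E Km Sg D S psi F t)) F)
              (hatKF_rel E Km Sg phi D S psi F)"

definition fpath :: "('v \<Rightarrow> 'v \<Rightarrow> bool) \<Rightarrow> 'v set \<Rightarrow> 'v \<Rightarrow> 'v edge list" where
  "fpath E F s = (THE es. es \<noteq> [] \<and> fst (hd es) \<in> F \<and> snd (last es) = s \<and>
      (\<forall>e\<in>set es. E (fst e) (snd e) \<and> snd e \<notin> F) \<and>
      (\<forall>i. Suc i < length es \<longrightarrow> snd (es ! i) = fst (es ! Suc i)) \<and> distinct (map snd es))"

text \<open>Composition of the maps delta along a path e1,...,em, starting from a point of hat K_(omega em),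
  landing in hat K_(alpha e1) (via Delta_e1).\<close>
fun hchain :: "('v \<Rightarrow> 'v \<Rightarrow> bool) \<Rightarrow> ('v \<Rightarrow> 'a metric) \<Rightarrow> ('v edge \<Rightarrow> 'a set)
    \<Rightarrow> ('v edge \<Rightarrow> 'a metric) \<Rightarrow> ('v edge \<Rightarrow> 'a set) \<Rightarrow> ('v edge \<Rightarrow> 'a \<Rightarrow> 'a)
    \<Rightarrow> ('v edge \<Rightarrow> ('v, 'a) pt \<Rightarrow> 'a) \<Rightarrow> 'v edge list \<Rightarrow> ('v, 'a) pt \<Rightarrow> ('v, 'a) pt" where
  "hchain E Km Sg D S psi delta [] p = p"
| "hchain E Km Sg D S psi delta (e # es) p = incD E Km Sg D S psi e (delta e (hchain E Km Sg D S psi delta es p))"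

definition hraw :: "('v \<Rightarrow> 'v \<Rightarrow> bool) \<Rightarrow> ('v \<Rightarrow> 'a metric) \<Rightarrow> ('v edge \<Rightarrow> 'a set)
    \<Rightarrow> ('v edge \<Rightarrow> 'a metric) \<Rightarrow> ('v edge \<Rightarrow> 'a set) \<Rightarrow> ('v edge \<Rightarrow> 'a \<Rightarrow> 'a)
    \<Rightarrow> ('v edge \<Rightarrow> ('v, 'a) pt \<Rightarrow> 'a) \<Rightarrow> 'v set \<Rightarrow> 'v \<times> ('v, 'a) pt \<Rightarrow> 'v \<times> ('v, 'a) pt" where
  "hraw E Km Sg D S psi delta F r =
     (if fst r \<in> F then r
      else (let es = fpath E F (fst r) in (fst (hd es), hchain E Km Sg D S psi delta es (snd r))))"

text \<open>The bonding map h_(F1 F2) : hat K_F2 -> hat K_F1 (the composition of the one-vertex maps,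
  written out explicitly on representatives).\<close>
definition hmap :: "('v \<Rightarrow> 'v \<Rightarrow> bool) \<Rightarrow> ('v \<Rightarrow> 'a metric) \<Rightarrow> ('v edge \<Rightarrow> 'a set) \<Rightarrow> ('v edge \<Rightarrow> 'a \<Rightarrow> 'a)
    \<Rightarrow> ('v edge \<Rightarrow> 'a metric) \<Rightarrow> ('v edge \<Rightarrow> 'a set) \<Rightarrow> ('v edge \<Rightarrow> 'a \<Rightarrow> 'a)
    \<Rightarrow> ('v edge \<Rightarrow> ('v, 'a) pt \<Rightarrow> 'a) \<Rightarrow> 'v set \<Rightarrow> 'v set
    \<Rightarrow> ('v \<times> ('v, 'a) pt) set \<Rightarrow> ('v \<times> ('v, 'a) pt) set" where
  "hmap E Km Sg phi D S psi delta F1 F2 c =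
     hatKF_rel E Km Sg phi D S psi F1 `` {hraw E Km Sg D S psi delta F1 (SOME r. r \<in> c)}"

definition invlim :: "'v set \<Rightarrow> ('v \<Rightarrow> 'v \<Rightarrow> bool) \<Rightarrow> ('v \<Rightarrow> 'a metric) \<Rightarrow> ('v edge \<Rightarrow> 'a set) \<Rightarrow> ('v edge \<Rightarrow> 'a \<Rightarrow> 'a)
    \<Rightarrow> ('v edge \<Rightarrow> 'a metric) \<Rightarrow> ('v edge \<Rightarrow> 'a set) \<Rightarrow> ('v edge \<Rightarrow> 'a \<Rightarrow> 'a)
    \<Rightarrow> ('v edge \<Rightarrow> ('v, 'a) pt \<Rightarrow> 'a) \<Rightarrow> ('v set \<Rightarrow> ('v \<times> ('v, 'a) pt) set) topology" where
  "invlim V E Km Sg phi D S psi delta =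
     subtopology (product_topology (hatKF E Km Sg phi D S psi) (subtrees V E))
       {x. \<forall>F1\<in>subtrees V E. \<forall>F2\<in>subtrees V E. F1 \<subseteq> F2 \<longrightarrow>
             hmap E Km Sg phi D S psi delta F1 F2 (x F2) = x F1}"

definition epath :: "('v \<Rightarrow> 'v \<Rightarrow> bool) \<Rightarrow> 'v edge list \<Rightarrow> bool" where
  "epath E g \<longleftrightarrow> g \<noteq> [] \<and> (\<forall>e\<in>set g. E (fst e) (snd e)) \<and>
     (\<forall>i. Suc i < length g \<longrightarrow> snd (g ! i) = fst (g ! Suc i)) \<and> distinct (fst (hd g) # map snd g)"

fun dgamma :: "('v \<Rightarrow> 'v \<Rightarrow> bool) \<Rightarrow> ('v \<Rightarrow> 'a metric) \<Rightarrow> ('v edge \<Rightarrow> 'a set)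
    \<Rightarrow> ('v edge \<Rightarrow> 'a metric) \<Rightarrow> ('v edge \<Rightarrow> 'a set) \<Rightarrow> ('v edge \<Rightarrow> 'a \<Rightarrow> 'a)
    \<Rightarrow> ('v edge \<Rightarrow> ('v, 'a) pt \<Rightarrow> 'a) \<Rightarrow> 'v edge list \<Rightarrow> 'a \<Rightarrow> 'a" where
  "dgamma E Km Sg D S psi delta [] y = y"
| "dgamma E Km Sg D S psi delta [e] y = y"
| "dgamma E Km Sg D S psi delta (e1 # e2 # es) y =
     delta e1 (incD E Km Sg D S psi e2 (dgamma E Km Sg D S psi delta (e2 # es) y))"

definition ext_fine :: "'v set \<Rightarrow> ('v \<Rightarrow> 'v \<Rightarrow> bool) \<Rightarrow> ('v \<Rightarrow> 'a metric) \<Rightarrow> ('v edge \<Rightarrow> 'a set)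
    \<Rightarrow> ('v edge \<Rightarrow> 'a metric) \<Rightarrow> ('v edge \<Rightarrow> 'a set) \<Rightarrow> ('v edge \<Rightarrow> 'a \<Rightarrow> 'a)
    \<Rightarrow> ('v edge \<Rightarrow> ('v, 'a) pt \<Rightarrow> 'a) \<Rightarrow> bool" where
  "ext_fine V E Km Sg D S psi delta \<longleftrightarrow> (\<forall>e \<in> oedges V E.
     null_family (D e) {g. epath E g \<and> 2 \<le> length g \<and> hd g = e}
       (\<lambda>g. dgamma E Km Sg D S psi delta g ` mspace (D (last g))))"

end

theory Submission
  imports Defs
begin

text \<open>
  A point \<open>y\<close> of \<open>K\<^sub>t\<close> defines the thread \<open>F \<mapsto> h\<^sub>F(y)\<close>, where \<open>h\<^sub>F\<close> composes the maps \<open>\<delta>\<^sub>e\<close> along the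
  path from \<open>t\<close> back to \<open>F\<close>.  For an end, represented by the ray with edges \<open>e\<^sub>0, e\<^sub>1, \<dots>\<close> leaving \<open>F\<close>, the
  images of \<open>\<Delta>(e\<^sub>n)\<close> in \<open>\<Delta>(e\<^sub>0)\<close> form a decreasing sequence of nonempty compact sets whose diameters
  tend to zero by fineness; their common point is the \<open>F\<close>-coordinate of the thread of the end.
  Conversely, if for some \<open>F\<close> the coordinate of a thread is a point of \<open>K\<^sub>F\<close> outside all \<open>\<Sigma>\<^sub>e\<close> with \<open>e\<close>
  leaving \<open>F\<close>, the thread is constant from \<open>F\<close> on; otherwise each coordinate lies in \<open>\<Delta>\<^sub>e\<close> for exactly one
  \<open>e\<close> leaving \<open>F\<close>, and these edges point to one end.

  The bijection carries \<open>G(U)\<close> to the preimage of the open set \<open>U \<union> \<Union>{\<Delta>\<^sub>e | \<Sigma>\<^sub>e \<subseteq> U}\<close> under the projection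
  to \<open>F\<close>, so the map from threads to points is continuous.  For the other direction, an open \<open>W\<close> around the
  \<open>F\<close>-coordinate of a point of \<open>K\<^sub>t\<close> is pulled back to a large \<open>K\<^sub>F'\<close>, and all \<open>\<Sigma>\<^sub>e\<close> with \<open>\<Delta>\<^sub>e\<close> not
  mapped into \<open>W\<close> are removed; only finitely many of them come near a given point, so the rest is open.
\<close>

section \<open>Paths and rays in trees\<close>

text \<open>The obstacle is double description. A point of \<open>\<Sigma>\<^sub>e\<close> with
  \<open>e\<close> leaving \<open>F\<close> is both a point of \<open>K\<^sub>F\<close> and a point
  of \<open>\<Delta>\<^sub>e\<close>, and it has representatives at both ends of \<open>e\<close>. A
  point of \<open>K\<^sub>s\<close> is therefore informative for a thread only when it is settled in
  \<open>F\<close>: every neighbour \<open>w\<close> of \<open>s\<close> whose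
  \<open>\<Sigma>\<close> at \<open>s\<close> contains it lies in \<open>F\<close>. By disjointness
  of the sets \<open>\<Sigma>\<^sub>e\<close> at \<open>s\<close>, one extra neighbour settles a
  point. Maps are computed on representatives by \<open>hrw\<close>, and the values of
  \<open>\<delta>\<^sub>e\<close> on \<open>\<Sigma>\<close> make the result independent of the
  choice. That only finitely many removed sets matter near a point comes from the limit topology of
  \<open>hat K\<^sub>t\<close>: a basic open set is given by a finite subtree of the star, and by
  saturation it contains \<open>\<Delta>\<^sub>e\<close> entirely, for \<open>e\<close> pointing out
  of that subtree, as soon as it contains a point of \<open>\<Sigma>\<^sub>e\<close>. At an end the
  shrinking images take over this role: some \<open>n\<close> has the image of
  \<open>\<Delta>(e\<^sub>n)\<close> inside \<open>W\<close>, and the branch behind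
  \<open>e\<^sub>n\<close> is the neighbourhood.\<close>

lemma vpath_singleton [simp]: "vpath E [u]"
  by (simp add: vpath_def)

lemma vpath_Cons:
  "vpath E (u # w # p) \<longleftrightarrow> E u w \<and> u \<notin> set (w # p) \<and> vpath E (w # p)"
proof -
  have "(\<forall>i. Suc i < length (u # w # p) \<longrightarrow> E ((u # w # p) ! i) ((u # w # p) ! Suc i)) \<longleftrightarrow>
      E u w \<and> (\<forall>i. Suc i < length (w # p) \<longrightarrow> E ((w # p) ! i) ((w # p) ! Suc i))"
    (is "?L \<longleftrightarrow> ?R")
  proof
    assume L: ?L
    show ?R using L[rule_format, of 0] L[rule_format, of "Suc i" for i] by fastforce
  next
    assume R: ?R
    show ?L
    proof (intro allI impI)
      fix i assume "Suc i < length (u # w # p)"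
      then show "E ((u # w # p) ! i) ((u # w # p) ! Suc i)"
        using R by (cases i) auto
    qed
  qed
  then show ?thesis by (auto simp: vpath_def)
qed

lemma vpath_append:
  assumes "vpath E (p @ [x])" "vpath E (x # q)" "set p \<inter> set q = {}"
  shows "vpath E (p @ x # q)"
  using assms
proof (induction p)
  case (Cons a p)
  then show ?case by (cases p) (auto simp: vpath_Cons)
qed auto

lemma vpath_suffix: "vpath E (p @ x # q) \<Longrightarrow> vpath E (x # q)"
proof (induction p)
  case (Cons a p)
  then show ?case by (cases p) (auto simp: vpath_Cons)
qed auto

section \<open>Walks as edge lists, and paths that leave a set for good\<close>

fun ewalk :: "('v \<Rightarrow> 'v \<Rightarrow> bool) \<Rightarrow> 'v \<Rightarrow> 'v edge list \<Rightarrow> 'v \<Rightarrow> bool" where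
  "ewalk E u [] w \<longleftrightarrow> u = w"
| "ewalk E u (e # es) w \<longleftrightarrow> fst e = u \<and> E u (snd e) \<and> ewalk E (snd e) es w"

lemma ewalk_append: "ewalk E u (es @ es') w \<longleftrightarrow> (\<exists>v. ewalk E u es v \<and> ewalk E v es' w)"
  by (induction es arbitrary: u) auto

lemma ewalk_last: "ewalk E u es w \<Longrightarrow> es \<noteq> [] \<Longrightarrow> snd (last es) = w"
  by (induction es arbitrary: u) (auto split: if_splits)

lemma ewalk_edges: "ewalk E u es w \<Longrightarrow> e \<in> set es \<Longrightarrow> E (fst e) (snd e)"
  by (induction es arbitrary: u) auto

text \<open>Links the indexed chain condition used in \<open>fpath\<close> and \<open>epath\<close>
  with the recursive form on which inductions run.\<close>

lemma ewalk_iff: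
  assumes "es \<noteq> []"
  shows "ewalk E (fst (hd es)) es w \<longleftrightarrow> snd (last es) = w \<and> (\<forall>e\<in>set es. E (fst e) (snd e)) \<and>
    (\<forall>i. Suc i < length es \<longrightarrow> snd (es ! i) = fst (es ! Suc i))"
  using assms
proof (induction es rule: list_nonempty_induct)
  case (cons e es)
  have "(\<forall>i. Suc i < length (e # es) \<longrightarrow> snd ((e # es) ! i) = fst ((e # es) ! Suc i)) \<longleftrightarrow>
      snd e = fst (hd es) \<and> (\<forall>i. Suc i < length es \<longrightarrow> snd (es ! i) = fst (es ! Suc i))"
    (is "?L \<longleftrightarrow> ?R")
  proof
    assume L: ?L
    show ?R using L[rule_format, of 0] L[rule_format, of "Suc i" for i] cons.hyps
      by (auto simp: hd_conv_nth)
  next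
    assume R: ?R
    show ?L
    proof (intro allI impI)
      fix i assume "Suc i < length (e # es)"
      then show "snd ((e # es) ! i) = fst ((e # es) ! Suc i)"
        using R cons.hyps by (cases i) (auto simp: hd_conv_nth)
    qed
  qed
  moreover have "ewalk E (snd e) es w \<Longrightarrow> snd e = fst (hd es)"
    using cons.hyps by (cases es) auto
  ultimately show ?case
    using cons by (auto simp del: ewalk.simps(2) simp: ewalk.simps(2)[of E _ e es])
qed auto

lemma ewalk_imp_vpath:
  "ewalk E u es w \<Longrightarrow> distinct (u # map snd es) \<Longrightarrow> vpath E (u # map snd es) \<and> last (u # map snd es) = w"
  by (induction es arbitrary: u) (auto simp: vpath_Cons)

lemma vpath_imp_ewalk: "vpath E (u # p) \<Longrightarrow> ewalk E u (zip (u # p) p) (last (u # p))"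
  by (induction p arbitrary: u) (auto simp: vpath_Cons)

lemma map_snd_zip_Cons [simp]: "map snd (zip (u # p) p) = p"
  by (simp add: map_snd_zip_take)

text \<open>A walk is determined by its start and the vertices it reaches, so uniqueness of vertex
  paths carries over to edge lists.\<close>

lemma ewalk_eq_zip: "ewalk E u es w \<Longrightarrow> es = zip (u # map snd es) (map snd es)"
  by (induction es arbitrary: u) auto

text \<open>This is the condition under the \<open>THE\<close> of \<open>fpath\<close>. The start
  vertex is automatically different from all later ones, because those avoid
  \<open>F\<close>.\<close>

definition exit_path :: "('v \<Rightarrow> 'v \<Rightarrow> bool) \<Rightarrow> 'v set \<Rightarrow> 'v edge list \<Rightarrow> 'v \<Rightarrow> bool" where
  "exit_path E F es s \<longleftrightarrow> es \<noteq> [] \<and> fst (hd es) \<in> F \<and> ewalk E (fst (hd es)) es s \<and>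
     snd ` set es \<inter> F = {} \<and> distinct (map snd es)"

lemma fpath_def': "fpath E F s = (THE es. exit_path E F es s)"
  unfolding fpath_def
  by (rule arg_cong[where f=The], rule ext)
     (unfold exit_path_def, use ewalk_iff[where E=E and w=s] in blast)

lemma exit_path_vpath:
  assumes "exit_path E F es s"
  shows "vpath E (fst (hd es) # map snd es)" "last (fst (hd es) # map snd es) = s"
proof -
  have "distinct (fst (hd es) # map snd es)"
    using assms by (auto simp: exit_path_def)
  then show "vpath E (fst (hd es) # map snd es)" "last (fst (hd es) # map snd es) = s"
    using assms ewalk_imp_vpath[of E "fst (hd es)" es s] by (auto simp: exit_path_def)
qed

text \<open>Cut \<open>p\<close> at its last visit to \<open>F\<close>; the remaining part is the
  exit path.\<close>

lemma vpath_exit_path: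
  assumes "vpath E p" "hd p \<in> F" "last p \<notin> F"
  shows "\<exists>es. exit_path E F es (last p) \<and> snd ` set es \<subseteq> set p"
proof -
  have "\<exists>x\<in>set p. x \<in> F" using assms(1,2) by (metis hd_in_set vpath_def)
  then obtain ys x zs where p: "p = ys @ x # zs" "x \<in> F" "\<forall>z\<in>set zs. z \<notin> F"
    using split_list_last_prop[of p "\<lambda>x. x \<in> F"] by blast
  then obtain z zs' where zs: "zs = z # zs'" using assms(3) by (cases zs) auto
  have vp: "vpath E (x # zs)" using assms(1) vpath_suffix[of E ys x zs] p by simp
  define es where "es = zip (x # zs) zs"
  have map: "map snd es = zs" by (simp add: es_def)
  have "ewalk E x es (last (x # zs))" unfolding es_def by (rule vpath_imp_ewalk[OF vp])
  moreover have "fst (hd es) = x" "es \<noteq> []" by (auto simp: es_def zs)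
  moreover have "snd ` set es = set zs" using map by (metis list.set_map)
  ultimately have "exit_path E F es (last p)"
    using p vp map unfolding exit_path_def by (auto simp: vpath_def)
  then show ?thesis using p \<open>snd ` set es = set zs\<close> by (intro exI[of _ es]) auto
qed

lemma exit_path_snoc:
  assumes "exit_path E F es s" "E s w" "w \<notin> F" "w \<notin> snd ` set es"
  shows "exit_path E F (es @ [(s, w)]) w"
  using assms by (auto simp: exit_path_def ewalk_append)

lemma exit_path_take:
  assumes "exit_path E F (es @ e # es') s"
  shows "exit_path E F (es @ [e]) (snd e)"
proof -
  have "hd (es @ e # es') = hd (es @ [e])" by (cases es) auto
  then show ?thesis using assms by (auto simp: exit_path_def ewalk_append)
qed

text \<open>The vertices stay distinct because \<open>es1\<close> runs inside \<open>F'\<close> and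
  \<open>es2\<close> outside it.\<close>

lemma exit_path_mono_append:
  assumes "exit_path E F es1 u" "exit_path E F' es2 s" "fst (hd es2) = u"
    "F \<subseteq> F'" "snd ` set es1 \<subseteq> F'"
  shows "exit_path E F (es1 @ es2) s"
  using assms by (fastforce simp: exit_path_def ewalk_append)

lemma exit_path_subset:
  assumes "exit_path E F' es s" "fst (hd es) \<in> F" "F \<subseteq> F'"
  shows "exit_path E F es s"
  using assms by (auto simp: exit_path_def)

section \<open>Finite subtrees and the path from a subtree to a vertex\<close>

locale tree =
  fixes V :: "'v set" and E :: "'v \<Rightarrow> 'v \<Rightarrow> bool"
  assumes is_tree: "is_tree V E"
begin

lemma E_V: "E u w \<Longrightarrow> u \<in> V \<and> w \<in> V" using is_tree by (auto simp: is_tree_def)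
lemma E_sym: "E u w \<Longrightarrow> E w u" using is_tree by (auto simp: is_tree_def)
lemma E_irrefl: "\<not> E u u" using is_tree by (auto simp: is_tree_def)

lemma oedges_iff: "e \<in> oedges V E \<longleftrightarrow> E (fst e) (snd e)"
  using E_V by (auto simp: oedges_def)

lemma vpath_last_V: "vpath E p \<Longrightarrow> hd p \<in> V \<Longrightarrow> last p \<in> V"
proof (induction p)
  case (Cons a p)
  then show ?case using E_V by (cases p) (auto simp: vpath_Cons)
qed (auto simp: vpath_def)

lemma path_unique:
  assumes "vpath E p" "vpath E q" "hd p = hd q" "last p = last q" "hd p \<in> V"
  shows "p = q"
  using is_tree assms vpath_last_V[of p] unfolding is_tree_def by metis

lemma path_ex: "u \<in> V \<Longrightarrow> w \<in> V \<Longrightarrow> \<exists>p. vpath E p \<and> hd p = u \<and> last p = w"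
  using is_tree unfolding is_tree_def by metis

text \<open>Connectedness of \<open>F\<close> supplies a path inside \<open>F\<close>, and the tree
  has no other path between the same vertices.\<close>

lemma subtree_path:
  assumes "F \<in> subtrees V E" "vpath E p" "hd p \<in> F" "last p \<in> F"
  shows "set p \<subseteq> F"
proof -
  obtain q where "vpath E q" "hd q = hd p" "last q = last p" "set q \<subseteq> F"
    using assms unfolding subtrees_def by blast
  moreover have "hd p \<in> V" using assms(1,3) unfolding subtrees_def by blast
  ultimately show ?thesis using path_unique[of p q] assms(2) by auto
qed

lemma subtreeD:
  assumes "F \<in> subtrees V E" shows "finite F" "F \<noteq> {}" "F \<subseteq> V"
  using assms by (auto simp: subtrees_def)

lemma subtree_path_ex:
  assumes "F \<in> subtrees V E" "u \<in> F" "w \<in> F"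
  obtains p where "vpath E p" "hd p = u" "last p = w" "set p \<subseteq> F"
  using assms unfolding subtrees_def by blast

lemma subtree_singleton: "t \<in> V \<Longrightarrow> {t} \<in> subtrees V E"
  by (auto simp: subtrees_def intro!: exI[of _ "[t]"])

lemma subtree_insert:
  assumes F: "F \<in> subtrees V E" and u: "u \<in> F" and E: "E u w"
  shows "insert w F \<in> subtrees V E"
proof (cases "w \<in> F")
  case True then show ?thesis using F by (simp add: insert_absorb)
next
  case False
  have "\<exists>p. vpath E p \<and> hd p = a \<and> last p = b \<and> set p \<subseteq> insert w F"
    if a: "a \<in> insert w F" and b: "b \<in> insert w F" for a b
  proof -
    consider "a = w" "b = w" | "a = w" "b \<in> F" | "a \<in> F" "b = w" | "a \<in> F" "b \<in> F"
      using a b by auto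
    then show ?thesis
    proof cases
      case 1 then show ?thesis by (intro exI[of _ "[w]"]) auto
    next
      case 2
      then obtain p where p: "vpath E p" "hd p = u" "last p = b" "set p \<subseteq> F"
        using subtree_path_ex F u by metis
      then obtain p' where "p = u # p'" by (cases p) (auto simp: vpath_def)
      then show ?thesis using p False E_sym[OF E] 2
        by (intro exI[of _ "w # p"]) (auto simp: vpath_Cons)
    next
      case 3
      then obtain p where p: "vpath E p" "hd p = a" "last p = u" "set p \<subseteq> F"
        using subtree_path_ex F u by metis
      then obtain p' where p': "p = p' @ [u]" by (cases p rule: rev_cases) (auto simp: vpath_def)
      have "vpath E (p' @ u # [w])"
        using p p' False E vpath_append[of E p' u "[w]"] u by (auto simp: vpath_Cons)
      then show ?thesis using p p' 3
        by (intro exI[of _ "p @ [w]"]) (auto simp: hd_append split: if_splits)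
    next
      case 4 then show ?thesis using subtree_path_ex[OF F] by (metis subset_insertI2)
    qed
  qed
  then show ?thesis using F E E_V by (auto simp: subtrees_def)
qed

lemma subtree_extend:
  assumes F: "F \<in> subtrees V E" and s: "s \<in> V"
  shows "\<exists>F'\<in>subtrees V E. F \<subseteq> F' \<and> s \<in> F'"
proof -
  obtain u where u: "u \<in> F" using F by (auto simp: subtrees_def)
  obtain p where p: "vpath E p" "hd p = u" "last p = s"
    using path_ex u s subtreeD(3)[OF F] by blast
  \<comment> \<open>The vertices of \<open>p\<close> are added one at a time; \<open>F\<close> is
    generalised because it grows along the induction.\<close>
  have "vpath E p \<Longrightarrow> hd p = u \<Longrightarrow> last p = s \<Longrightarrow> u \<in> F \<Longrightarrow> F \<in> subtrees V E \<Longrightarrow>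
      \<exists>F'\<in>subtrees V E. F \<subseteq> F' \<and> s \<in> F'" for p u F
  proof (induction p arbitrary: u F)
    case (Cons a p)
    show ?case
    proof (cases p)
      case Nil then show ?thesis using Cons.prems by auto
    next
      case (Cons b q)
      then have "E u b" "vpath E p" using Cons.prems by (auto simp: vpath_Cons)
      then have "insert b F \<in> subtrees V E" using Cons.prems subtree_insert by blast
      then have "\<exists>F'\<in>subtrees V E. insert b F \<subseteq> F' \<and> s \<in> F'"
        using Cons.IH[of b "insert b F"] Cons Cons.prems(3) \<open>vpath E p\<close> by simp
      then show ?thesis by blast
    qed
  qed (auto simp: vpath_def)
  then show ?thesis using p u F by blast
qed

lemma subtree_extend_set:
  assumes F: "F \<in> subtrees V E" and "finite A" "A \<subseteq> V"
  shows "\<exists>F'\<in>subtrees V E. F \<subseteq> F' \<and> A \<subseteq> F'"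
  using assms(2,3)
proof (induction A rule: finite_induct)
  case empty then show ?case using F by auto
next
  case (insert a A)
  then obtain F' where F': "F' \<in> subtrees V E" "F \<subseteq> F'" "A \<subseteq> F'" by auto
  moreover obtain F'' where "F'' \<in> subtrees V E" "F' \<subseteq> F''" "a \<in> F''"
    using subtree_extend[OF F'(1), of a] insert.prems by auto
  ultimately show ?case by (intro bexI[of _ F'']) auto
qed

text \<open>The two start vertices may differ a priori. Putting the path inside \<open>F\<close>
  from \<open>?u\<close> to \<open>?u'\<close> in front of \<open>es'\<close> gives another path
  from \<open>?u\<close> to \<open>s\<close>, so it coincides with \<open>es\<close>. As
  \<open>es\<close> never returns to \<open>F\<close>, the added part is trivial.\<close>

lemma exit_path_unique:
  assumes F: "F \<in> subtrees V E" and es: "exit_path E F es s" and es': "exit_path E F es' s"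
  shows "es = es'"
proof -
  let ?u = "fst (hd es)" and ?u' = "fst (hd es')"
  have u: "?u \<in> F" "?u' \<in> F" using es es' by (auto simp: exit_path_def)
  obtain p where p: "vpath E p" "hd p = ?u" "last p = ?u'" "set p \<subseteq> F"
    using subtree_path_ex[OF F] u by metis
  then obtain p' where p': "p = p' @ [?u']" by (cases p rule: rev_cases) (auto simp: vpath_def)
  have disj: "set p \<inter> snd ` set es' = {}" using p es' by (auto simp: exit_path_def)
  have "vpath E (p' @ ?u' # map snd es')"
    using vpath_append[of E p' ?u' "map snd es'"] p p' exit_path_vpath(1)[OF es'] disj by auto
  moreover have "hd (p' @ ?u' # map snd es') = ?u" using p p' by (cases p') auto
  moreover have "last (p' @ ?u' # map snd es') = s" using exit_path_vpath(2)[OF es'] by simp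
  moreover have "?u \<in> V" using u subtreeD(3)[OF F] by auto
  ultimately have eq: "p' @ ?u' # map snd es' = ?u # map snd es"
    using exit_path_vpath[OF es] by (intro path_unique) simp_all
  have "p' = []"
  proof (cases p')
    case (Cons a q)
    then have "?u' \<in> set (map snd es)" using eq by (metis append_Cons in_set_conv_decomp list.inject)
    then show ?thesis using es u by (auto simp: exit_path_def)
  qed auto
  then have "?u = ?u'" "map snd es = map snd es'" using eq by auto
  then show ?thesis using ewalk_eq_zip[of E ?u es s] ewalk_eq_zip[of E ?u' es' s] es es'
    by (auto simp: exit_path_def)
qed

lemma fpath_eq: "F \<in> subtrees V E \<Longrightarrow> exit_path E F es s \<Longrightarrow> fpath E F s = es"
  unfolding fpath_def' using exit_path_unique by blast

lemma exit_path_ex: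
  assumes F: "F \<subseteq> F'" "F \<noteq> {}" "F' \<in> subtrees V E" and s: "s \<in> F' - F"
  shows "\<exists>es. exit_path E F es s \<and> snd ` set es \<subseteq> F'"
proof -
  obtain u where u: "u \<in> F" using F by auto
  then obtain p where p: "vpath E p" "hd p = u" "last p = s" "set p \<subseteq> F'"
    using subtree_path_ex[OF F(3), of u s] F s by blast
  then show ?thesis using vpath_exit_path[of E p F] u s by auto
qed

lemma fpath_in:
  assumes "F \<subseteq> F'" "F \<in> subtrees V E" "F' \<in> subtrees V E" "s \<in> F' - F"
  shows "snd ` set (fpath E F s) \<subseteq> F'"
  using exit_path_ex[of F F' s] assms fpath_eq subtreeD(2) by metis

lemma fpath_exit:
  assumes F: "F \<in> subtrees V E" and s: "s \<in> V - F"
  shows "exit_path E F (fpath E F s) s"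
proof -
  obtain F' where "F' \<in> subtrees V E" "F \<subseteq> F'" "s \<in> F'" using subtree_extend[OF F] s by blast
  then show ?thesis using exit_path_ex[of F F' s] F s fpath_eq subtreeD(2) by (metis DiffD2 DiffI)
qed

lemma fpath_edge:
  assumes "F \<in> subtrees V E" "u \<in> F" "E u w" "w \<notin> F"
  shows "fpath E F w = [(u, w)]"
  using assms by (intro fpath_eq) (auto simp: exit_path_def)

text \<open>The path to \<open>s\<close> leaves \<open>F'\<close> at \<open>u\<close>. Either
  \<open>u\<close> is already in \<open>F\<close>, or the path first runs inside \<open>F'\<close>
  from \<open>F\<close> to \<open>u\<close>. This is why the bonding maps compose.\<close>

lemma fpath_comp:
  assumes F: "F \<in> subtrees V E" and F': "F' \<in> subtrees V E" and sub: "F \<subseteq> F'" and s: "s \<in> V - F'"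
  defines "u \<equiv> fst (hd (fpath E F' s))"
  shows "u \<in> F \<Longrightarrow> fpath E F s = fpath E F' s"
    and "u \<notin> F \<Longrightarrow> fpath E F s = fpath E F u @ fpath E F' s"
proof -
  have ex': "exit_path E F' (fpath E F' s) s" by (rule fpath_exit[OF F' s])
  then have uF': "u \<in> F'" by (auto simp: u_def exit_path_def)
  show "fpath E F s = fpath E F' s" if "u \<in> F"
    using exit_path_subset[OF ex' _ sub] that by (intro fpath_eq[OF F]) (auto simp: u_def)
  show "fpath E F s = fpath E F u @ fpath E F' s" if "u \<notin> F"
  proof (intro fpath_eq[OF F] exit_path_mono_append[OF _ ex'])
    show "exit_path E F (fpath E F u) u" using fpath_exit[OF F] uF' that subtreeD[OF F'] by auto
    show "snd ` set (fpath E F u) \<subseteq> F'" using fpath_in[OF sub F F'] uF' that by auto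
  qed (use u_def sub in auto)
qed

text \<open>If \<open>s'\<close> is not on the path to \<open>s\<close>, that path extends by one
  edge. If it is, cutting there and appending the edge back to \<open>s\<close> is again an exit
  path to \<open>s\<close>, hence the original one.\<close>

lemma fpath_adj:
  assumes F: "F \<in> subtrees V E" and s: "s \<notin> F" "s' \<notin> F" and E: "E s s'"
  shows "fpath E F s' = fpath E F s @ [(s, s')] \<or> fpath E F s = fpath E F s' @ [(s', s)]"
proof -
  let ?es = "fpath E F s"
  have V: "s \<in> V - F" using E_V[OF E] s by auto
  have ex: "exit_path E F ?es s" by (rule fpath_exit[OF F V])
  show ?thesis
  proof (cases "s' \<in> snd ` set ?es")
    case False
    then show ?thesis using exit_path_snoc[OF ex E s(2)] fpath_eq[OF F] by blast
  next
    case True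
    then obtain e where e: "e \<in> set ?es" "snd e = s'" by auto
    then obtain as bs where es: "?es = as @ e # bs" by (meson split_list)
    have ex1: "exit_path E F (as @ [e]) s'" using exit_path_take ex es e by metis
    have "s \<noteq> s'" using E E_irrefl by auto
    then have "bs \<noteq> []" using ex es e ewalk_last unfolding exit_path_def
      by (metis last_snoc snoc_eq_iff_butlast)
    then have "s \<in> snd ` set bs" using ex es ewalk_last unfolding exit_path_def
      by (metis append_is_Nil_conv image_eqI last_ConsR last_appendR last_in_set list.distinct(1))
    moreover have "distinct (map snd as @ snd e # map snd bs)"
      using ex es unfolding exit_path_def by simp
    then have "snd e \<notin> snd ` set bs" "snd ` set as \<inter> snd ` set bs = {}"
      by (simp_all add: Int_Un_distrib)
    ultimately have "s \<noteq> snd e" "s \<notin> snd ` set as" by blast+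
    then have "s \<notin> snd ` set (as @ [e])" by simp
    then have "exit_path E F ((as @ [e]) @ [(s', s)]) s"
      by (rule exit_path_snoc[OF ex1 E_sym[OF E] s(1)])
    then show ?thesis using fpath_eq[OF F] ex1 by metis
  qed
qed

lemma out_edges_iff: "e \<in> out_edges V E F \<longleftrightarrow> E (fst e) (snd e) \<and> fst e \<in> F \<and> snd e \<notin> F"
  by (auto simp: out_edges_def oedges_iff)

lemma fpath_hd:
  assumes "F \<in> subtrees V E" "s \<in> V - F"
  shows "fpath E F s \<noteq> []" "hd (fpath E F s) \<in> out_edges V E F"
    "snd (last (fpath E F s)) = s"
proof -
  have *: "exit_path E F (fpath E F s) s" by (rule fpath_exit[OF assms])
  then show 1: "fpath E F s \<noteq> []" by (simp add: exit_path_def)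
  show "snd (last (fpath E F s)) = s"
    using * ewalk_last[of E "fst (hd (fpath E F s))" "fpath E F s" s] by (simp add: exit_path_def)
  have "hd (fpath E F s) \<in> set (fpath E F s)" using 1 by simp
  moreover from this have "snd (hd (fpath E F s)) \<notin> F"
    using * unfolding exit_path_def by blast
  moreover have "E (fst e) (snd e)" if "e \<in> set (fpath E F s)" for e
    using ewalk_edges[of E "fst (hd (fpath E F s))" "fpath E F s" s e] * that
    unfolding exit_path_def by blast
  ultimately show "hd (fpath E F s) \<in> out_edges V E F"
    using * by (simp add: out_edges_iff exit_path_def)
qed

text \<open>Replaces the existential path of \<open>exits_to\<close> by \<open>fpath\<close>, so the
  edge through which \<open>s\<close> is seen from \<open>F\<close> becomes a function of
  \<open>s\<close>.\<close>

lemma exits_to_iff: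
  assumes F: "F \<in> subtrees V E" and e: "fst e \<in> F"
  shows "exits_to E F e s \<longleftrightarrow> s \<in> V - F \<and> e = hd (fpath E F s)"
proof
  assume "exits_to E F e s"
  then obtain p where p: "vpath E p" "2 \<le> length p" "hd p = fst e" "p ! 1 = snd e"
    "last p = s" "set (tl p) \<inter> F = {}" by (auto simp: exits_to_def)
  then obtain a b q where q: "p = a # b # q" by (cases p; cases "tl p") auto
  have s: "s \<notin> F" using p q last_in_set[of "b # q"] by auto
  moreover have "s \<in> V" using vpath_last_V[of p] p e subtreeD(3)[OF F] by auto
  moreover have "exit_path E F (zip p (tl p)) s"
    using vpath_imp_ewalk[of E a "b # q"] p q e unfolding exit_path_def
    by (auto simp: vpath_def dest: set_zip_rightD)
  then have "fpath E F s = zip p (tl p)" by (rule fpath_eq[OF F])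
  ultimately show "s \<in> V - F \<and> e = hd (fpath E F s)" using p q by (auto simp: prod_eq_iff)
next
  assume s: "s \<in> V - F \<and> e = hd (fpath E F s)"
  let ?es = "fpath E F s"
  have ex: "exit_path E F ?es s" by (rule fpath_exit[OF F]) (use s in auto)
  then obtain e' q where "?es = e' # q" by (cases ?es) (auto simp: exit_path_def)
  then show "exits_to E F e s" unfolding exits_to_def
    using exit_path_vpath[OF ex] ex s
    by (intro exI[of _ "fst e # map snd ?es"]) (auto simp: exit_path_def)
qed

end

section \<open>Rays, and ends seen from a finite subtree\<close>

definition redges :: "(nat \<Rightarrow> 'v) \<Rightarrow> nat \<Rightarrow> 'v edge list" where
  "redges r n = map (\<lambda>i. (r i, r (Suc i))) [0..<n]"

lemma redges_0 [simp]: "redges r 0 = []" by (simp add: redges_def)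

lemma redges_Suc: "redges r (Suc n) = redges r n @ [(r n, r (Suc n))]"
  by (simp add: redges_def)

lemma redges_Suc': "redges r (Suc n) = (r 0, r 1) # redges (\<lambda>i. r (Suc i)) n"
proof (induction n)
  case (Suc n)
  then show ?case by (simp only: redges_Suc[of r "Suc n"] redges_Suc[of "\<lambda>i. r (Suc i)" n]) simp
qed (simp add: redges_Suc)

lemma redges_nonempty [simp]: "redges r (Suc n) \<noteq> []"
  by (simp add: redges_def)

lemma hd_redges [simp]: "hd (redges r (Suc n)) = (r 0, r (Suc 0))"
  by (simp add: redges_Suc')

lemma last_redges [simp]: "last (redges r (Suc n)) = (r n, r (Suc n))"
  by (simp add: redges_Suc)

definition exit_ray :: "'v set \<Rightarrow> ('v \<Rightarrow> 'v \<Rightarrow> bool) \<Rightarrow> 'v set \<Rightarrow> (nat \<Rightarrow> 'v) \<Rightarrow> bool" where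
  "exit_ray V E F r \<longleftrightarrow> is_ray V E r \<and> r 0 \<in> F \<and> (\<forall>n\<ge>1. r n \<notin> F)"

lemma is_ray_shift: "is_ray V E r \<Longrightarrow> is_ray V E (\<lambda>n. r (n + k))"
  by (auto simp: is_ray_def intro!: injI dest: injD)

lemma ewalk_redges: "is_ray V E r \<Longrightarrow> ewalk E (r 0) (redges r n) (r n)"
  by (induction n) (auto simp: redges_Suc ewalk_append is_ray_def)

lemma map_snd_redges: "map snd (redges r n) = map r [1..<Suc n]"
  by (induction n) (auto simp: redges_Suc)

lemma vpath_ray:
  assumes "is_ray V E r" shows "vpath E (map r [0..<Suc n])"
proof -
  have "map r [0..<Suc n] = r 0 # map snd (redges r n)"
    by (simp add: map_snd_redges upt_conv_Cons del: upt_Suc)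
  moreover have "distinct (map r [0..<Suc n])"
    using assms by (auto simp: is_ray_def distinct_map intro: inj_on_subset dest: injD)
  ultimately show ?thesis using ewalk_imp_vpath[OF ewalk_redges[OF assms, of n]] by simp
qed

lemma exit_ray_path:
  assumes "exit_ray V E F r" "n \<ge> 1"
  shows "exit_path E F (redges r n) (r n)"
proof -
  have "is_ray V E r" using assms by (simp add: exit_ray_def)
  have ms: "map snd (redges r n) = map r [1..<Suc n]" by (rule map_snd_redges)
  then have "snd ` set (redges r n) = r ` {1..<Suc n}" by (metis list.set_map set_upt)
  moreover have "distinct (map r [1..<Suc n])"
    using \<open>is_ray V E r\<close> by (auto simp: is_ray_def distinct_map intro: inj_on_subset dest: injD)
  moreover have "redges r n \<noteq> []" "fst (hd (redges r n)) = r 0"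
    using assms(2) by (cases n; auto simp: redges_Suc')+
  ultimately show ?thesis using assms ms ewalk_redges[OF \<open>is_ray V E r\<close>]
    unfolding exit_path_def exit_ray_def by auto
qed

context tree
begin

text \<open>An injective ray meets the finite set \<open>F\<close> only finitely often;
  \<open>N\<close> is the last visit. Between \<open>m\<close> and \<open>N\<close> the ray cannot
  leave \<open>F\<close>, because subtrees are convex.\<close>

lemma exit_ray_shift:
  assumes r: "is_ray V E r" and F: "F \<in> subtrees V E" and m: "r m \<in> F"
  shows "\<exists>N\<ge>m. exit_ray V E F (\<lambda>n. r (n + N)) \<and> (\<forall>i. m \<le> i \<and> i \<le> N \<longrightarrow> r i \<in> F)"
proof -
  let ?A = "{n. r n \<in> F}"
  have inj: "inj r" using r by (simp add: is_ray_def)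
  have fin: "finite ?A" using finite_vimageI[OF subtreeD(1)[OF F] inj] by (simp add: vimage_def)
  define N where "N = Max ?A"
  have N: "r N \<in> F" "m \<le> N" using Max_in[OF fin] Max_ge[OF fin] m by (auto simp: N_def)
  have out: "r k \<notin> F" if "k > N" for k using Max_ge[OF fin, of k] that by (auto simp: N_def)
  have "r i \<in> F" if "m \<le> i" "i \<le> N" for i
  proof -
    define k where "k = N - m"
    have "vpath E (map (\<lambda>n. r (n + m)) [0..<Suc k])" using vpath_ray[OF is_ray_shift[OF r]] .
    moreover have "hd (map (\<lambda>n. r (n + m)) [0..<Suc k]) = r m"
      by (simp add: upt_conv_Cons del: upt_Suc)
    moreover have "last (map (\<lambda>n. r (n + m)) [0..<Suc k]) = r N" using N by (simp add: k_def)
    ultimately have "set (map (\<lambda>n. r (n + m)) [0..<Suc k]) \<subseteq> F"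
      using subtree_path[OF F] m N by metis
    then show ?thesis using that k_def N(1) by (cases "i = N") (auto simp: image_subset_iff dest!: bspec[of _ _ "i - m"])
  qed
  then show ?thesis using N out is_ray_shift[OF r] by (intro exI[of _ N]) (auto simp: exit_ray_def)
qed

text \<open>Far out both rays pass through the same vertex, and the exit path to it is unique.
  Comparing lengths forces the shift between the rays to be zero.\<close>

lemma exit_ray_unique:
  assumes F: "F \<in> subtrees V E" and r: "exit_ray V E F r" and r': "exit_ray V E F r'"
    and tails: "\<forall>n. r (i + n) = r' (j + n)"
  shows "r = r'"
proof -
  have eq: "i + n = j + n \<and> (\<forall>m\<le>i+n. r m = r' m)" if n: "n \<ge> 1" for n
  proof -
    have "redges r (i + n) = redges r' (j + n)"
      using exit_path_unique[OF F exit_ray_path[OF r, of "i + n"]]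
        exit_ray_path[OF r', of "j + n"] tails n by auto
    moreover from this have "length (redges r (i + n)) = length (redges r' (j + n))" by simp
    then have ij: "i = j" by (simp add: redges_def)
    ultimately have "r m = r' m" if "m < i + n" for m
      using that by (auto simp: redges_def)
    then show ?thesis using ij tails by (metis le_neq_implies_less)
  qed
  show ?thesis
  proof
    fix m show "r m = r' m" using eq[of "Suc m"] by auto
  qed
qed

text \<open>In \<open>tree_ends\<close> an end is described from one reference ray; since tail
  equivalence is transitive, any of its rays can serve.\<close>

lemma tree_endsD:
  assumes "xi \<in> tree_ends V E" "r \<in> xi"
  shows "is_ray V E r" "r' \<in> xi \<longleftrightarrow> is_ray V E r' \<and> (\<exists>i j. \<forall>n. r' (i + n) = r (j + n))"
proof -
  obtain r0 where r0: "xi = {r'. is_ray V E r' \<and> (\<exists>i j. \<forall>n. r' (i + n) = r0 (j + n))}"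
    using assms(1) by (auto simp: tree_ends_def)
  show "is_ray V E r" using assms(2) r0 by auto
  obtain i j where ij: "\<forall>n. r (i + n) = r0 (j + n)" using assms(2) r0 by auto
  have "(\<exists>k l. \<forall>n. r' (k + n) = r0 (l + n)) \<longleftrightarrow> (\<exists>k l. \<forall>n. r' (k + n) = r (l + n))"
  proof
    assume "\<exists>k l. \<forall>n. r' (k + n) = r0 (l + n)"
    then obtain k l where "\<forall>n. r' (k + n) = r0 (l + n)" by auto
    then have "\<forall>n. r' ((k + j) + n) = r ((l + i) + n)"
      using ij by (metis add.assoc add.commute)
    then show "\<exists>k l. \<forall>n. r' (k + n) = r (l + n)" by blast
  next
    assume "\<exists>k l. \<forall>n. r' (k + n) = r (l + n)"
    then obtain k l where "\<forall>n. r' (k + n) = r (l + n)" by auto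
    then have "\<forall>n. r' ((k + i) + n) = r0 ((l + j) + n)"
      using ij by (metis add.assoc add.commute)
    then show "\<exists>k l. \<forall>n. r' (k + n) = r0 (l + n)" by blast
  qed
  then show "r' \<in> xi \<longleftrightarrow> is_ray V E r' \<and> (\<exists>i j. \<forall>n. r' (i + n) = r (j + n))"
    using r0 by simp
qed

lemma tree_ends_nonempty: "xi \<in> tree_ends V E \<Longrightarrow> xi \<noteq> {}"
  by (force simp: tree_ends_def)

lemma shift_in_end:
  assumes "xi \<in> tree_ends V E" "r \<in> xi" shows "(\<lambda>n. r (n + k)) \<in> xi"
proof -
  have "\<exists>i j. \<forall>n. r ((i + n) + k) = r (j + n)"
    by (intro exI[of _ 0] exI[of _ k]) (simp add: add.commute)
  then show ?thesis
    by (intro tree_endsD(2)[OF assms, THEN iffD2] conjI is_ray_shift tree_endsD(1)[OF assms])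
qed

lemma ray_end: "is_ray V E r \<Longrightarrow> \<exists>xi\<in>tree_ends V E. r \<in> xi"
  unfolding tree_ends_def by (rule bexI[where x="{r'. is_ray V E r' \<and> (\<exists>i j. \<forall>n. r' (i + n) = r (j + n))}"]) auto

lemma exit_ray_in_end_unique:
  assumes "F \<in> subtrees V E" "xi \<in> tree_ends V E" "r \<in> xi" "r' \<in> xi" "exit_ray V E F r" "exit_ray V E F r'"
  shows "r = r'"
proof -
  obtain i j where "\<forall>n. r (i + n) = r' (j + n)"
    using tree_endsD(2)[OF assms(2,4)] assms(3) by blast
  then show ?thesis using exit_ray_unique assms by blast
qed

text \<open>Choose \<open>F'\<close> containing \<open>F\<close> and the start of some ray of the
  end, and cut that ray at its last visit to \<open>F'\<close>. The path from \<open>F\<close> to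
  the cut vertex stays in \<open>F'\<close> and the rest of the ray outside, so joining them gives
  an injective ray.\<close>

lemma exit_ray_ex:
  assumes F: "F \<in> subtrees V E" and xi: "xi \<in> tree_ends V E"
  shows "\<exists>r\<in>xi. exit_ray V E F r"
proof -
  obtain r0 where r0: "r0 \<in> xi" using tree_ends_nonempty[OF xi] by auto
  note r0D = tree_endsD[OF xi r0]
  have "r0 0 \<in> V" using r0D by (auto simp: is_ray_def)
  then obtain F' where F': "F' \<in> subtrees V E" "F \<subseteq> F'" "r0 0 \<in> F'" using subtree_extend[OF F] by blast
  then obtain N where N: "exit_ray V E F' (\<lambda>n. r0 (n + N))"
    using exit_ray_shift[OF r0D(1) F'(1), of 0] by blast
  define r1 where "r1 = (\<lambda>n. r0 (n + N))"
  have r1: "r1 \<in> xi" "exit_ray V E F' r1" using shift_in_end[OF xi r0] N by (auto simp: r1_def)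
  show ?thesis
  proof (cases "r1 0 \<in> F")
    case True then show ?thesis using r1 F' by (auto simp: exit_ray_def)
  next
    case False
    then have s: "r1 0 \<in> F' - F" using r1 by (auto simp: exit_ray_def)
    define es where "es = fpath E F (r1 0)"
    define p where "p = fst (hd es) # map snd es"
    have ex: "exit_path E F es (r1 0)" using fpath_exit[OF F] s subtreeD(3)[OF F'(1)] by (auto simp: es_def)
    have p: "vpath E p" "last p = r1 0" using exit_path_vpath[OF ex] by (auto simp: p_def)
    have pF': "set p \<subseteq> F'" using fpath_in[OF F'(2) F F'(1) s] ex F'(2) by (auto simp: p_def es_def exit_path_def)
    define l where "l = length p"
    have l2: "l \<ge> 1" by (auto simp: l_def p_def)
    \<comment> \<open>The vertex \<open>r1 0\<close> is already the last entry of \<open>p\<close>,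
      so position \<open>l\<close> continues with \<open>r1 1\<close>.\<close>
    define r where "r = (\<lambda>n. if n < l then p ! n else r1 (n - l + 1))"
    have r1out: "r1 n \<notin> F'" if "n \<ge> 1" for n using r1 that by (auto simp: exit_ray_def)
    have rp: "r n \<in> F'" if "n < l" for n using that pF' by (auto simp: r_def l_def)
    have injr1: "inj r1" and r1E: "\<And>n. E (r1 n) (r1 (Suc n))" using r1 by (auto simp: exit_ray_def is_ray_def)
    have "inj r"
    proof (rule injI)
      fix a b assume ab: "r a = r b"
      consider "a < l" "b < l" | "a < l" "b \<ge> l" | "a \<ge> l" "b < l" | "a \<ge> l" "b \<ge> l" by linarith
      then show "a = b"
      proof cases
        case 1 then show ?thesis using ab p(1) by (auto simp: r_def l_def vpath_def nth_eq_iff_index_eq)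
      next
        case 2 then show ?thesis using rp[of a] ab r1out[of "b - l + 1"] by (simp add: r_def)
      next
        case 3 then show ?thesis using rp[of b] ab r1out[of "a - l + 1"] by (simp add: r_def)
      next
        case 4
        then have "r1 (a - l + 1) = r1 (b - l + 1)" using ab by (simp add: r_def)
        then show ?thesis using injD[OF injr1] 4 by fastforce
      qed
    qed
    moreover have rE: "E (r n) (r (Suc n))" for n
    proof -
      consider "Suc n < l" | "Suc n = l" | "n \<ge> l" by linarith
      then show ?thesis
      proof cases
        case 1 then show ?thesis using p(1) by (auto simp: r_def l_def vpath_def)
      next
        case 2
        then have "r n = r1 0" using p(2) last_conv_nth[of p] l2 unfolding r_def l_def
          by (metis One_nat_def diff_Suc_1 lessI list.size(3) not_one_le_zero)
        then show ?thesis using 2 r1E[of 0] by (simp add: r_def)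
      next
        case 3 then show ?thesis using r1E[of "n - l + 1"] by (simp add: r_def Suc_diff_le)
      qed
    qed
    ultimately have ray: "is_ray V E r" using E_V by (auto simp: is_ray_def)
    have "\<forall>n. r (l + n) = r1 (1 + n)" by (simp add: r_def)
    then have "r \<in> xi" using tree_endsD(2)[OF xi r1(1)] ray by blast
    moreover have "exit_ray V E F r"
    proof -
      have "r 0 \<in> F" using l2 ex by (auto simp: r_def p_def exit_path_def)
      moreover have "r n \<notin> F" if "n \<ge> 1" for n
      proof (cases "n < l")
        case True
        then have "r n = map snd es ! (n - 1)" using that by (simp add: r_def p_def nth_Cons')
        moreover have "n - 1 < length (map snd es)" using True that by (auto simp: l_def p_def)
        ultimately have "r n \<in> set (map snd es)" using nth_mem by metis
        then show ?thesis using ex by (auto simp: exit_path_def)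
      next
        case False
        then show ?thesis using r1out[of "n - l + 1"] F' by (auto simp: r_def)
      qed
      ultimately show ?thesis using ray by (auto simp: exit_ray_def)
    qed
    ultimately show ?thesis by blast
  qed
qed

text \<open>The representative of the end that starts in \<open>F\<close> and leaves it at once; its
  first edge is the edge leaving \<open>F\<close> that points to \<open>xi\<close>.\<close>

definition fray :: "'v set \<Rightarrow> (nat \<Rightarrow> 'v) set \<Rightarrow> (nat \<Rightarrow> 'v)" where
  "fray F xi = (THE r. r \<in> xi \<and> exit_ray V E F r)"

lemma fray_eq:
  "F \<in> subtrees V E \<Longrightarrow> xi \<in> tree_ends V E \<Longrightarrow> r \<in> xi \<Longrightarrow> exit_ray V E F r \<Longrightarrow> fray F xi = r"
  unfolding fray_def using exit_ray_in_end_unique by blast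

lemma fray:
  assumes "F \<in> subtrees V E" "xi \<in> tree_ends V E"
  shows "fray F xi \<in> xi" "exit_ray V E F (fray F xi)"
  using exit_ray_ex[OF assms] fray_eq[OF assms] by auto

text \<open>Enlarging the subtree only removes an initial segment of the ray, which
  \<open>F'\<close> has absorbed.\<close>

lemma fray_shift:
  assumes F: "F \<in> subtrees V E" and F': "F' \<in> subtrees V E" and sub: "F \<subseteq> F'" and xi: "xi \<in> tree_ends V E"
  obtains N where "fray F' xi = (\<lambda>n. fray F xi (n + N))" "\<forall>i\<le>N. fray F xi i \<in> F'"
proof -
  note fr = fray[OF F xi]
  have "is_ray V E (fray F xi)" "fray F xi 0 \<in> F'" using fr sub by (auto simp: exit_ray_def)
  then obtain N where N: "exit_ray V E F' (\<lambda>n. fray F xi (n + N))" "\<forall>i\<le>N. fray F xi i \<in> F'"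
    using exit_ray_shift[of "fray F xi" F' 0] F' by auto
  then show ?thesis using that fray_eq[OF F' xi shift_in_end[OF xi fr(1)]] by blast
qed

lemma exits_to_end_iff:
  assumes "F \<in> subtrees V E" "xi \<in> tree_ends V E" "fst e \<in> F"
  shows "exits_to_end F e xi \<longleftrightarrow> e = (fray F xi 0, fray F xi 1)"
proof
  assume "exits_to_end F e xi"
  then obtain r where r: "r \<in> xi" "r 0 = fst e" "r 1 = snd e" "\<forall>n\<ge>1. r n \<notin> F"
    by (auto simp: exits_to_end_def)
  then have "exit_ray V E F r" using assms tree_endsD(1) by (auto simp: exit_ray_def)
  then have "fray F xi = r" using fray_eq assms r by blast
  then show "e = (fray F xi 0, fray F xi 1)" using r by (simp add: prod_eq_iff)
next
  assume "e = (fray F xi 0, fray F xi 1)"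
  then show "exits_to_end F e xi" using fray[OF assms(1,2)]
    by (auto simp: exits_to_end_def exit_ray_def)
qed

lemma fray_edge:
  assumes "F \<in> subtrees V E" "xi \<in> tree_ends V E"
  shows "(fray F xi 0, fray F xi 1) \<in> out_edges V E F"
  using fray[OF assms] by (auto simp: exit_ray_def is_ray_def out_edges_iff)

lemma subtree_add_ray:
  assumes F: "F \<in> subtrees V E" and r: "exit_ray V E F r"
  shows "F \<union> r ` {..n} \<in> subtrees V E" "exit_ray V E (F \<union> r ` {..n}) (\<lambda>i. r (i + n))"
proof -
  show "F \<union> r ` {..n} \<in> subtrees V E"
  proof (induction n)
    case 0 then show ?case using F r by (simp add: exit_ray_def insert_absorb)
  next
    case (Suc n)
    then have "insert (r (Suc n)) (F \<union> r ` {..n}) \<in> subtrees V E"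
      using r by (intro subtree_insert[of _ "r n"]) (auto simp: exit_ray_def is_ray_def)
    then show ?case by (simp add: atMost_Suc)
  qed
  have "inj r" using r by (auto simp: exit_ray_def is_ray_def)
  then have "r (i + n) \<notin> r ` {..n}" if "i \<ge> 1" for i using that by (auto dest: injD)
  then show "exit_ray V E (F \<union> r ` {..n}) (\<lambda>i. r (i + n))"
    using r is_ray_shift[of V E r n] by (auto simp: exit_ray_def)
qed

end

section \<open>Gluing and quotient topologies\<close>

lemma equiv_glue_eq: "equiv A (glue_eq A P)"
proof -
  have "sym ((P \<union> P\<inverse>)\<^sup>*)" by (intro sym_rtrancl) (auto simp: sym_def)
  then show ?thesis
    by (auto simp: equiv_def glue_eq_def refl_on_def sym_def trans_def)
qed

text \<open>In all gluings below a point is identified with at most one other point, because the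
  \<open>\<Sigma>\<^sub>e\<close> at a vertex are disjoint.\<close>
lemma glue_eq_partner:
  assumes sym: "\<And>x y. (x, y) \<in> P \<Longrightarrow> (y, x) \<in> P"
    and fn: "\<And>x y z. (x, y) \<in> P \<Longrightarrow> (x, z) \<in> P \<Longrightarrow> y = z"
  shows "(x, y) \<in> glue_eq A P \<longleftrightarrow> x \<in> A \<and> y \<in> A \<and> (x = y \<or> (x, y) \<in> P)"
proof -
  have "P \<union> P\<inverse> = P" using sym by auto
  moreover have "(x, y) \<in> P\<^sup>* \<longleftrightarrow> x = y \<or> (x, y) \<in> P"
  proof
    assume "(x, y) \<in> P\<^sup>*"
    then show "x = y \<or> (x, y) \<in> P"
      by (induction rule: rtrancl_induct) (use sym fn in blast)+
  qed auto
  ultimately show ?thesis by (auto simp: glue_eq_def)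
qed

text \<open>The generating family in \<open>quot_top\<close> is already a topology: distinct classes
  are disjoint, so taking unions of classes commutes with intersections.\<close>

lemma openin_quot_top:
  assumes R: "equiv (topspace X) R"
  shows "openin (quot_top X R) U \<longleftrightarrow> U \<subseteq> topspace X // R \<and> openin X (\<Union>U)"
proof
  assume "openin (quot_top X R) U"
  then have "generate_topology_on {U. U \<subseteq> topspace X // R \<and> openin X (\<Union>U)} U"
    by (simp add: quot_top_def openin_topology_generated_by)
  then show "U \<subseteq> topspace X // R \<and> openin X (\<Union>U)"
  proof induction
    case (Int a b)
    have "\<Union>(a \<inter> b) = \<Union>a \<inter> \<Union>b"
    proof (intro equalityI subsetI)
      fix x assume "x \<in> \<Union>a \<inter> \<Union>b"
      then obtain c d where "c \<in> a" "x \<in> c" "d \<in> b" "x \<in> d" by auto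
      moreover from this have "c = d" using quotient_disj[OF R, of c d] Int.IH by auto
      ultimately show "x \<in> \<Union>(a \<inter> b)" by auto
    qed auto
    then show ?case using Int.IH by (auto simp: openin_Int)
  next
    case (UN K)
    have "\<Union>(\<Union>K) = \<Union>(Union ` K)" by auto
    moreover have "openin X (\<Union>(Union ` K))" by (rule openin_Union) (use UN.IH in auto)
    moreover have "\<Union>K \<subseteq> topspace X // R" using UN.IH by blast
    ultimately show ?case by simp
  qed auto
next
  assume "U \<subseteq> topspace X // R \<and> openin X (\<Union>U)"
  then show "openin (quot_top X R) U"
    unfolding quot_top_def by (intro topology_generated_by_Basis) auto
qed

lemma openin_quot_sum:
  assumes R: "equiv (Sigma I (\<lambda>i. topspace (X i))) R"
  shows "openin (quot_top (sum_topology X I) R) U \<longleftrightarrow> U \<subseteq> Sigma I (\<lambda>i. topspace (X i)) // R \<and>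
    (\<forall>i\<in>I. openin (X i) {x \<in> topspace (X i). R `` {(i, x)} \<in> U})"
proof -
  have ts: "topspace (sum_topology X I) = Sigma I (\<lambda>i. topspace (X i))" by (auto simp: o_def)
  have "\<Union>U = {r \<in> Sigma I (\<lambda>i. topspace (X i)). R `` {r} \<in> U}"
    if U: "U \<subseteq> Sigma I (\<lambda>i. topspace (X i)) // R"
  proof (intro equalityI subsetI)
    fix r assume "r \<in> \<Union>U"
    then obtain c where c: "c \<in> U" "r \<in> c" by auto
    then obtain a where a: "a \<in> Sigma I (\<lambda>i. topspace (X i))" "c = R `` {a}"
      using U by (auto elim!: quotientE)
    then have "(a, r) \<in> R" using c by auto
    then have "R `` {a} = R `` {r}" by (rule equiv_class_eq[OF R])
    moreover have "r \<in> Sigma I (\<lambda>i. topspace (X i))"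
      using \<open>(a, r) \<in> R\<close> equiv_type[OF R] by blast
    ultimately show "r \<in> {r \<in> Sigma I (\<lambda>i. topspace (X i)). R `` {r} \<in> U}" using c a by auto
  next
    fix r assume r: "r \<in> {r \<in> Sigma I (\<lambda>i. topspace (X i)). R `` {r} \<in> U}"
    then have "r \<in> R `` {r}" using equiv_class_self[OF R, of r] by blast
    then show "r \<in> \<Union>U" using r by blast
  qed
  then have "U \<subseteq> Sigma I (\<lambda>i. topspace (X i)) // R \<Longrightarrow>
      openin (sum_topology X I) (\<Union>U) \<longleftrightarrow>
      (\<forall>i\<in>I. openin (X i) {x \<in> topspace (X i). R `` {(i, x)} \<in> U})"
    by (auto simp: openin_sum_topology cong: conj_cong)
  then show ?thesis using openin_quot_top[of "sum_topology X I" R U] R ts by auto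
qed

text \<open>Open sets of classes are built below from predicates on representatives; invariance of
  \<open>P\<close> allows membership to be tested on any representative.\<close>

lemma class_in_image:
  assumes R: "equiv A R" and P: "\<And>r r'. (r, r') \<in> R \<Longrightarrow> P r \<longleftrightarrow> P r'" and r: "r \<in> A"
  shows "R `` {r} \<in> (\<lambda>r. R `` {r}) ` {r \<in> A. P r} \<longleftrightarrow> P r"
proof
  assume "R `` {r} \<in> (\<lambda>r. R `` {r}) ` {r \<in> A. P r}"
  then obtain r' where r': "r' \<in> A" "P r'" "R `` {r} = R `` {r'}" by auto
  then have "(r, r') \<in> R" using eq_equiv_class_iff[OF R r, of r'] by simp
  then show "P r" using P r' by blast
qed (use r in auto)

section \<open>Tree systems\<close>

text \<open>Instantiated twice: with the given tree system, and with the star at each vertex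
  \<open>t\<close>, whose limit is \<open>hat K\<^sub>t\<close>.\<close>

locale tree_system = tree V E
  for V :: "'v set" and E :: "'v \<Rightarrow> 'v \<Rightarrow> bool" +
  fixes K :: "'v \<Rightarrow> 'c topology" and Sg :: "'v edge \<Rightarrow> 'c set" and phi :: "'v edge \<Rightarrow> 'c \<Rightarrow> 'c"
  assumes Sg_sub: "E u w \<Longrightarrow> Sg (u, w) \<subseteq> topspace (K u)"
    and Sg_nonempty: "E u w \<Longrightarrow> Sg (u, w) \<noteq> {}"
    and phi_in: "E u w \<Longrightarrow> x \<in> Sg (u, w) \<Longrightarrow> phi (u, w) x \<in> Sg (w, u)"
    and phi_inv: "E u w \<Longrightarrow> x \<in> Sg (u, w) \<Longrightarrow> phi (w, u) (phi (u, w) x) = x"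
    and Sg_disj: "E u w \<Longrightarrow> E u w' \<Longrightarrow> x \<in> Sg (u, w) \<Longrightarrow> x \<in> Sg (u, w') \<Longrightarrow> w = w'"
begin

abbreviation "raw F \<equiv> ts_raw F K"
abbreviation "rel F \<equiv> ts_rel F E K Sg phi"
abbreviation "sat F U \<equiv> ts_saturated V E K Sg phi F U"
abbreviation "G F U \<equiv> ts_G V E K Sg phi F U"
abbreviation "tlim \<equiv> ts_lim V E K Sg phi"
abbreviation "KF F \<equiv> ts_KF E K Sg phi F"

definition good :: "'v set \<Rightarrow> ('v \<times> 'c) set set \<Rightarrow> 'v edge \<Rightarrow> bool" where
  "good F U e \<longleftrightarrow> (\<forall>x\<in>Sg e. rel F `` {(fst e, x)} \<in> U)"

lemma raw_iff: "(s, x) \<in> raw F \<longleftrightarrow> s \<in> F \<and> x \<in> topspace (K s)"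
  by (auto simp: ts_raw_def)

lemma equiv_rel: "equiv (raw F) (rel F)"
  by (simp add: ts_rel_def equiv_glue_eq)

lemma rel_iff:
  "((s, x), (s', x')) \<in> rel F \<longleftrightarrow> s \<in> F \<and> s' \<in> F \<and> x \<in> topspace (K s) \<and> x' \<in> topspace (K s') \<and>
    (s = s' \<and> x = x' \<or> E s s' \<and> x \<in> Sg (s, s') \<and> x' = phi (s, s') x)"
proof -
  let ?P = "ts_glue (oedges F E) Sg phi"
  have P: "((s, x), (s', x')) \<in> ?P \<longleftrightarrow> s \<in> F \<and> s' \<in> F \<and> E s s' \<and> x \<in> Sg (s, s') \<and> x' = phi (s, s') x"
    for s x s' x'
    by (auto simp: ts_glue_def oedges_def)
  have sym: "(b, a) \<in> ?P" if "(a, b) \<in> ?P" for a b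
    using that phi_in phi_inv E_sym by (cases a; cases b) (auto simp: P)
  have fn: "b = c" if "(a, b) \<in> ?P" "(a, c) \<in> ?P" for a b c
    using that Sg_disj by (cases a; cases b; cases c) (auto simp: P)
  have "((s, x), (s', x')) \<in> rel F \<longleftrightarrow> (s, x) \<in> raw F \<and> (s', x') \<in> raw F \<and>
      ((s, x) = (s', x') \<or> ((s, x), (s', x')) \<in> ?P)"
    unfolding ts_rel_def by (rule glue_eq_partner) (use sym fn in blast)+
  then show ?thesis by (auto simp: P raw_iff)
qed

lemma class_eq_iff:
  assumes "s \<in> F" "x \<in> topspace (K s)" "s' \<in> F" "x' \<in> topspace (K s')"
  shows "rel F `` {(s, x)} = rel F `` {(s', x')} \<longleftrightarrow>
    s = s' \<and> x = x' \<or> E s s' \<and> x \<in> Sg (s, s') \<and> x' = phi (s, s') x"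
proof -
  have "rel F `` {(s, x)} = rel F `` {(s', x')} \<longleftrightarrow> ((s, x), (s', x')) \<in> rel F"
    by (rule eq_equiv_class_iff[OF equiv_rel]) (use assms in \<open>auto simp: raw_iff\<close>)
  then show ?thesis using assms by (simp add: rel_iff)
qed

lemma phi_topspace: "E u w \<Longrightarrow> x \<in> Sg (u, w) \<Longrightarrow> phi (u, w) x \<in> topspace (K w)"
  using phi_in Sg_sub E_sym by blast

lemma class_glue:
  assumes "E s s'" "x \<in> Sg (s, s')" "s \<in> F" "s' \<in> F"
  shows "rel F `` {(s', phi (s, s') x)} = rel F `` {(s, x)}"
  using class_eq_iff[of s F x s' "phi (s, s') x"] assms Sg_sub phi_topspace by blast

lemma openin_KF:
  "openin (KF F) U \<longleftrightarrow> U \<subseteq> raw F // rel F \<and>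
    (\<forall>s\<in>F. openin (K s) {x \<in> topspace (K s). rel F `` {(s, x)} \<in> U})"
  using openin_quot_sum[of F K "rel F" U] equiv_rel[of F] by (simp add: ts_KF_def ts_raw_def)

lemma class_quotient: "s \<in> F \<Longrightarrow> x \<in> topspace (K s) \<Longrightarrow> rel F `` {(s, x)} \<in> raw F // rel F"
  by (intro quotientI) (simp add: raw_iff)

lemma quotient_class:
  assumes "c \<in> raw F // rel F"
  obtains s x where "s \<in> F" "x \<in> topspace (K s)" "c = rel F `` {(s, x)}"
  using assms by (auto elim!: quotientE simp: ts_raw_def)

lemma class_rep:
  assumes "s \<in> F" "x \<in> topspace (K s)" "(s', x') \<in> rel F `` {(s, x)}"
  shows "s' \<in> F" "x' \<in> topspace (K s')" "s = s' \<and> x = x' \<or> E s s' \<and> x \<in> Sg (s, s') \<and> x' = phi (s, s') x"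
  using assms by (auto simp: rel_iff)

lemma satD:
  assumes "sat F U" "e \<in> out_edges V E F" "x \<in> Sg e" "rel F `` {(fst e, x)} \<in> U"
  shows "good F U e"
  using assms unfolding ts_saturated_def good_def by blast

lemma fpath_hd_nbr:
  assumes F: "F \<in> subtrees V E" and s: "s \<in> V - F" "s' \<in> V - F" and E: "E s s'"
  shows "hd (fpath E F s) = hd (fpath E F s')"
  using fpath_adj[OF F _ _ E] s fpath_hd(1)[OF F s(1)] fpath_hd(1)[OF F s(2)] by auto

text \<open>In \<open>ts_G\<close> a class belongs to the set if some representative qualifies.
  Gluing and saturation make the criterion the same for all representatives, so it can be evaluated
  at \<open>(s, x)\<close>.\<close>

lemma G_Inl:
  assumes F: "F \<in> subtrees V E" and U: "sat F U" and s: "s \<in> V" and x: "x \<in> topspace (K s)"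
  shows "Inl (rel V `` {(s, x)}) \<in> G F U \<longleftrightarrow>
    (if s \<in> F then rel F `` {(s, x)} \<in> U else good F U (hd (fpath E F s)))" (is "?L \<longleftrightarrow> ?R s x")
proof -
  have FV: "F \<subseteq> V" by (rule subtreeD[OF F])
  have L: "?L \<longleftrightarrow> (\<exists>s' x'. (s', x') \<in> rel V `` {(s, x)} \<and> ?R s' x')"
  proof -
    define A where "A s' \<longleftrightarrow> (\<exists>e\<in>{e \<in> out_edges V E F. good F U e}. exits_to E F e s')" for s'
    have A: "A s' \<longleftrightarrow> s' \<notin> F \<and> good F U (hd (fpath E F s'))" if "s' \<in> V" for s'
      unfolding A_def
    proof
      assume "\<exists>e\<in>{e \<in> out_edges V E F. good F U e}. exits_to E F e s'"
      then obtain e where e: "e \<in> out_edges V E F" "good F U e" "exits_to E F e s'" by auto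
      then have "fst e \<in> F" by (auto simp: out_edges_iff)
      then show "s' \<notin> F \<and> good F U (hd (fpath E F s'))" using e exits_to_iff[OF F] by auto
    next
      assume s': "s' \<notin> F \<and> good F U (hd (fpath E F s'))"
      then have out: "hd (fpath E F s') \<in> out_edges V E F" using fpath_hd(2)[OF F] that by auto
      then have "fst (hd (fpath E F s')) \<in> F" by (auto simp: out_edges_iff)
      then show "\<exists>e\<in>{e \<in> out_edges V E F. good F U e}. exits_to E F e s'"
        using exits_to_iff[OF F, of "hd (fpath E F s')" s'] that s' out
        by (intro bexI[of _ "hd (fpath E F s')"]) auto
    qed
    have inner: "s' \<in> F \<and> rel F `` {(s', x')} \<in> U \<or> A s' \<longleftrightarrow> ?R s' x'"
      if "(s', x') \<in> rel V `` {(s, x)}" for s' x'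
      using A[OF class_rep(1)[OF s x that]] by auto
    have "rel V `` {(s, x)} \<in> raw V // rel V" by (rule class_quotient[OF s x])
    moreover have "?L \<longleftrightarrow> rel V `` {(s, x)} \<in> raw V // rel V \<and> (\<exists>s' x'. (s', x') \<in> rel V `` {(s, x)} \<and>
        (s' \<in> F \<and> rel F `` {(s', x')} \<in> U \<or> A s'))"
      unfolding A_def ts_G_def Let_def good_def[symmetric]
      by (simp add: image_iff Bex_def del: Image_singleton_iff)
    ultimately show ?thesis using inner by blast
  qed
  show ?thesis
  proof
    assume ?L
    then obtain s' x' where r: "(s', x') \<in> rel V `` {(s, x)}" and R: "?R s' x'" using L by auto
    note rep = class_rep[OF s x r]
    show "?R s x"
    proof (cases "s = s' \<and> x = x'")
      case True then show ?thesis using R by simp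
    next
      case False
      then have E: "E s s'" and xS: "x \<in> Sg (s, s')" and x': "x' = phi (s, s') x" using rep(3) by auto
      have E': "E s' s" by (rule E_sym[OF E])
      have x'S: "x' \<in> Sg (s', s)" using phi_in[OF E xS] x' by simp
      consider "s \<in> F" "s' \<in> F" | "s \<in> F" "s' \<notin> F" | "s \<notin> F" "s' \<in> F" | "s \<notin> F" "s' \<notin> F" by blast
      then show ?thesis
      proof cases
        case 1 then show ?thesis using R class_glue[OF E xS] x' by simp
      next
        case 2
        then have "good F U (s, s')" using R fpath_edge[OF F _ E] by simp
        then show ?thesis using 2 xS by (auto simp: good_def)
      next
        \<comment> \<open>This is where saturation enters: one point of \<open>Sg (s', s)\<close> in
          \<open>U\<close> makes the whole edge good, and this edge is the one leading from
          \<open>F\<close> to \<open>s\<close>.\<close>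
        case 3
        then have "(s', s) \<in> out_edges V E F" using E' by (simp add: out_edges_iff)
        then have "good F U (s', s)" using satD[OF U, of "(s', s)" x'] 3 R x'S by simp
        then show ?thesis using 3 fpath_edge[OF F _ E'] by simp
      next
        case 4
        then show ?thesis using R fpath_hd_nbr[OF F _ _ E] s rep(1) by simp
      qed
    qed
  next
    assume R: "?R s x"
    have "(s, x) \<in> rel V `` {(s, x)}" using s x by (simp add: rel_iff)
    show ?L
      by (rule L[THEN iffD2], rule exI[of _ s], rule exI[of _ x], rule conjI, fact, fact R)
  qed
qed

lemma G_Inr:
  assumes F: "F \<in> subtrees V E" and xi: "xi \<in> tree_ends V E"
  shows "Inr xi \<in> G F U \<longleftrightarrow> good F U (fray F xi 0, fray F xi 1)"
proof -
  have "Inr xi \<in> G F U \<longleftrightarrow> (\<exists>e\<in>out_edges V E F. good F U e \<and> exits_to_end F e xi)"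
    unfolding ts_G_def Let_def good_def[symmetric] using xi by (simp add: image_iff Bex_def conj_assoc)
  also have "\<dots> \<longleftrightarrow> good F U (fray F xi 0, fray F xi 1)"
  proof
    assume "\<exists>e\<in>out_edges V E F. good F U e \<and> exits_to_end F e xi"
    then obtain e where e: "e \<in> out_edges V E F" "good F U e" "exits_to_end F e xi" by blast
    then have "fst e \<in> F" by (simp add: out_edges_iff)
    then show "good F U (fray F xi 0, fray F xi 1)" using e exits_to_end_iff[OF F xi, of e] by simp
  next
    let ?e = "(fray F xi 0, fray F xi 1)"
    assume "good F U ?e"
    moreover have out: "?e \<in> out_edges V E F" by (rule fray_edge[OF F xi])
    moreover have "exits_to_end F ?e xi"
      using exits_to_end_iff[OF F xi, of ?e] out by (simp add: out_edges_iff)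
    ultimately show "\<exists>e\<in>out_edges V E F. good F U e \<and> exits_to_end F e xi" by blast
  qed
  finally show ?thesis .
qed

lemma G_subset: "G F U \<subseteq> Inl ` (raw V // rel V) \<union> Inr ` tree_ends V E"
  by (auto simp: ts_G_def Let_def)

lemma openin_KF_full: "openin (KF F) (raw F // rel F)"
proof -
  have "{x \<in> topspace (K s). rel F `` {(s, x)} \<in> raw F // rel F} = topspace (K s)" if "s \<in> F" for s
    using class_quotient that by auto
  then show ?thesis by (simp add: openin_KF)
qed

lemma good_full: "e \<in> out_edges V E F \<Longrightarrow> good F (raw F // rel F) e"
  using subsetD[OF Sg_sub] class_quotient by (cases e) (auto simp: good_def out_edges_iff)

text \<open>A single basic set covers everything: for a one-vertex subtree and \<open>U\<close> the
  whole of its space, every outgoing edge is good.\<close>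

lemma topspace_tlim: "topspace tlim = Inl ` (raw V // rel V) \<union> Inr ` tree_ends V E"
proof
  show "topspace tlim \<subseteq> Inl ` (raw V // rel V) \<union> Inr ` tree_ends V E"
    using G_subset by (auto simp: ts_lim_def)
next
  obtain t where "t \<in> V" using is_tree by (auto simp: is_tree_def)
  then have F: "{t} \<in> subtrees V E" by (rule subtree_singleton)
  let ?U = "raw {t} // rel {t}"
  have sat: "sat {t} ?U" using good_full unfolding ts_saturated_def good_def by blast
  have "Inl ` (raw V // rel V) \<union> Inr ` tree_ends V E \<subseteq> G {t} ?U"
  proof
    fix z :: "('v \<times> 'c) set + (nat \<Rightarrow> 'v) set"
    assume "z \<in> Inl ` (raw V // rel V) \<union> Inr ` tree_ends V E"
    then consider c where "z = Inl c" "c \<in> raw V // rel V" | xi where "z = Inr xi" "xi \<in> tree_ends V E"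
      by auto
    then show "z \<in> G {t} ?U"
    proof cases
      case 1
      then obtain s x where sx: "s \<in> V" "x \<in> topspace (K s)" "c = rel V `` {(s, x)}"
        using quotient_class by metis
      then show ?thesis using G_Inl[OF F sat, of s x] class_quotient[of t "{t}"] good_full
          fpath_hd(2)[OF F, of s] 1 by auto
    next
      case 2
      then show ?thesis using G_Inr[OF F] good_full[OF fray_edge[OF F]] by auto
    qed
  qed
  then show "Inl ` (raw V // rel V) \<union> Inr ` tree_ends V E \<subseteq> topspace tlim"
    using F sat openin_KF_full unfolding ts_lim_def topology_generated_by_topspace by blast
qed

lemma openin_G: "F \<in> subtrees V E \<Longrightarrow> openin (KF F) U \<Longrightarrow> sat F U \<Longrightarrow> openin tlim (G F U)"
  unfolding ts_lim_def by (intro topology_generated_by_Basis) auto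

lemma continuous_map_into_tlim:
  assumes f: "\<And>x. x \<in> topspace X \<Longrightarrow> f x \<in> topspace tlim"
    and G: "\<And>F U. F \<in> subtrees V E \<Longrightarrow> openin (KF F) U \<Longrightarrow> sat F U \<Longrightarrow>
      openin X {x \<in> topspace X. f x \<in> G F U}"
  shows "continuous_map X tlim f"
  unfolding ts_lim_def
proof (rule continuous_on_generated_topo)
  fix W assume "W \<in> {G F U | F U. F \<in> subtrees V E \<and> openin (KF F) U \<and> sat F U}"
  moreover have "f -` W \<inter> topspace X = {x \<in> topspace X. f x \<in> W}" by auto
  ultimately show "openin X (f -` W \<inter> topspace X)" using G by auto
qed (use f in \<open>auto simp: ts_lim_def\<close>)

lemma continuous_map_class:
  assumes s: "s \<in> V"
  shows "continuous_map (K s) tlim (\<lambda>x. Inl (rel V `` {(s, x)}))"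
proof (rule continuous_map_into_tlim)
  fix x assume "x \<in> topspace (K s)"
  then show "Inl (rel V `` {(s, x)}) \<in> topspace tlim"
    using s class_quotient by (auto simp: topspace_tlim)
next
  fix F U assume F: "F \<in> subtrees V E" and U: "openin (KF F) U" "sat F U"
  have "{x \<in> topspace (K s). Inl (rel V `` {(s, x)}) \<in> G F U} =
      {x \<in> topspace (K s). if s \<in> F then rel F `` {(s, x)} \<in> U else good F U (hd (fpath E F s))}"
    using G_Inl[OF F U(2) s] by auto
  moreover have "openin (K s) \<dots>"
  proof (cases "s \<in> F")
    case True then show ?thesis using U(1) by (simp add: openin_KF)
  next
    \<comment> \<open>Here the condition does not depend on \<open>x\<close>, so the preimage is
      everything or empty.\<close>
    case False then show ?thesis by (cases "good F U (hd (fpath E F s))") auto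
  qed
  ultimately show "openin (K s) {x \<in> topspace (K s). Inl (rel V `` {(s, x)}) \<in> G F U}" by simp
qed

end

section \<open>Extended spaces\<close>

text \<open>\<open>psi\<close> is the homeomorphism from \<open>S\<^sub>e\<close> to
  \<open>\<Sigma>\<^sub>e\<close>. In \<open>delta_Sg\<close> its inverse appears because
  \<open>delta\<close> takes values in \<open>\<Delta>\<^sub>e\<close>, so the identification of
  \<open>\<Sigma>\<^sub>e\<close> with \<open>S\<^sub>e\<close> has to be written out.\<close>

locale extended_system = tree_system V E "\<lambda>t. mtopology_of (Km t)" Sg phi
  for V :: "'v set" and E :: "'v \<Rightarrow> 'v \<Rightarrow> bool" and Km :: "'v \<Rightarrow> 'a metric"
    and Sg :: "'v edge \<Rightarrow> 'a set" and phi :: "'v edge \<Rightarrow> 'a \<Rightarrow> 'a" +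
  fixes D :: "'v edge \<Rightarrow> 'a metric" and S :: "'v edge \<Rightarrow> 'a set" and psi :: "'v edge \<Rightarrow> 'a \<Rightarrow> 'a"
    and delta :: "'v edge \<Rightarrow> ('v, 'a) pt \<Rightarrow> 'a"
  assumes Sg_closed: "E u w \<Longrightarrow> closedin (mtopology_of (Km u)) (Sg (u, w))"
    and D_compact: "E u w \<Longrightarrow> compact_space (mtopology_of (D (u, w)))"
    and S_sub: "E u w \<Longrightarrow> S (u, w) \<subseteq> mspace (D (u, w))"
    and psi_bij: "E u w \<Longrightarrow> bij_betw (psi (u, w)) (S (u, w)) (Sg (u, w))"
    and psi_cont: "E u w \<Longrightarrow>
      continuous_map (subtopology (mtopology_of (D (u, w))) (S (u, w))) (mtopology_of (Km u)) (psi (u, w))"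
    and delta_cont: "E u w \<Longrightarrow>
      continuous_map (subtopology (hatK E Km Sg D S psi w) (hatKe E Km Sg D S psi (u, w)))
        (mtopology_of (D (u, w))) (delta (u, w))"
    and delta_Sg: "E u w \<Longrightarrow> x \<in> Sg (w, u) \<Longrightarrow>
      delta (u, w) (incK E Km Sg D S psi w x) = inv_into (S (u, w)) (psi (u, w)) (phi (w, u) x)"
    and fine: "ext_fine V E Km Sg D S psi delta"
begin

abbreviation "hK \<equiv> hatK E Km Sg D S psi"
abbreviation "iK \<equiv> incK E Km Sg D S psi"
abbreviation "iD \<equiv> incD E Km Sg D S psi"
abbreviation "hKe \<equiv> hatKe E Km Sg D S psi"
abbreviation "prt \<equiv> hatKF_part E Km Sg D S psi"
abbreviation "hrel \<equiv> hatKF_rel E Km Sg phi D S psi"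
abbreviation "hKF \<equiv> hatKF E Km Sg phi D S psi"
abbreviation "hchn \<equiv> hchain E Km Sg D S psi delta"
abbreviation "hrw \<equiv> hraw E Km Sg D S psi delta"
abbreviation "hmp \<equiv> hmap E Km Sg phi D S psi delta"
abbreviation "dg \<equiv> dgamma E Km Sg D S psi delta"

abbreviation "srel t F \<equiv> ts_rel F (star_E E t) (star_K Km D t) (star_Sg Sg S t) (star_phi S psi t)"

lemma Sg_mspace: "E u w \<Longrightarrow> x \<in> Sg (u, w) \<Longrightarrow> x \<in> mspace (Km u)"
  using Sg_sub by fastforce

text \<open>Paths with at most three vertices show existence; uniqueness is inherited, since a path
  of the star is a path of the whole tree.\<close>

lemma star_path:
  assumes t: "t \<in> V" and u: "u \<in> star_V E t" and w: "w \<in> star_V E t"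
  shows "\<exists>!p. vpath (star_E E t) p \<and> hd p = u \<and> last p = w"
proof -
  have sub: "vpath E p" if "vpath (star_E E t) p" for p
    using that by (auto simp: vpath_def star_E_def)
  have uV: "u \<in> V" using u t E_V by (auto simp: star_V_def)
  have tE: "star_E E t t x" "star_E E t x t" if "E t x" for x
    using that E_sym by (auto simp: star_E_def)
  have tn: "t \<noteq> x" if "E t x" for x using that E_irrefl by auto
  have "\<exists>p. vpath (star_E E t) p \<and> hd p = u \<and> last p = w"
  proof -
    consider "u = w" | "u \<noteq> w" "u = t" "E t w" | "u \<noteq> w" "w = t" "E t u" | "u \<noteq> w" "E t u" "E t w"
      using u w by (auto simp: star_V_def)
    then show ?thesis
    proof cases
      case 1 then show ?thesis by (intro exI[of _ "[u]"]) simp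
    next
      case 2 then show ?thesis using tE by (intro exI[of _ "[u, w]"]) (auto simp: vpath_Cons)
    next
      case 3 then show ?thesis using tE by (intro exI[of _ "[u, w]"]) (auto simp: vpath_Cons)
    next
      case 4 then show ?thesis using tE tn by (intro exI[of _ "[u, t, w]"]) (auto simp: vpath_Cons)
    qed
  qed
  then obtain p where p: "vpath (star_E E t) p" "hd p = u" "last p = w" by blast
  show ?thesis
  proof (rule ex1I[of _ p])
    fix q assume "vpath (star_E E t) q \<and> hd q = u \<and> last q = w"
    then show "q = p" using path_unique[of q p] sub p uV by auto
  qed (use p in simp)
qed

lemma is_tree_star: "t \<in> V \<Longrightarrow> is_tree (star_V E t) (star_E E t)"
  using star_path[of t] E_sym E_irrefl unfolding is_tree_def by (auto simp: star_E_def star_V_def)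

lemma psi_in: "E u w \<Longrightarrow> d \<in> S (u, w) \<Longrightarrow> psi (u, w) d \<in> Sg (u, w)"
  using psi_bij bij_betwE by blast

lemma inv_psi:
  assumes "E u w" "x \<in> Sg (u, w)"
  shows "inv_into (S (u, w)) (psi (u, w)) x \<in> S (u, w)"
    "psi (u, w) (inv_into (S (u, w)) (psi (u, w)) x) = x"
proof -
  have "x \<in> psi (u, w) ` S (u, w)" using psi_bij[OF assms(1)] assms(2) by (simp add: bij_betw_def)
  then show "inv_into (S (u, w)) (psi (u, w)) x \<in> S (u, w)"
    "psi (u, w) (inv_into (S (u, w)) (psi (u, w)) x) = x"
    by (auto intro: inv_into_into f_inv_into_f)
qed

lemma inv_psi_psi: "E u w \<Longrightarrow> d \<in> S (u, w) \<Longrightarrow> inv_into (S (u, w)) (psi (u, w)) (psi (u, w) d) = d"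
  using psi_bij by (simp add: bij_betw_def)

lemma S_nonempty: "E u w \<Longrightarrow> S (u, w) \<noteq> {}"
  using inv_psi(1) Sg_nonempty by blast

text \<open>Through this instance all facts about limits apply to \<open>hat K\<^sub>t\<close>.
  Disjointness is an issue only at the centre, as every other vertex has the single neighbour
  \<open>t\<close>.\<close>

lemma star:
  assumes t: "t \<in> V"
  shows "tree_system (star_V E t) (star_E E t) (star_K Km D t) (star_Sg Sg S t) (star_phi S psi t)"
proof unfold_locales
  show "is_tree (star_V E t) (star_E E t)" by (rule is_tree_star[OF t])
next
  fix u w assume uw: "star_E E t u w"
  then have E: "E u w" and c: "u = t \<and> w \<noteq> t \<or> w = t \<and> u \<noteq> t" using E_irrefl by (auto simp: star_E_def)
  have E': "E w u" by (rule E_sym[OF E])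
  show "star_Sg Sg S t (u, w) \<subseteq> topspace (star_K Km D t u)"
    using c Sg_sub[OF E] S_sub[OF E'] by (auto simp: star_Sg_def star_K_def rev_e_def)
  show "star_Sg Sg S t (u, w) \<noteq> {}"
    using c Sg_nonempty[OF E] S_nonempty[OF E'] by (auto simp: star_Sg_def rev_e_def)
  fix x assume x: "x \<in> star_Sg Sg S t (u, w)"
  show "star_phi S psi t (u, w) x \<in> star_Sg Sg S t (w, u)"
    using c x inv_psi(1)[OF E] psi_in[OF E'] by (auto simp: star_phi_def star_Sg_def rev_e_def)
  show "star_phi S psi t (w, u) (star_phi S psi t (u, w) x) = x"
    using c x inv_psi(2)[OF E] inv_psi_psi[OF E'] by (auto simp: star_phi_def star_Sg_def rev_e_def)
next
  fix u w w' x assume "star_E E t u w" "star_E E t u w'" "x \<in> star_Sg Sg S t (u, w)" "x \<in> star_Sg Sg S t (u, w')"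
  then show "w = w'" using Sg_disj by (auto simp: star_E_def star_Sg_def split: if_splits)
qed

text \<open>Every edge of the star contains \<open>t\<close>, whereas the edges
  \<open>r 0, r 1\<close> and \<open>r 2, r 3\<close> of a ray have no common vertex.\<close>

lemma star_no_ends: "tree_ends (star_V E t) (star_E E t) = {}"
proof -
  have "\<not> is_ray (star_V E t) (star_E E t) r" for r
  proof
    assume r: "is_ray (star_V E t) (star_E E t) r"
    then have "star_E E t (r 0) (r 1)" "star_E E t (r 2) (r 3)"
      unfolding is_ray_def by (metis One_nat_def, metis Suc_1 numeral_2_eq_2 numeral_3_eq_3)
    moreover have "inj r" using r by (simp add: is_ray_def)
    ultimately show False by (auto simp: star_E_def dest: injD)
  qed
  then show ?thesis by (auto simp: tree_ends_def)
qed

section \<open>How \<open>K\<^sub>t\<close> and the spaces \<open>\<Delta>\<^sub>e\<close> sit in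
  \<open>hat K\<^sub>t\<close>\<close>

lemma iK_def': "iK t x = Inl (srel t (star_V E t) `` {(t, x)})"
  by (simp add: incK_def)

lemma iD_def': "iD (t, w) d = Inl (srel t (star_V E t) `` {(w, d)})"
  by (simp add: incD_def)

lemma star_V_iff: "w \<in> star_V E t \<longleftrightarrow> w = t \<or> E t w" by (auto simp: star_V_def)

lemma star_K_t [simp]: "star_K Km D t t = mtopology_of (Km t)" by (simp add: star_K_def)

lemma star_K_w: "E t w \<Longrightarrow> star_K Km D t w = mtopology_of (D (t, w))"
  using E_irrefl by (auto simp: star_K_def)

lemma star_E_iff: "star_E E t t w \<longleftrightarrow> E t w" "star_E E t w t \<longleftrightarrow> E t w"
  using E_sym by (auto simp: star_E_def)

lemma star_E_not: "E t w \<Longrightarrow> E t w' \<Longrightarrow> \<not> star_E E t w w'"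
  using E_irrefl by (auto simp: star_E_def)

lemma iK_eq_iff:
  assumes "t \<in> V" "x \<in> mspace (Km t)" "x' \<in> mspace (Km t)"
  shows "iK t x = iK t x' \<longleftrightarrow> x = x'"
  using tree_system.class_eq_iff[OF star, of t t "star_V E t" x t x'] assms E_irrefl
  by (simp add: iK_def' star_V_iff star_E_iff)

lemma iK_eq_iD_iff:
  assumes "E t w" "x \<in> mspace (Km t)" "d \<in> mspace (D (t, w))"
  shows "iK t x = iD (t, w) d \<longleftrightarrow> d \<in> S (t, w) \<and> psi (t, w) d = x"
proof -
  have "t \<in> V" using E_V assms by auto
  moreover have "t \<noteq> w" using assms(1) E_irrefl by auto
  ultimately have "iK t x = iD (t, w) d \<longleftrightarrow> x \<in> Sg (t, w) \<and> d = inv_into (S (t, w)) (psi (t, w)) x"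
    using tree_system.class_eq_iff[OF star, of t t "star_V E t" x w d] assms
    by (simp add: iK_def' iD_def' star_V_iff star_E_iff star_K_w star_Sg_def star_phi_def)
  then show ?thesis using inv_psi[OF assms(1)] inv_psi_psi[OF assms(1)] psi_in[OF assms(1)] by auto
qed

lemma iD_eq_iff:
  assumes "E t w" "E t w'" "d \<in> mspace (D (t, w))" "d' \<in> mspace (D (t, w'))"
  shows "iD (t, w) d = iD (t, w') d' \<longleftrightarrow> w = w' \<and> d = d'"
proof -
  have "t \<in> V" using E_V assms by auto
  then show ?thesis
    using tree_system.class_eq_iff[OF star, of t w "star_V E t" d w' d'] assms star_E_not[of t w w']
    by (simp add: iD_def' star_V_iff star_E_iff star_K_w)
qed

lemma topspace_hK:
  assumes t: "t \<in> V"
  shows "p \<in> topspace (hK t) \<longleftrightarrow> (\<exists>x\<in>mspace (Km t). p = iK t x) \<or>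
    (\<exists>w d. E t w \<and> d \<in> mspace (D (t, w)) \<and> p = iD (t, w) d)" (is "_ \<longleftrightarrow> ?R")
proof -
  let ?raw = "ts_raw (star_V E t) (star_K Km D t)"
  have top: "topspace (hK t) = Inl ` (?raw // srel t (star_V E t))"
    unfolding hatK_def tree_system.topspace_tlim[OF star[OF t]] star_no_ends by simp
  show ?thesis
  proof
    assume "p \<in> topspace (hK t)"
    then obtain c where c: "p = Inl c" "c \<in> ?raw // srel t (star_V E t)" using top by auto
    then obtain s x where "s \<in> star_V E t" "x \<in> topspace (star_K Km D t s)"
        "c = srel t (star_V E t) `` {(s, x)}"
      using tree_system.quotient_class[OF star[OF t] c(2)] by metis
    then show ?R using c(1)
      by (cases "s = t") (auto simp: star_V_iff iK_def' iD_def' star_K_w intro!: exI[of _ s])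
  next
    assume ?R
    then show "p \<in> topspace (hK t)"
      using tree_system.class_quotient[OF star[OF t], of _ "star_V E t"]
      by (auto simp: top star_V_iff iK_def' iD_def' star_K_w)
  qed
qed

lemma iK_in: "t \<in> V \<Longrightarrow> x \<in> mspace (Km t) \<Longrightarrow> iK t x \<in> topspace (hK t)"
  using topspace_hK by blast

lemma iD_in: "E t w \<Longrightarrow> d \<in> mspace (D (t, w)) \<Longrightarrow> iD (t, w) d \<in> topspace (hK t)"
  using topspace_hK E_V by blast

lemma iK_cont: "t \<in> V \<Longrightarrow> continuous_map (mtopology_of (Km t)) (hK t) (iK t)"
  using tree_system.continuous_map_class[OF star, of t t]
  by (simp add: hatK_def iK_def'[abs_def] star_V_iff)

lemma iD_cont: "E t w \<Longrightarrow> continuous_map (mtopology_of (D (t, w))) (hK t) (iD (t, w))"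
  using tree_system.continuous_map_class[OF star, of t w] E_V
  by (simp add: hatK_def iD_def'[abs_def] star_V_iff star_K_w)

lemma iK_inv_psi:
  "E t w \<Longrightarrow> x \<in> Sg (t, w) \<Longrightarrow> iD (t, w) (inv_into (S (t, w)) (psi (t, w)) x) = iK t x"
  using iK_eq_iD_iff[of t w x "inv_into (S (t, w)) (psi (t, w)) x"] inv_psi[of t w x]
    Sg_mspace[of t w x] S_sub[of t w] by (metis subsetD)

lemma star_subtree:
  assumes t: "t \<in> V" and "finite A" "\<And>w. w \<in> A \<Longrightarrow> E t w"
  shows "insert t A \<in> subtrees (star_V E t) (star_E E t)"
proof -
  interpret st: tree "star_V E t" "star_E E t" using is_tree_star[OF t] by unfold_locales
  show ?thesis using assms(2,3)
  proof (induction A rule: finite_induct)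
    case empty then show ?case using st.subtree_singleton by (simp add: star_V_iff)
  next
    case (insert w A)
    then have "insert w (insert t A) \<in> subtrees (star_V E t) (star_E E t)"
      by (intro st.subtree_insert[of "insert t A" t w]) (auto simp: star_E_iff)
    then show ?case by (simp add: insert_commute)
  qed
qed

text \<open>For a basic open set, \<open>A\<close> is the finite subtree of the star that defines
  it: for \<open>w\<close> outside, saturation puts all of \<open>\<Delta>\<close> into the set once
  \<open>Sg (t, w)\<close> meets its trace \<open>U\<close>. The statement survives finite
  intersections and arbitrary unions, hence the induction over the generated topology.\<close>

lemma hK_nbhd:
  assumes t: "t \<in> V" and W: "openin (hK t) W" and y: "y \<in> mspace (Km t)" "iK t y \<in> W"
  shows "\<exists>U A. openin (mtopology_of (Km t)) U \<and> y \<in> U \<and> finite A \<and>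
    (\<forall>w d. E t w \<and> w \<notin> A \<and> Sg (t, w) \<inter> U \<noteq> {} \<and> d \<in> mspace (D (t, w)) \<longrightarrow> iD (t, w) d \<in> W)"
proof -
  interpret st: tree_system "star_V E t" "star_E E t" "star_K Km D t" "star_Sg Sg S t" "star_phi S psi t"
    by (rule star[OF t])
  have "generate_topology_on {st.G F U | F U. F \<in> subtrees (star_V E t) (star_E E t) \<and>
      openin (st.KF F) U \<and> st.sat F U} W"
    using W unfolding hatK_def ts_lim_def by (rule openin_topology_generated_by)
  then show ?thesis using y(2)
  proof induction
    case (Int a b)
    then obtain U A U' A' where
      "openin (mtopology_of (Km t)) U" "y \<in> U" "finite A" "openin (mtopology_of (Km t)) U'" "y \<in> U'" "finite A'"
      "\<forall>w d. E t w \<and> w \<notin> A \<and> Sg (t, w) \<inter> U \<noteq> {} \<and> d \<in> mspace (D (t, w)) \<longrightarrow> iD (t, w) d \<in> a"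
      "\<forall>w d. E t w \<and> w \<notin> A' \<and> Sg (t, w) \<inter> U' \<noteq> {} \<and> d \<in> mspace (D (t, w)) \<longrightarrow> iD (t, w) d \<in> b"
      by auto
    then show ?case by (intro exI[of _ "U \<inter> U'"] exI[of _ "A \<union> A'"]) blast
  next
    case (UN C)
    then obtain a where a: "a \<in> C" "iK t y \<in> a" by auto
    then obtain U A where "openin (mtopology_of (Km t)) U" "y \<in> U" "finite A"
      "\<forall>w d. E t w \<and> w \<notin> A \<and> Sg (t, w) \<inter> U \<noteq> {} \<and> d \<in> mspace (D (t, w)) \<longrightarrow> iD (t, w) d \<in> a"
      using UN.IH[OF a] by (elim exE conjE)
    then show ?case using a(1) by (intro exI[of _ U] exI[of _ A] conjI) auto
  next
    case (Basis B)
    then obtain F U where B: "B = st.G F U" and F: "F \<in> subtrees (star_V E t) (star_E E t)"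
      and U: "openin (st.KF F) U" "st.sat F U" by auto
    have tst: "t \<in> star_V E t" by (simp add: star_V_iff)
    have yG: "if t \<in> F then st.rel F `` {(t, y)} \<in> U else st.good F U (hd (fpath (star_E E t) F t))"
      using Basis(2) st.G_Inl[OF F U(2) tst, of y] y(1) by (simp add: B iK_def')
    have iDG: "iD (t, w) d \<in> B" if w: "E t w" "w \<notin> F" "d \<in> mspace (D (t, w))"
      "st.good F U (hd (fpath (star_E E t) F w))" for w d
    proof -
      have "w \<in> star_V E t" "d \<in> topspace (star_K Km D t w)"
        using w by (simp_all add: star_V_iff star_K_w)
      from st.G_Inl[OF F U(2) this] show ?thesis using w(2,4) unfolding B iD_def' by simp
    qed
    show ?case
    proof (cases "t \<in> F")
      case True
      let ?U = "{x \<in> topspace (mtopology_of (Km t)). st.rel F `` {(t, x)} \<in> U}"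
      have "openin (mtopology_of (Km t)) ?U"
        using bspec[OF conjunct2[OF U(1)[unfolded st.openin_KF]] True] by simp
      moreover have "y \<in> ?U" using yG True y(1) by simp
      moreover have "iD (t, w) d \<in> B"
        if w: "E t w" "w \<notin> F" "Sg (t, w) \<inter> ?U \<noteq> {}" "d \<in> mspace (D (t, w))" for w d
      proof -
        have E: "star_E E t t w" using w by (simp add: star_E_iff)
        obtain x where x: "x \<in> Sg (t, w)" "st.rel F `` {(t, x)} \<in> U" using w(3) by auto
        have "(t, w) \<in> out_edges (star_V E t) (star_E E t) F" using E True w by (simp add: st.out_edges_iff)
        then have "st.good F U (t, w)" using st.satD[OF U(2), of "(t, w)" x] x by (simp add: star_Sg_def)
        moreover have "fpath (star_E E t) F w = [(t, w)]" by (rule st.fpath_edge[OF F True E w(2)])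
        ultimately show ?thesis using iDG[OF w(1,2,4)] by simp
      qed
      ultimately show ?thesis using st.subtreeD(1)[OF F] by (intro exI[of _ ?U] exI[of _ F]) blast
    next
      \<comment> \<open>From a subtree without the centre, \<open>t\<close> and all remaining leaves
        are seen through the same edge, so membership of \<open>y\<close> already puts every such
        \<open>\<Delta>\<close> into \<open>B\<close>.\<close>
      case False
      have "iD (t, w) d \<in> B" if w: "E t w" "w \<notin> F" "d \<in> mspace (D (t, w))" for w d
      proof -
        have "hd (fpath (star_E E t) F t) = hd (fpath (star_E E t) F w)"
          using False w by (intro st.fpath_hd_nbr[OF F]) (auto simp: star_V_iff star_E_iff)
        then show ?thesis using iDG[OF w] yG False by simp
      qed
      moreover have "openin (mtopology_of (Km t)) (topspace (mtopology_of (Km t)))" by (rule openin_topspace)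
      ultimately show ?thesis using st.subtreeD(1)[OF F] y(1)
        by (intro exI[of _ "topspace (mtopology_of (Km t))"] exI[of _ F] conjI) auto
    qed
  qed auto
qed

text \<open>Builds an open set over the subtree formed by \<open>t\<close> and \<open>A\<close>,
  where the sets \<open>W w\<close> continue \<open>U\<close> across \<open>S (t, w)\<close>. The
  conclusion is silent on \<open>\<Delta>\<close> over \<open>A\<close>: in the application
  \<open>A\<close> consists of the neighbours inside \<open>F\<close>, and there
  \<open>\<Delta>\<close> minus \<open>S\<close> is cut out of \<open>hat K\<^sub>F\<close>.\<close>

lemma hK_open:
  assumes t: "t \<in> V" and A: "finite A" "\<And>w. w \<in> A \<Longrightarrow> E t w"
    and U: "openin (mtopology_of (Km t)) U"
    and W: "\<And>w. w \<in> A \<Longrightarrow> openin (mtopology_of (D (t, w))) (W w)"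
    and WU: "\<And>w d. w \<in> A \<Longrightarrow> d \<in> S (t, w) \<Longrightarrow> d \<in> W w \<longleftrightarrow> psi (t, w) d \<in> U"
    and sat: "\<And>w. E t w \<Longrightarrow> w \<notin> A \<Longrightarrow> Sg (t, w) \<subseteq> U \<or> Sg (t, w) \<inter> U = {}"
  shows "\<exists>Q. openin (hK t) Q \<and> (\<forall>x\<in>mspace (Km t). iK t x \<in> Q \<longleftrightarrow> x \<in> U) \<and>
    (\<forall>w d. E t w \<and> w \<notin> A \<and> d \<in> mspace (D (t, w)) \<longrightarrow> (iD (t, w) d \<in> Q \<longleftrightarrow> Sg (t, w) \<subseteq> U))"
proof -
  interpret st: tree_system "star_V E t" "star_E E t" "star_K Km D t" "star_Sg Sg S t" "star_phi S psi t"
    by (rule star[OF t])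
  define F where "F = insert t A"
  have F: "F \<in> subtrees (star_V E t) (star_E E t)" unfolding F_def by (rule star_subtree[OF t A])
  define P where "P r \<longleftrightarrow> (if fst r = t then snd r \<in> U else snd r \<in> W (fst r))" for r
  have tA: "t \<notin> A" using A(2) E_irrefl by auto
  define UU where "UU = (\<lambda>r. st.rel F `` {r}) ` {r \<in> st.raw F. P r}"
  have P: "P r \<longleftrightarrow> P r'" if "(r, r') \<in> st.rel F" for r r'
  proof -
    obtain s x s' x' where r: "r = (s, x)" "r' = (s', x')" by (cases r; cases r')
    have ss: "s \<in> F" "s' \<in> F" and c: "s = s' \<and> x = x' \<or> star_E E t s s' \<and> x \<in> star_Sg Sg S t (s, s') \<and>
        x' = star_phi S psi t (s, s') x"
      using that by (auto simp: r st.rel_iff)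
    show ?thesis
    proof (cases "s = s' \<and> x = x'")
      case False
      then have E: "star_E E t s s'" and x: "x \<in> star_Sg Sg S t (s, s')" and x': "x' = star_phi S psi t (s, s') x"
        using c by auto
      consider "s = t" "s' \<in> A" | "s' = t" "s \<in> A"
        using ss E E_irrefl by (auto simp: F_def star_E_def)
      then show ?thesis
      proof cases
        case 1
        then show ?thesis using x x' tA WU[of s' x'] inv_psi[OF A(2)]
          by (auto simp: P_def r star_Sg_def star_phi_def)
      next
        case 2
        then have "s \<noteq> t" using tA by auto
        then show ?thesis using 2 x x' WU[of s x]
          by (simp add: P_def r star_Sg_def star_phi_def rev_e_def)
      qed
    qed (simp add: r)
  qed
  have UU: "st.rel F `` {(s, x)} \<in> UU \<longleftrightarrow> P (s, x)" if "s \<in> F" "x \<in> topspace (star_K Km D t s)" for s x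
    unfolding UU_def by (rule class_in_image[OF st.equiv_rel P]) (use that st.raw_iff in auto)
  have op: "openin (st.KF F) UU"
    unfolding st.openin_KF
  proof (intro conjI ballI)
    show "UU \<subseteq> st.raw F // st.rel F" by (auto simp: UU_def intro: quotientI)
    fix s assume s: "s \<in> F"
    have "{x \<in> topspace (star_K Km D t s). st.rel F `` {(s, x)} \<in> UU} =
        {x \<in> topspace (star_K Km D t s). P (s, x)}" using UU[OF s] by auto
    also have "\<dots> = (if s = t then U else W s)"
      using s subsetD[OF openin_subset[OF W]] subsetD[OF openin_subset[OF U]] A(2)
      by (auto simp: P_def F_def star_K_w)
    also have "openin (star_K Km D t s) \<dots>"
      using s U W A(2) tA by (auto simp: F_def star_K_w)
    finally show "openin (star_K Km D t s) {x \<in> topspace (star_K Km D t s). st.rel F `` {(s, x)} \<in> UU}" .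
  qed
  have out: "e = (t, snd e) \<and> E t (snd e) \<and> snd e \<notin> A" if "e \<in> out_edges (star_V E t) (star_E E t) F" for e
    using that E_sym by (cases e) (auto simp: st.out_edges_iff F_def star_E_def dest: A(2))
  have cls: "st.rel F `` {(t, x)} \<in> UU \<longleftrightarrow> x \<in> U" if "x \<in> mspace (Km t)" for x
    using UU[of t x] that by (simp add: F_def P_def)
  have st: "st.sat F UU"
    unfolding ts_saturated_def
  proof
    fix e assume e: "e \<in> out_edges (star_V E t) (star_E E t) F"
    obtain w where w: "e = (t, w)" "E t w" "w \<notin> A" using out[OF e] by auto
    then show "(\<forall>x\<in>star_Sg Sg S t e. st.rel F `` {(fst e, x)} \<in> UU) \<or>
        (\<forall>x\<in>star_Sg Sg S t e. st.rel F `` {(fst e, x)} \<notin> UU)"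
      using sat[OF w(2,3)] Sg_mspace[OF w(2)] by (auto simp: star_Sg_def cls)
  qed
  have good: "st.good F UU (t, w) \<longleftrightarrow> Sg (t, w) \<subseteq> U" if "E t w" for w
    using Sg_mspace[OF that] cls by (auto simp: st.good_def star_Sg_def)
  let ?Q = "st.G F UU"
  have "openin (hK t) ?Q" unfolding hatK_def by (rule st.openin_G[OF F op st])
  moreover have "iK t x \<in> ?Q \<longleftrightarrow> x \<in> U" if "x \<in> mspace (Km t)" for x
    using st.G_Inl[OF F st, of t x] that cls by (simp add: iK_def' star_V_iff F_def)
  moreover have "iD (t, w) d \<in> ?Q \<longleftrightarrow> Sg (t, w) \<subseteq> U" if w: "E t w" "w \<notin> A" "d \<in> mspace (D (t, w))" for w d
  proof -
    have wF: "w \<notin> F" using w E_irrefl by (auto simp: F_def)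
    have "fpath (star_E E t) F w = [(t, w)]"
      using w wF by (intro st.fpath_edge[OF F]) (auto simp: F_def star_E_iff)
    then show ?thesis using st.G_Inl[OF F st, of w d] w wF good by (simp add: iD_def' star_V_iff star_K_w)
  qed
  ultimately show ?thesis by blast
qed

text \<open>Of the space \<open>\<Delta>\<close> pointing back to \<open>u\<close> only
  \<open>S\<close> survives, and its points are points of \<open>K\<^sub>w\<close>; so two normal
  forms suffice. The same happens in \<open>prt_iff\<close> for all neighbours inside
  \<open>F\<close>.\<close>

lemma hKe_iff:
  assumes E: "E u w"
  shows "p \<in> hKe (u, w) \<longleftrightarrow> (\<exists>x\<in>mspace (Km w). p = iK w x) \<or>
    (\<exists>v d. E w v \<and> v \<noteq> u \<and> d \<in> mspace (D (w, v)) \<and> p = iD (w, v) d)" (is "_ \<longleftrightarrow> ?R")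
proof -
  have E': "E w u" by (rule E_sym[OF E])
  have wV: "w \<in> V" using E_V[OF E] by simp
  have def: "p \<in> hKe (u, w) \<longleftrightarrow> p \<in> topspace (hK w) \<and> p \<notin> iD (w, u) ` (mspace (D (w, u)) - S (w, u))"
    by (simp add: hatKe_def rev_e_def)
  show ?thesis
  proof
    assume p: "p \<in> hKe (u, w)"
    then have "p \<in> topspace (hK w)" using def by simp
    then consider x where "x \<in> mspace (Km w)" "p = iK w x"
      | v d where "E w v" "d \<in> mspace (D (w, v))" "p = iD (w, v) d"
      using topspace_hK[OF wV] by blast
    then show ?R
    proof cases
      case 2
      show ?thesis
      proof (cases "v = u")
        case True
        then have "d \<in> S (w, u)" using p 2 def by auto
        then have "p = iK w (psi (w, u) d)" "psi (w, u) d \<in> mspace (Km w)"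
          using iK_eq_iD_iff[OF E', of "psi (w, u) d" d] 2 True psi_in[OF E'] Sg_mspace[OF E'] by auto
        then show ?thesis by blast
      qed (use 2 in blast)
    qed blast
  next
    assume ?R
    then show "p \<in> hKe (u, w)"
      using def iK_in[OF wV] iD_in iK_eq_iD_iff[OF E'] iD_eq_iff[OF _ E'] by (auto 4 4)
  qed
qed

lemma prt_iff:
  assumes t: "t \<in> F" and F: "F \<subseteq> V"
  shows "p \<in> prt F t \<longleftrightarrow> (\<exists>x\<in>mspace (Km t). p = iK t x) \<or>
    (\<exists>w d. E t w \<and> w \<notin> F \<and> d \<in> mspace (D (t, w)) \<and> p = iD (t, w) d)" (is "_ \<longleftrightarrow> ?R")
proof -
  have tV: "t \<in> V" using t F by auto
  have def: "p \<in> prt F t \<longleftrightarrow> p \<in> topspace (hK t) \<and>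
      (\<forall>w\<in>F. E t w \<longrightarrow> p \<notin> iD (t, w) ` (mspace (D (t, w)) - S (t, w)))"
    using t by (auto simp: hatKF_part_def oedges_def)
  show ?thesis
  proof
    assume p: "p \<in> prt F t"
    then have "p \<in> topspace (hK t)" using def by simp
    then consider x where "x \<in> mspace (Km t)" "p = iK t x"
      | v d where "E t v" "d \<in> mspace (D (t, v))" "p = iD (t, v) d"
      using topspace_hK[OF tV] by blast
    then show ?R
    proof cases
      case 2
      show ?thesis
      proof (cases "v \<in> F")
        case True
        then have "d \<in> S (t, v)" using p 2 def by auto
        then have "p = iK t (psi (t, v) d)" "psi (t, v) d \<in> mspace (Km t)"
          using iK_eq_iD_iff[OF 2(1), of "psi (t, v) d" d] 2 psi_in[OF 2(1)] Sg_mspace[OF 2(1)] by auto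
        then show ?thesis by blast
      qed (use 2 in blast)
    qed blast
  next
    assume ?R
    then consider x where "x \<in> mspace (Km t)" "p = iK t x"
      | v d where "E t v" "v \<notin> F" "d \<in> mspace (D (t, v))" "p = iD (t, v) d" by blast
    then show "p \<in> prt F t"
    proof cases
      case 1
      have "iK t x \<noteq> iD (t, w) d" if "w \<in> F" "E t w" "d \<in> mspace (D (t, w)) - S (t, w)" for w d
        using iK_eq_iD_iff[OF that(2) 1(1), of d] that(3) by auto
      then show ?thesis using def 1 iK_in[OF tV] by auto
    next
      case 2
      have "iD (t, v) d \<noteq> iD (t, w) d'" if "w \<in> F" "E t w" "d' \<in> mspace (D (t, w)) - S (t, w)" for w d'
        using iD_eq_iff[OF 2(1) that(2) 2(3), of d'] that 2 by auto
      then show ?thesis using def 2 iD_in by auto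
    qed
  qed
qed

lemma prt_topspace: "prt F t \<subseteq> topspace (hK t)"
  by (auto simp: hatKF_part_def)

lemma iK_prt: "t \<in> F \<Longrightarrow> F \<subseteq> V \<Longrightarrow> x \<in> mspace (Km t) \<Longrightarrow> iK t x \<in> prt F t"
  using prt_iff by blast

lemma iD_prt: "t \<in> F \<Longrightarrow> F \<subseteq> V \<Longrightarrow> E t w \<Longrightarrow> w \<notin> F \<Longrightarrow> d \<in> mspace (D (t, w)) \<Longrightarrow> iD (t, w) d \<in> prt F t"
  using prt_iff by blast

section \<open>The inverse system\<close>

lemma equiv_hrel: "equiv (Sigma F (prt F)) (hrel F)"
  by (simp add: hatKF_rel_def equiv_glue_eq)

lemma hrel_iff:
  assumes F: "F \<subseteq> V"
  shows "((s, p), (s', p')) \<in> hrel F \<longleftrightarrow> s \<in> F \<and> s' \<in> F \<and> p \<in> prt F s \<and> p' \<in> prt F s' \<and>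
    (s = s' \<and> p = p' \<or> E s s' \<and> (\<exists>x\<in>Sg (s, s'). p = iK s x \<and> p' = iK s' (phi (s, s') x)))"
proof -
  let ?P = "{((fst e, iK (fst e) x), (snd e, iK (snd e) (phi e x))) | e x. e \<in> oedges F E \<and> x \<in> Sg e}"
  have P: "((s, p), (s', p')) \<in> ?P \<longleftrightarrow> s \<in> F \<and> s' \<in> F \<and> E s s' \<and>
      (\<exists>x\<in>Sg (s, s'). p = iK s x \<and> p' = iK s' (phi (s, s') x))" for s p s' p'
    by (auto simp: oedges_def)
  have sym: "(b, a) \<in> ?P" if ab': "(a, b) \<in> ?P" for a b
  proof -
    obtain s p s' p' where ab: "a = (s, p)" "b = (s', p')" by (cases a; cases b)
    obtain x where x: "s \<in> F" "s' \<in> F" "E s s'" "x \<in> Sg (s, s')" "p = iK s x" "p' = iK s' (phi (s, s') x)"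
      using ab' unfolding ab P by blast
    then show ?thesis unfolding ab P
      using E_sym[OF x(3)] phi_in[OF x(3,4)] phi_inv[OF x(3,4)] by (intro conjI bexI[of _ "phi (s, s') x"]) auto
  qed
  have fn: "b = c" if abac: "(a, b) \<in> ?P" "(a, c) \<in> ?P" for a b c
  proof -
    obtain s p s' p' s'' p'' where abc: "a = (s, p)" "b = (s', p')" "c = (s'', p'')" by (cases a; cases b; cases c)
    obtain x where x: "s \<in> F" "E s s'" "x \<in> Sg (s, s')" "p = iK s x" "p' = iK s' (phi (s, s') x)"
      using abac(1) unfolding abc P by blast
    obtain y where y: "E s s''" "y \<in> Sg (s, s'')" "p = iK s y" "p'' = iK s'' (phi (s, s'') y)"
      using abac(2) unfolding abc P by blast
    have "s \<in> V" using x(1) F by auto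
    then have "x = y" using iK_eq_iff[of s x y] x y Sg_mspace by metis
    then show ?thesis using Sg_disj[OF x(2) y(1)] x y abc by auto
  qed
  have "((s, p), (s', p')) \<in> hrel F \<longleftrightarrow> (s, p) \<in> Sigma F (prt F) \<and> (s', p') \<in> Sigma F (prt F) \<and>
      ((s, p) = (s', p') \<or> ((s, p), (s', p')) \<in> ?P)"
    unfolding hatKF_rel_def by (rule glue_eq_partner) (use sym fn in blast)+
  then show ?thesis unfolding P by auto
qed

lemma hclass_eq_iff:
  assumes "F \<subseteq> V" "s \<in> F" "p \<in> prt F s" "s' \<in> F" "p' \<in> prt F s'"
  shows "hrel F `` {(s, p)} = hrel F `` {(s', p')} \<longleftrightarrow>
    s = s' \<and> p = p' \<or> E s s' \<and> (\<exists>x\<in>Sg (s, s'). p = iK s x \<and> p' = iK s' (phi (s, s') x))"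
proof -
  have "hrel F `` {(s, p)} = hrel F `` {(s', p')} \<longleftrightarrow> ((s, p), (s', p')) \<in> hrel F"
    by (rule eq_equiv_class_iff[OF equiv_hrel]) (use assms in auto)
  then show ?thesis using assms by (simp add: hrel_iff)
qed

lemma openin_hKF:
  "openin (hKF F) W \<longleftrightarrow> W \<subseteq> Sigma F (prt F) // hrel F \<and>
    (\<forall>s\<in>F. openin (subtopology (hK s) (prt F s)) {p \<in> prt F s. hrel F `` {(s, p)} \<in> W})"
proof -
  have ts: "topspace (subtopology (hK s) (prt F s)) = prt F s" for s
    using prt_topspace by auto
  show ?thesis
    using openin_quot_sum[of F "\<lambda>s. subtopology (hK s) (prt F s)" "hrel F" W] equiv_hrel[of F]
    unfolding hatKF_def ts by simp
qed

lemma topspace_hKF: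
  shows "topspace (hKF F) = Sigma F (prt F) // hrel F"
proof
  show "topspace (hKF F) \<subseteq> Sigma F (prt F) // hrel F"
    using openin_topspace[of "hKF F"] unfolding openin_hKF by blast
  have "{p \<in> prt F s. hrel F `` {(s, p)} \<in> Sigma F (prt F) // hrel F} = prt F s" if "s \<in> F" for s
    using that by (auto intro: quotientI)
  then have "openin (hKF F) (Sigma F (prt F) // hrel F)"
    unfolding openin_hKF using prt_topspace by (auto simp: openin_subtopology_refl)
  then show "Sigma F (prt F) // hrel F \<subseteq> topspace (hKF F)" by (rule openin_subset)
qed

lemma hclass_cases:
  assumes "c \<in> topspace (hKF F)"
  obtains s p where "s \<in> F" "p \<in> prt F s" "c = hrel F `` {(s, p)}"
  using assms unfolding topspace_hKF by (auto elim!: quotientE)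

lemma hclass_in: "s \<in> F \<Longrightarrow> p \<in> prt F s \<Longrightarrow> hrel F `` {(s, p)} \<in> topspace (hKF F)"
  unfolding topspace_hKF by (auto intro: quotientI)

section \<open>Composites of the maps \<open>\<delta>\<^sub>e\<close> along paths\<close>

lemma delta_in: "E u w \<Longrightarrow> p \<in> hKe (u, w) \<Longrightarrow> delta (u, w) p \<in> mspace (D (u, w))"
  using continuous_map_funspace[OF delta_cont, of u w] by (auto simp: hatKe_def Pi_iff)

lemma iD_hKe: "E u w \<Longrightarrow> E w v \<Longrightarrow> v \<noteq> u \<Longrightarrow> d \<in> mspace (D (w, v)) \<Longrightarrow> iD (w, v) d \<in> hKe (u, w)"
  using hKe_iff by blast

lemma iK_hKe: "E u w \<Longrightarrow> x \<in> mspace (Km w) \<Longrightarrow> iK w x \<in> hKe (u, w)"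
  using hKe_iff by blast

lemma epath_iff: "epath E g \<longleftrightarrow> g \<noteq> [] \<and> ewalk E (fst (hd g)) g (snd (last g)) \<and> distinct (fst (hd g) # map snd g)"
  unfolding epath_def using ewalk_iff[of g E "snd (last g)"] by blast

lemma exit_path_epath:
  assumes "exit_path E F es s" shows "epath E es"
proof -
  have "snd (last es) = s" using assms ewalk_last[of E "fst (hd es)" es s] by (simp add: exit_path_def)
  then show ?thesis using assms by (auto simp: epath_iff exit_path_def)
qed

lemma epath_Cons:
  "epath E (e1 # e2 # es) \<Longrightarrow> epath E (e2 # es) \<and> snd e1 = fst e2 \<and> E (fst e1) (snd e1) \<and>
    E (fst e2) (snd e2) \<and> snd e2 \<noteq> fst e1"
  by (auto simp: epath_iff)

lemma dg_cont: "epath E g \<Longrightarrow> continuous_map (mtopology_of (D (last g))) (mtopology_of (D (hd g))) (dg g)"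
proof (induction g rule: induct_list012)
  case (2 e)
  have "dg [e] = (\<lambda>y. y)" by auto
  then show ?case by (simp add: continuous_map_id[unfolded id_def])
next
  case (3 e1 e2 es)
  note e = epath_Cons[OF 3(3)]
  have IH: "continuous_map (mtopology_of (D (last (e2 # es)))) (mtopology_of (D e2)) (dg (e2 # es))"
    using 3(2) e by simp
  obtain u w v where uw: "e1 = (u, w)" "e2 = (w, v)" using e by (metis prod.collapse)
  have E: "E u w" "E w v" "v \<noteq> u" using e uw by auto
  \<comment> \<open>An embedded path does not turn back, so \<open>\<Delta>\<close> of the next edge
    lies in the domain \<open>hat K\<^sub>e\<close> of the previous \<open>delta\<close>.\<close>
  have "continuous_map (mtopology_of (D (w, v))) (subtopology (hK w) (hKe (u, w))) (iD (w, v))"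
    using iD_cont[OF E(2)] iD_hKe[OF E] by (auto simp: continuous_map_in_subtopology)
  then have "continuous_map (mtopology_of (D (w, v))) (mtopology_of (D (u, w))) (delta (u, w) \<circ> iD (w, v))"
    by (rule continuous_map_compose[OF _ delta_cont[OF E(1)]])
  then have comp: "continuous_map (mtopology_of (D (last (e2 # es)))) (mtopology_of (D (u, w)))
      ((delta (u, w) \<circ> iD (w, v)) \<circ> dg (e2 # es))"
    using continuous_map_compose[OF IH, of "mtopology_of (D (u, w))" "delta (u, w) \<circ> iD (w, v)"]
    unfolding uw(2) by blast
  have dgeq: "dg (e1 # e2 # es) = (delta (u, w) \<circ> iD (w, v)) \<circ> dg (e2 # es)" by (auto simp: uw)
  have l: "last (e1 # e2 # es) = last (e2 # es)" by simp
  show ?case using comp unfolding l list.sel(1) dgeq unfolding uw(1) .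
qed (auto simp: epath_def)

lemma dg_in: "epath E g \<Longrightarrow> y \<in> mspace (D (last g)) \<Longrightarrow> dg g y \<in> mspace (D (hd g))"
  using continuous_map_funspace[OF dg_cont] by fastforce

text \<open>\<open>hchain\<close> starts from a point of the extended space at the far end,
  \<open>dgamma\<close> from a point of \<open>\<Delta>\<close> of the last edge; they differ by one
  \<open>delta\<close> at the start and one inclusion at the end.\<close>

lemma hchn_dg: "es \<noteq> [] \<Longrightarrow> hchn es p = iD (hd es) (dg es (delta (last es) p))"
  by (induction es rule: induct_list012) auto

lemma hchn_append: "hchn (es @ es') p = hchn es (hchn es' p)"
  by (induction es) auto

lemma dg_snoc: "g \<noteq> [] \<Longrightarrow> dg (g @ [e]) y = dg g (delta (last g) (iD e y))"
  by (induction g rule: induct_list012) auto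

lemma hrw_in: "s \<in> F \<Longrightarrow> hrw F (s, p) = (s, p)"
  by (simp add: hraw_def)

lemma hrw_out: "s \<notin> F \<Longrightarrow> hrw F (s, p) = (fst (hd (fpath E F s)), hchn (fpath E F s) p)"
  by (simp add: hraw_def Let_def)

lemma hrw_out_cases:
  assumes F: "F \<in> subtrees V E" and s: "s \<in> V - F" and p: "p \<in> hKe (last (fpath E F s))"
  obtains u w d where "hd (fpath E F s) = (u, w)" "E u w" "u \<in> F" "w \<notin> F" "d \<in> mspace (D (u, w))"
    "hrw F (s, p) = (u, iD (u, w) d)"
proof -
  let ?es = "fpath E F s"
  have ex: "exit_path E F ?es s" by (rule fpath_exit[OF F s])
  have ep: "epath E ?es" by (rule exit_path_epath[OF ex])
  obtain u w where uw: "hd ?es = (u, w)" by (cases "hd ?es")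
  have o: "E u w" "u \<in> F" "w \<notin> F" "?es \<noteq> []" using fpath_hd[OF F s] uw by (auto simp: out_edges_iff)
  have "E (fst (last ?es)) (snd (last ?es))" using ep o unfolding epath_def by auto
  then have "delta (last ?es) p \<in> mspace (D (last ?es))"
    using delta_in[of "fst (last ?es)" "snd (last ?es)" p] p by simp
  then have "dg ?es (delta (last ?es) p) \<in> mspace (D (u, w))" using dg_in[OF ep] uw by simp
  moreover have "hrw F (s, p) = (u, iD (u, w) (dg ?es (delta (last ?es) p)))"
    using hrw_out[of s F p] s hchn_dg[OF o(4)] uw by simp
  ultimately show ?thesis using that uw o by blast
qed

text \<open>\<open>\<delta>\<^sub>e\<close> is arbitrary outside \<open>hat K\<^sub>e\<close>; on the points singled out here \<open>hrw F\<close> applies it only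
  inside its domain.\<close>
definition valid :: "'v set \<Rightarrow> 'v \<Rightarrow> ('v, 'a) pt \<Rightarrow> bool" where
  "valid F s p \<longleftrightarrow> s \<in> V \<and> (if s \<in> F then p \<in> prt F s else p \<in> hKe (last (fpath E F s)))"

lemma hrw_valid:
  assumes F: "F \<in> subtrees V E" and v: "valid F s p"
  shows "hrw F (s, p) \<in> Sigma F (prt F)"
proof (cases "s \<in> F")
  case True then show ?thesis using v by (simp add: hrw_in valid_def)
next
  case False
  then have "s \<in> V - F" "p \<in> hKe (last (fpath E F s))" using v by (auto simp: valid_def)
  then obtain u w d where "E u w" "u \<in> F" "w \<notin> F" "d \<in> mspace (D (u, w))"
    "hrw F (s, p) = (u, iD (u, w) d)" using hrw_out_cases[OF F] by metis
  then show ?thesis using iD_prt subtreeD(3)[OF F] by simp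
qed

text \<open>The predecessor of \<open>s\<close> on the path lies in \<open>F'\<close>. Hence an edge
  at \<open>s\<close> leaving \<open>F'\<close> does not lead back along the path, which keeps its
  \<open>\<Delta>\<close> inside the domain of \<open>delta\<close>.\<close>

lemma last_edge_fst:
  assumes F: "F \<in> subtrees V E" and F': "F' \<in> subtrees V E" and sub: "F \<subseteq> F'" and s: "s \<in> F' - F"
  shows "\<exists>u. last (fpath E F s) = (u, s) \<and> E u s \<and> u \<in> F'"
proof -
  let ?es = "fpath E F s"
  have sV: "s \<in> V - F" using s subtreeD(3)[OF F'] by auto
  have ex: "exit_path E F ?es s" by (rule fpath_exit[OF F sV])
  obtain es u v where es: "?es = es @ [(u, v)]" using fpath_hd(1)[OF F sV] by (metis rev_exhaust surj_pair)
  have v: "v = s" using fpath_hd(3)[OF F sV] es by simp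
  have wk: "ewalk E (fst (hd ?es)) (es @ [(u, v)]) s" using ex es by (simp add: exit_path_def)
  then have E: "E u s" and wk': "ewalk E (fst (hd ?es)) es u" using v by (auto simp: ewalk_append)
  have "u \<in> F'"
  proof (cases "es = []")
    case True then show ?thesis using es ex sub by (auto simp: exit_path_def)
  next
    case False
    then have "u \<in> snd ` set es" using ewalk_last[OF wk'] by (metis imageI last_in_set)
    then show ?thesis using fpath_in[OF sub F F' s] es by auto
  qed
  then show ?thesis using es v E by simp
qed

lemma valid_iK:
  assumes F: "F \<in> subtrees V E" and s: "s \<in> V" and x: "x \<in> mspace (Km s)"
  shows "valid F s (iK s x)"
proof (cases "s \<in> F")
  case True then show ?thesis using s x iK_prt[OF True subtreeD(3)[OF F]] by (simp add: valid_def)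
next
  case False
  obtain F' where "F' \<in> subtrees V E" "F \<subseteq> F'" "s \<in> F'" using subtree_extend[OF F s] by blast
  then obtain u where "last (fpath E F s) = (u, s)" "E u s" using last_edge_fst[OF F] False by blast
  then show ?thesis using iK_hKe x s False by (simp add: valid_def)
qed

lemma valid_mono:
  assumes F: "F \<in> subtrees V E" and F': "F' \<in> subtrees V E" and sub: "F \<subseteq> F'" and s: "s \<in> F'"
    and p: "p \<in> prt F' s"
  shows "valid F s p"
proof -
  have sV: "s \<in> V" using s subtreeD(3)[OF F'] by auto
  consider x where "x \<in> mspace (Km s)" "p = iK s x"
    | w d where "E s w" "w \<notin> F'" "d \<in> mspace (D (s, w))" "p = iD (s, w) d"
    using p prt_iff[OF s subtreeD(3)[OF F']] by blast
  then show ?thesis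
  proof cases
    case 1 then show ?thesis using valid_iK[OF F sV] by simp
  next
    case 2
    show ?thesis
    proof (cases "s \<in> F")
      case True
      then show ?thesis using 2 sub iD_prt[OF True subtreeD(3)[OF F], of w d] sV by (auto simp: valid_def)
    next
      case False
      then obtain u where "last (fpath E F s) = (u, s)" "E u s" "u \<in> F'"
        using last_edge_fst[OF F F' sub] s by blast
      moreover from this have "iD (s, w) d \<in> hKe (u, s)" using 2 by (intro iD_hKe) auto
      ultimately show ?thesis using 2 False sV by (simp add: valid_def)
    qed
  qed
qed

text \<open>A formal consequence of path concatenation; it holds for every \<open>p\<close>, inside
  the domain of \<open>delta\<close> or not.\<close>

lemma hrw_comp:
  assumes F: "F \<in> subtrees V E" and F': "F' \<in> subtrees V E" and sub: "F \<subseteq> F'" and s: "s \<in> V"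
  shows "hrw F (hrw F' (s, p)) = hrw F (s, p)"
proof (cases "s \<in> F'")
  case True then show ?thesis by (simp add: hrw_in)
next
  case False
  then have sV: "s \<in> V - F'" and sF: "s \<notin> F" using s sub by auto
  let ?es = "fpath E F' s"
  let ?u = "fst (hd ?es)"
  show ?thesis
  proof (cases "?u \<in> F")
    case True
    then show ?thesis using fpath_comp(1)[OF F F' sub sV True]
      by (simp add: hrw_out[OF False] hrw_in[OF True] hrw_out[OF sF])
  next
    case u: False
    have "?u \<in> F'" using fpath_hd(2)[OF F' sV] by (simp add: out_edges_iff)
    then have "?u \<in> V - F" using u subtreeD(3)[OF F'] by auto
    then have "fpath E F ?u \<noteq> []" by (rule fpath_hd(1)[OF F])
    then show ?thesis using fpath_comp(2)[OF F F' sub sV u]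
      by (simp add: hrw_out[OF False] hrw_out[OF u] hrw_out[OF sF] hchn_append)
  qed
qed

text \<open>The prescribed values of \<open>delta\<close> on \<open>\<Sigma>\<close> at work: moving
  the glued partner back across the edge returns the point itself.\<close>

lemma hchn_glue:
  assumes E: "E s s'" and x: "x \<in> Sg (s, s')"
  shows "hchn [(s, s')] (iK s' (phi (s, s') x)) = iK s x"
proof -
  have "delta (s, s') (iK s' (phi (s, s') x)) = inv_into (S (s, s')) (psi (s, s')) x"
    using delta_Sg[OF E phi_in[OF E x]] phi_inv[OF E x] by simp
  then show ?thesis using iK_inv_psi[OF E x] by simp
qed

text \<open>\<open>hmap\<close> selects a representative by \<open>SOME\<close>, so glued
  representatives must have glued images. If at least one of the two vertices is outside
  \<open>F\<close>, the images are even equal.\<close>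

lemma hrw_glue:
  assumes F: "F \<in> subtrees V E" and E: "E s s'" and x: "x \<in> Sg (s, s')"
  shows "(hrw F (s, iK s x), hrw F (s', iK s' (phi (s, s') x))) \<in> hrel F"
proof -
  let ?x' = "phi (s, s') x"
  have E': "E s' s" by (rule E_sym[OF E])
  have x': "?x' \<in> Sg (s', s)" by (rule phi_in[OF E x])
  have FV: "F \<subseteq> V" by (rule subtreeD(3)[OF F])
  have ss: "s \<in> V" "s' \<in> V" using E_V[OF E] by auto
  have xm: "x \<in> mspace (Km s)" "?x' \<in> mspace (Km s')" using Sg_mspace E E' x x' by blast+
  have in1: "hrw F (s, iK s x) \<in> Sigma F (prt F)" "hrw F (s', iK s' ?x') \<in> Sigma F (prt F)"
    using hrw_valid[OF F valid_iK[OF F]] ss xm by auto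
  have refl: "(r, r) \<in> hrel F" if "r \<in> Sigma F (prt F)" for r
    using that equiv_hrel[of F] by (auto simp: equiv_def refl_on_def)
  consider "s \<in> F" "s' \<in> F" | "s \<in> F" "s' \<notin> F" | "s \<notin> F" "s' \<in> F" | "s \<notin> F" "s' \<notin> F" by blast
  then show ?thesis
  proof cases
    case 1
    then have "hrw F (s, iK s x) = (s, iK s x)" "hrw F (s', iK s' ?x') = (s', iK s' ?x')"
      by (simp_all add: hrw_in)
    then show ?thesis using in1 E x by (auto simp: hrel_iff[OF FV])
  next
    case 2
    have "fpath E F s' = [(s, s')]" using fpath_edge[OF F 2(1) E 2(2)] .
    then have "hrw F (s', iK s' ?x') = (s, iK s x)"
      using hchn_glue[OF E x] hrw_out[OF 2(2)] by simp
    then show ?thesis using refl[OF in1(1)] 2 by (simp add: hrw_in)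
  next
    case 3
    have "fpath E F s = [(s', s)]" using fpath_edge[OF F 3(2) E' 3(1)] .
    then have "hrw F (s, iK s x) = (s', iK s' ?x')"
      using hchn_glue[OF E' x'] phi_inv[OF E x] hrw_out[OF 3(1)] by simp
    then show ?thesis using refl[OF in1(2)] 3 by (simp add: hrw_in)
  next
    case 4
    have ne: "fpath E F s \<noteq> []" "fpath E F s' \<noteq> []" using fpath_hd(1)[OF F] ss 4 by auto
    from fpath_adj[OF F 4 E] have "hrw F (s, iK s x) = hrw F (s', iK s' ?x')"
    proof
      assume "fpath E F s' = fpath E F s @ [(s, s')]"
      then show ?thesis using ne hchn_glue[OF E x]
        by (simp add: hrw_out[OF 4(1)] hrw_out[OF 4(2)] hchn_append del: hchain.simps)
    next
      assume "fpath E F s = fpath E F s' @ [(s', s)]"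
      then show ?thesis using ne hchn_glue[OF E' x'] phi_inv[OF E x]
        by (simp add: hrw_out[OF 4(1)] hrw_out[OF 4(2)] hchn_append del: hchain.simps)
    qed
    then show ?thesis using refl[OF in1(1)] by simp
  qed
qed

lemma hclass_glue:
  assumes F: "F \<in> subtrees V E" and E: "E s s'" and x: "x \<in> Sg (s, s')"
  shows "hrel F `` {hrw F (s, iK s x)} = hrel F `` {hrw F (s', iK s' (phi (s, s') x))}"
  by (rule equiv_class_eq[OF equiv_hrel hrw_glue[OF assms]])

lemma hmp_class:
  assumes F: "F \<in> subtrees V E" and F': "F' \<in> subtrees V E" and sub: "F \<subseteq> F'" and s: "s \<in> F'"
    and p: "p \<in> prt F' s"
  shows "hmp F F' (hrel F' `` {(s, p)}) = hrel F `` {hrw F (s, p)}"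
proof -
  let ?c = "hrel F' `` {(s, p)}"
  define r where "r = (SOME r. r \<in> ?c)"
  have FV: "F' \<subseteq> V" by (rule subtreeD(3)[OF F'])
  have "(s, p) \<in> ?c" using equiv_class_self[OF equiv_hrel, of "(s, p)" F'] s p by simp
  then have "r \<in> ?c" unfolding r_def by (rule someI)
  then obtain s' p' where r: "r = (s', p')" "((s, p), (s', p')) \<in> hrel F'" by (cases r) auto
  have "hrel F `` {hrw F (s', p')} = hrel F `` {hrw F (s, p)}"
  proof (cases "s = s' \<and> p = p'")
    case False
    then obtain x where "E s s'" "x \<in> Sg (s, s')" "p = iK s x" "p' = iK s' (phi (s, s') x)"
      using r(2) hrel_iff[OF FV] by blast
    then show ?thesis using hclass_glue[OF F] by metis
  qed simp
  then show ?thesis unfolding hmap_def r_def[symmetric] r(1) .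
qed

section \<open>The point of \<open>\<Delta>\<close> determined by a ray\<close>

lemma ray_E: "is_ray V E r \<Longrightarrow> E (r n) (r (Suc n))"
  by (simp add: is_ray_def)

lemma epath_redges:
  assumes r: "is_ray V E r"
  shows "epath E (redges r (Suc n))"
proof -
  have "distinct (map r [0..<Suc (Suc n)])" using vpath_ray[OF r, of "Suc n"] unfolding vpath_def by blast
  moreover have "map r [0..<Suc (Suc n)] = r 0 # map snd (redges r (Suc n))"
    unfolding map_snd_redges by (simp add: upt_conv_Cons del: upt_Suc)
  ultimately have "distinct (r 0 # map snd (redges r (Suc n)))" by metis
  then show ?thesis using ewalk_redges[OF r, of "Suc n"] unfolding epath_iff by simp
qed

text \<open>\<open>redges r (Suc n)\<close> has \<open>n + 1\<close> edges, so \<open>n\<close> maps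
  \<open>delta\<close> are applied, and \<open>ray_image r 0\<close> is the whole of the first
  \<open>\<Delta>\<close>.\<close>

definition ray_image :: "(nat \<Rightarrow> 'v) \<Rightarrow> nat \<Rightarrow> 'a set" where
  "ray_image r n = dg (redges r (Suc n)) ` mspace (D (r n, r (Suc n)))"

lemma ray_image_0: "ray_image r 0 = mspace (D (r 0, r (Suc 0)))"
proof -
  have "dg (redges r (Suc 0)) = (\<lambda>y. y)" by (auto simp: redges_def)
  then show ?thesis by (simp add: ray_image_def)
qed

lemma ray_image_subset:
  assumes r: "is_ray V E r" shows "ray_image r n \<subseteq> mspace (D (r 0, r (Suc 0)))"
  using dg_in[OF epath_redges[OF r, of n]] by (auto simp: ray_image_def)

lemma iD_ray_hKe:
  assumes r: "is_ray V E r" and d: "d \<in> mspace (D (r (Suc n), r (Suc (Suc n))))"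
  shows "iD (r (Suc n), r (Suc (Suc n))) d \<in> hKe (r n, r (Suc n))"
proof (rule iD_hKe[OF ray_E[OF r] ray_E[OF r] _ d])
  have "inj r" using r by (simp add: is_ray_def)
  then show "r (Suc (Suc n)) \<noteq> r n" by (auto dest: injD)
qed

lemma ray_image_Suc:
  assumes r: "is_ray V E r" shows "ray_image r (Suc n) \<subseteq> ray_image r n"
proof
  fix x assume "x \<in> ray_image r (Suc n)"
  then obtain d where d: "d \<in> mspace (D (r (Suc n), r (Suc (Suc n))))" "x = dg (redges r (Suc (Suc n))) d"
    by (auto simp: ray_image_def)
  have "x = dg (redges r (Suc n)) (delta (r n, r (Suc n)) (iD (r (Suc n), r (Suc (Suc n))) d))"
    unfolding d(2) redges_Suc[of r "Suc n"] by (simp add: dg_snoc)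
  moreover have "delta (r n, r (Suc n)) (iD (r (Suc n), r (Suc (Suc n))) d) \<in> mspace (D (r n, r (Suc n)))"
    by (rule delta_in[OF ray_E[OF r] iD_ray_hKe[OF r d(1)]])
  ultimately show "x \<in> ray_image r n" by (auto simp: ray_image_def)
qed

text \<open>\<open>mdiam\<close> is a supremum of real numbers; compactness provides the bound under
  which it dominates the distances.\<close>

lemma D_bounded:
  assumes E: "E u w"
  shows "\<exists>B. \<forall>x\<in>mspace (D (u, w)). \<forall>y\<in>mspace (D (u, w)). mdist (D (u, w)) x y \<le> B"
proof -
  interpret M: Metric_space "mspace (D (u, w))" "mdist (D (u, w))" by simp
  have "compactin M.mtopology (mspace (D (u, w)))"
    using D_compact[OF E] by (simp add: compact_space_def mtopology_of_def)
  then show ?thesis using M.compactin_imp_mbounded M.mbounded_alt by blast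
qed

lemma mdist_le_mdiam:
  assumes E: "E u w" and A: "A \<subseteq> mspace (D (u, w))" and x: "x \<in> A" "y \<in> A"
  shows "mdist (D (u, w)) x y \<le> mdiam (D (u, w)) A"
proof -
  obtain B where B: "\<forall>x\<in>mspace (D (u, w)). \<forall>y\<in>mspace (D (u, w)). mdist (D (u, w)) x y \<le> B"
    using D_bounded[OF E] by blast
  then have "bdd_above ((\<lambda>p. mdist (D (u, w)) (fst p) (snd p)) ` (A \<times> A))"
    using A B by (intro bdd_aboveI[of _ B]) (auto simp: subset_iff)
  then show ?thesis unfolding mdiam_def
    using cSUP_upper[of "(x, y)" "A \<times> A" "\<lambda>p. mdist (D (u, w)) (fst p) (snd p)"] x by simp
qed

lemma ray_image_small:
  assumes r: "is_ray V E r" and e: "\<epsilon> > 0"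
  shows "\<exists>n. mdiam (D (r 0, r (Suc 0))) (ray_image r n) < \<epsilon>"
proof (rule ccontr)
  assume neg: "\<not> ?thesis"
  let ?e = "(r 0, r (Suc 0))"
  let ?B = "{g \<in> {g. epath E g \<and> 2 \<le> length g \<and> hd g = ?e}. mdiam (D ?e) (dg g ` mspace (D (last g))) \<ge> \<epsilon>}"
  have "?e \<in> oedges V E" using ray_E[OF r, of 0] by (simp add: oedges_iff)
  then have fin: "finite ?B" using fine e unfolding ext_fine_def null_family_def by blast
  \<comment> \<open>Fineness speaks of paths with at least two edges, hence the double successor.
    Infinitely many such paths would have large images.\<close>
  have "redges r (Suc (Suc n)) \<in> ?B" for n
  proof -
    have "2 \<le> length (redges r (Suc (Suc n)))" by (simp add: redges_def)
    moreover have "\<epsilon> \<le> mdiam (D ?e) (dg (redges r (Suc (Suc n))) ` mspace (D (last (redges r (Suc (Suc n))))))"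
      using neg unfolding ray_image_def by (simp only: last_redges) (meson linorder_not_le)
    ultimately show ?thesis using epath_redges[OF r, of "Suc n"] by simp
  qed
  then have "range (\<lambda>n. redges r (Suc (Suc n))) \<subseteq> ?B" by blast
  then have "finite (range (\<lambda>n. redges r (Suc (Suc n))))" by (rule finite_subset[OF _ fin])
  moreover have "inj (\<lambda>n. redges r (Suc (Suc n)))"
  proof (rule injI)
    fix m n assume "redges r (Suc (Suc m)) = redges r (Suc (Suc n))"
    then have "length (redges r (Suc (Suc m))) = length (redges r (Suc (Suc n)))" by simp
    then show "m = n" by (simp add: redges_def)
  qed
  ultimately show False using finite_imageD infinite_UNIV_nat by blast
qed

lemma ray_image_unique:
  assumes r: "is_ray V E r" and d: "\<And>n. d \<in> ray_image r n" "\<And>n. d' \<in> ray_image r n"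
  shows "d = d'"
proof (rule ccontr)
  assume neq: "d \<noteq> d'"
  let ?D = "D (r 0, r (Suc 0))"
  have dD: "d \<in> mspace ?D" "d' \<in> mspace ?D" using ray_image_subset[OF r] d by blast+
  then have "mdist ?D d d' > 0"
    using Metric_space.mdist_pos_less[OF Metric_space_mspace_mdist neq] by simp
  then obtain n where "mdiam ?D (ray_image r n) < mdist ?D d d'" using ray_image_small[OF r] by blast
  moreover have "mdist ?D d d' \<le> mdiam ?D (ray_image r n)"
    using mdist_le_mdiam[OF ray_E[OF r]] ray_image_subset[OF r] d by simp
  ultimately show False by simp
qed

lemma ray_image_ex:
  assumes r: "is_ray V E r"
  shows "\<exists>d. \<forall>n. d \<in> ray_image r n"
proof -
  let ?X = "mtopology_of (D (r 0, r (Suc 0)))"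
  have "Hausdorff_space ?X"
    unfolding mtopology_of_def by (rule Metric_space.Hausdorff_space_mtopology) simp
  have closed: "closedin ?X (ray_image r n)" for n
  proof -
    have "compactin (mtopology_of (D (r n, r (Suc n)))) (mspace (D (r n, r (Suc n))))"
      using D_compact[OF ray_E[OF r, of n]] by (simp add: compact_space_def)
    moreover have "continuous_map (mtopology_of (D (r n, r (Suc n)))) ?X (dg (redges r (Suc n)))"
      using dg_cont[OF epath_redges[OF r, of n]] by simp
    ultimately have "compactin ?X (ray_image r n)" unfolding ray_image_def by (rule image_compactin)
    then show ?thesis using \<open>Hausdorff_space ?X\<close> compactin_imp_closedin by blast
  qed
  have "ray_image r n \<noteq> {}" for n
    using S_sub[OF ray_E[OF r, of n]] S_nonempty[OF ray_E[OF r, of n]] by (auto simp: ray_image_def)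
  moreover have "decseq (ray_image r)" using ray_image_Suc[OF r] by (rule decseq_SucI)
  ultimately have "(\<Inter>n. ray_image r n) \<noteq> {}"
    using compact_space_imp_nest[OF D_compact[OF ray_E[OF r, of 0]], of "ray_image r"] closed by simp
  then show ?thesis by blast
qed

definition ray_point :: "(nat \<Rightarrow> 'v) \<Rightarrow> 'a" where
  "ray_point r = (SOME d. \<forall>n. d \<in> ray_image r n)"

lemma ray_point_in: "is_ray V E r \<Longrightarrow> ray_point r \<in> ray_image r n"
  using someI_ex[OF ray_image_ex, of r] unfolding ray_point_def by blast

lemma ray_point_eq: "is_ray V E r \<Longrightarrow> (\<And>n. d \<in> ray_image r n) \<Longrightarrow> d = ray_point r"
  using ray_image_unique ray_point_in by blast

lemma ray_point_D: "is_ray V E r \<Longrightarrow> ray_point r \<in> mspace (D (r 0, r (Suc 0)))"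
  using ray_point_in[of r 0] by (simp add: ray_image_0)

lemma ray_point_nbhd:
  assumes r: "is_ray V E r" and Q: "openin (mtopology_of (D (r 0, r (Suc 0)))) Q" "ray_point r \<in> Q"
  shows "\<exists>n. ray_image r n \<subseteq> Q"
proof -
  let ?D = "D (r 0, r (Suc 0))"
  interpret M: Metric_space "mspace ?D" "mdist ?D" by simp
  have "openin M.mtopology Q" using Q(1) by (simp add: mtopology_of_def)
  then obtain \<epsilon> where e: "\<epsilon> > 0" "M.mball (ray_point r) \<epsilon> \<subseteq> Q" using Q(2) M.openin_mtopology by blast
  obtain n where n: "mdiam ?D (ray_image r n) < \<epsilon>" using ray_image_small[OF r e(1)] by blast
  have "ray_image r n \<subseteq> M.mball (ray_point r) \<epsilon>"
  proof
    fix d assume d: "d \<in> ray_image r n"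
    have "mdist ?D (ray_point r) d \<le> mdiam ?D (ray_image r n)"
      using mdist_le_mdiam[OF ray_E[OF r] ray_image_subset[OF r]] ray_point_in[OF r] d by simp
    then show "d \<in> M.mball (ray_point r) \<epsilon>" using n ray_image_subset[OF r] d ray_point_D[OF r] by (auto simp: M.in_mball)
  qed
  then show ?thesis using e(2) by blast
qed

text \<open>By uniqueness of the common point it suffices that the left side lies in every
  \<open>ray_image r n\<close>; a new first edge shifts the index of the images by one.\<close>

lemma ray_point_delta:
  assumes r: "is_ray V E r"
  shows "delta (r 0, r (Suc 0)) (iD (r (Suc 0), r (Suc (Suc 0))) (ray_point (\<lambda>i. r (Suc i)))) = ray_point r"
proof (rule ray_point_eq[OF r])
  let ?r' = "\<lambda>i. r (Suc i)"
  have r': "is_ray V E ?r'" using is_ray_shift[OF r, of 1] by simp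
  fix n
  show "delta (r 0, r (Suc 0)) (iD (r (Suc 0), r (Suc (Suc 0))) (ray_point ?r')) \<in> ray_image r n"
  proof (cases n)
    case 0
    then show ?thesis
      using delta_in[OF ray_E[OF r] iD_ray_hKe[OF r ray_point_D[OF r']]] by (simp add: ray_image_0)
  next
    case (Suc m)
    obtain y where y: "y \<in> mspace (D (r (Suc m), r (Suc (Suc m))))" "ray_point ?r' = dg (redges ?r' (Suc m)) y"
      using ray_point_in[OF r', of m] by (auto simp: ray_image_def)
    have "dg (redges r (Suc (Suc m))) y =
        delta (r 0, r (Suc 0)) (iD (r (Suc 0), r (Suc (Suc 0))) (dg (redges ?r' (Suc m)) y))"
      unfolding redges_Suc'[of r "Suc m"] by (simp add: redges_Suc'[of ?r' m])
    then show ?thesis unfolding Suc ray_image_def y(2)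
      by (rule image_eqI[OF sym y(1)])
  qed
qed

lemma hchn_ray_point:
  assumes r: "is_ray V E r"
  shows "hchn (redges r n) (iD (r n, r (Suc n)) (ray_point (\<lambda>i. r (i + n)))) = iD (r 0, r (Suc 0)) (ray_point r)"
proof (induction n)
  case (Suc n)
  have "delta (r n, r (Suc n)) (iD (r (Suc n), r (Suc (Suc n))) (ray_point (\<lambda>i. r (i + Suc n)))) = ray_point (\<lambda>i. r (i + n))"
    using ray_point_delta[OF is_ray_shift[OF r, of n]] by simp
  then show ?case using Suc by (simp add: redges_Suc hchn_append)
qed simp

section \<open>Separating points of the spaces in the inverse system\<close>

text \<open>A point of \<open>K\<^sub>F\<close> can also be a point of
  \<open>\<Delta>\<^sub>e\<close> only if it lies on \<open>\<Sigma>\<^sub>e\<close> with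
  \<open>e\<close> leaving \<open>F\<close>. The assumption \<open>settled\<close> excludes this at
  \<open>s\<close>, and disjointness of the \<open>\<Sigma>\<close> excludes it at a glued
  partner.\<close>

lemma hclass_iK_neq_iD:
  assumes F: "F \<in> subtrees V E" and s: "s \<in> F" "x \<in> mspace (Km s)"
    and settled: "\<And>w. E s w \<Longrightarrow> x \<in> Sg (s, w) \<Longrightarrow> w \<in> F"
    and u: "u \<in> F" "E u w" "w \<notin> F" "d \<in> mspace (D (u, w))"
  shows "hrel F `` {(s, iK s x)} \<noteq> hrel F `` {(u, iD (u, w) d)}"
proof
  have FV: "F \<subseteq> V" by (rule subtreeD(3)[OF F])
  have iD: "y \<in> Sg (u, w)" if "iK u y = iD (u, w) d" "y \<in> mspace (Km u)" for y
    using iK_eq_iD_iff[OF u(2) that(2) u(4)] that psi_in[OF u(2)] by auto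
  assume "hrel F `` {(s, iK s x)} = hrel F `` {(u, iD (u, w) d)}"
  then consider "s = u" "iK s x = iD (u, w) d"
    | y where "E s u" "y \<in> Sg (s, u)" "iK s x = iK s y" "iD (u, w) d = iK u (phi (s, u) y)"
    using hclass_eq_iff[OF FV s(1) iK_prt[OF s(1) FV s(2)] u(1) iD_prt[OF u(1) FV u(2-4)]] by blast
  then show False
  proof cases
    case 1 then show ?thesis using iD[of x] settled[of w] s u by auto
  next
    case 2
    have "phi (s, u) y \<in> Sg (u, s)" by (rule phi_in[OF 2(1,2)])
    moreover from this have "phi (s, u) y \<in> Sg (u, w)"
      using iD[of "phi (s, u) y"] 2 Sg_mspace[OF E_sym[OF 2(1)]] by auto
    ultimately have "s = w" using Sg_disj[OF E_sym[OF 2(1)] u(2)] by blast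
    then show ?thesis using s u by simp
  qed
qed

text \<open>Gluing in \<open>hat K\<^sub>F\<close> only involves \<open>\<Sigma>\<close> of edges
  inside \<open>F\<close>, which are disjoint from the \<open>\<Sigma>\<close> of outgoing edges. So
  the outgoing \<open>\<Delta>\<^sub>e\<close> embed with disjoint images.\<close>

lemma hclass_iD_eq:
  assumes F: "F \<in> subtrees V E" and u: "u \<in> F" "E u w" "w \<notin> F" "d \<in> mspace (D (u, w))"
    and u': "u' \<in> F" "E u' w'" "w' \<notin> F" "d' \<in> mspace (D (u', w'))"
    and eq: "hrel F `` {(u, iD (u, w) d)} = hrel F `` {(u', iD (u', w') d')}"
  shows "u = u' \<and> w = w' \<and> d = d'"
proof -
  have FV: "F \<subseteq> V" by (rule subtreeD(3)[OF F])
  consider "u = u'" "iD (u, w) d = iD (u', w') d'"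
    | y where "E u u'" "y \<in> Sg (u, u')" "iD (u, w) d = iK u y"
    using eq hclass_eq_iff[OF FV u(1) iD_prt[OF u(1) FV u(2-4)] u'(1) iD_prt[OF u'(1) FV u'(2-4)]] by blast
  then show ?thesis
  proof cases
    case 1 then show ?thesis using iD_eq_iff[of u w w' d d'] u u' by auto
  next
    case 2
    have "y \<in> Sg (u, w)"
      using iK_eq_iD_iff[OF u(2) _ u(4), of y] 2 Sg_mspace[OF 2(1,2)] psi_in[OF u(2)] by auto
    then have "w = u'" using Sg_disj[OF u(2) 2(1)] 2(2) by blast
    then show ?thesis using u u' by simp
  qed
qed

text \<open>At most one of the disjoint sets \<open>\<Sigma>\<close> at \<open>s\<close> contains
  \<open>x\<close>, so one added neighbour is enough.\<close>

lemma settled_ex: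
  assumes s: "s \<in> V"
  shows "\<exists>F\<in>subtrees V E. s \<in> F \<and> (\<forall>w. E s w \<and> x \<in> Sg (s, w) \<longrightarrow> w \<in> F)"
proof (cases "\<exists>w. E s w \<and> x \<in> Sg (s, w)")
  case True
  then obtain w where w: "E s w" "x \<in> Sg (s, w)" by blast
  have "insert w {s} \<in> subtrees V E" using subtree_insert[OF subtree_singleton[OF s] _ w(1)] by simp
  then show ?thesis using w Sg_disj[OF w(1)] by (intro bexI[of _ "insert w {s}"]) auto
next
  case False
  then show ?thesis using subtree_singleton[OF s] by (intro bexI[of _ "{s}"]) auto
qed

section \<open>The map from the limit of the tree system to the inverse limit\<close>

text \<open>Runs from points to threads, opposite to the map of the theorem, since threads can be
  written down directly. Restriction to subtrees makes the value extensional, as elements of the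
  product must be.\<close>

definition Phi :: "(('v \<times> 'a) set + (nat \<Rightarrow> 'v) set) \<Rightarrow> 'v set \<Rightarrow> ('v \<times> ('v, 'a) pt) set" where
  "Phi z = (\<lambda>F\<in>subtrees V E. case z of
      Inl c \<Rightarrow> (let r = SOME r. r \<in> c in hrel F `` {hrw F (fst r, iK (fst r) (snd r))})
    | Inr xi \<Rightarrow> (let r = fray F xi in hrel F `` {(r 0, iD (r 0, r (Suc 0)) (ray_point r))}))"

lemma Phi_Inl:
  assumes F: "F \<in> subtrees V E" and s: "s \<in> V" and x: "x \<in> mspace (Km s)"
  shows "Phi (Inl (rel V `` {(s, x)})) F = hrel F `` {hrw F (s, iK s x)}"
proof -
  define r where "r = (SOME r. r \<in> rel V `` {(s, x)})"
  have "(s, x) \<in> rel V `` {(s, x)}" using s x by (simp add: rel_iff)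
  then have "r \<in> rel V `` {(s, x)}" unfolding r_def by (rule someI)
  then obtain s' x' where r: "r = (s', x')" "(s', x') \<in> rel V `` {(s, x)}" by (cases r) auto
  have "s = s' \<and> x = x' \<or> E s s' \<and> x \<in> Sg (s, s') \<and> x' = phi (s, s') x"
    using class_rep(3)[OF s _ r(2)] x by simp
  then have "hrel F `` {hrw F (s', iK s' x')} = hrel F `` {hrw F (s, iK s x)}"
    using hclass_glue[OF F] by metis
  moreover have "Phi (Inl (rel V `` {(s, x)})) F = hrel F `` {hrw F (fst r, iK (fst r) (snd r))}"
    using F unfolding Phi_def r_def by (simp add: Let_def)
  ultimately show ?thesis by (simp add: r(1))
qed

lemma Phi_Inl_in:
  assumes F: "F \<in> subtrees V E" and s: "s \<in> F" and x: "x \<in> mspace (Km s)"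
  shows "Phi (Inl (rel V `` {(s, x)})) F = hrel F `` {(s, iK s x)}"
  using Phi_Inl[OF F _ x] s subtreeD(3)[OF F] by (auto simp: hrw_in)

lemma Phi_Inr:
  assumes F: "F \<in> subtrees V E" and r: "r = fray F xi"
  shows "Phi (Inr xi) F = hrel F `` {(r 0, iD (r 0, r (Suc 0)) (ray_point r))}"
  using F r by (simp add: Phi_def Let_def)

lemma tlim_cases:
  assumes "z \<in> topspace tlim"
  obtains (pt) s x where "s \<in> V" "x \<in> mspace (Km s)" "z = Inl (rel V `` {(s, x)})"
    | (end_pt) xi where "xi \<in> tree_ends V E" "z = Inr xi"
proof -
  consider c where "c \<in> raw V // rel V" "z = Inl c" | xi where "xi \<in> tree_ends V E" "z = Inr xi"
    using assms unfolding topspace_tlim by blast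
  then show thesis
  proof cases
    case 1
    then obtain s x where "s \<in> V" "x \<in> topspace (mtopology_of (Km s))" "c = rel V `` {(s, x)}"
      using quotient_class by metis
    then show ?thesis using pt 1 by simp
  qed (rule end_pt)
qed

lemma Inl_in_tlim: "s \<in> V \<Longrightarrow> x \<in> mspace (Km s) \<Longrightarrow> Inl (rel V `` {(s, x)}) \<in> topspace tlim"
  unfolding topspace_tlim using class_quotient[of s V x] by auto

lemma Inr_in_tlim: "xi \<in> tree_ends V E \<Longrightarrow> Inr xi \<in> topspace tlim"
  unfolding topspace_tlim by auto

lemma fray_facts:
  assumes F: "F \<in> subtrees V E" and xi: "xi \<in> tree_ends V E" and r: "r = fray F xi"
  shows "is_ray V E r" "r 0 \<in> F" "r (Suc n) \<notin> F" "r \<in> xi" "exit_ray V E F r"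
  using fray[OF F xi] r by (auto simp: exit_ray_def)

lemma fpath_redges:
  assumes "F \<in> subtrees V E" "exit_ray V E F r"
  shows "fpath E F (r (Suc n)) = redges r (Suc n)"
  using fpath_eq[OF assms(1) exit_ray_path[OF assms(2), of "Suc n"]] by simp

lemma Phi_rep:
  assumes F: "F \<in> subtrees V E" and z: "z \<in> topspace tlim"
  obtains s p where "s \<in> F" "p \<in> prt F s" "Phi z F = hrel F `` {(s, p)}"
  using z
proof (cases rule: tlim_cases)
  case (pt s x)
  have "hrw F (s, iK s x) \<in> Sigma F (prt F)" by (rule hrw_valid[OF F valid_iK[OF F pt(1,2)]])
  then show ?thesis using that Phi_Inl[OF F pt(1,2)] pt(3) by (cases "hrw F (s, iK s x)") auto
next
  case (end_pt xi)
  define r where "r = fray F xi"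
  note rf = fray_facts[OF F end_pt(1) r_def]
  have "iD (r 0, r (Suc 0)) (ray_point r) \<in> prt F (r 0)"
    using iD_prt[OF rf(2) subtreeD(3)[OF F] ray_E[OF rf(1)] rf(3) ray_point_D[OF rf(1)]] .
  then show ?thesis using that rf(2) Phi_Inr[OF F r_def] end_pt(2) by blast
qed

lemma Phi_thread:
  assumes F: "F \<in> subtrees V E" and F': "F' \<in> subtrees V E" and sub: "F \<subseteq> F'" and z: "z \<in> topspace tlim"
  shows "hmp F F' (Phi z F') = Phi z F"
  using z
proof (cases rule: tlim_cases)
  case (pt s x)
  obtain s' p' where sp: "hrw F' (s, iK s x) = (s', p')" by (cases "hrw F' (s, iK s x)")
  then have "s' \<in> F'" "p' \<in> prt F' s'" using hrw_valid[OF F' valid_iK[OF F' pt(1,2)]] by auto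
  then have "hmp F F' (hrel F' `` {(s', p')}) = hrel F `` {hrw F (s', p')}" by (rule hmp_class[OF F F' sub])
  also have "hrw F (s', p') = hrw F (s, iK s x)" using hrw_comp[OF F F' sub pt(1), of "iK s x"] sp by simp
  finally show ?thesis using Phi_Inl[OF F pt(1,2)] Phi_Inl[OF F' pt(1,2)] sp pt(3) by simp
next
  case (end_pt xi)
  define r where "r = fray F xi"
  define r' where "r' = fray F' xi"
  note rf = fray_facts[OF F end_pt(1) r_def]
  note rf' = fray_facts[OF F' end_pt(1) r'_def]
  obtain N where N: "r' = (\<lambda>n. r (n + N))" using fray_shift[OF F F' sub end_pt(1)] r_def r'_def by metis
  let ?p = "iD (r' 0, r' (Suc 0)) (ray_point r')"
  have "?p \<in> prt F' (r' 0)"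
    using iD_prt[OF rf'(2) subtreeD(3)[OF F'] ray_E[OF rf'(1)] rf'(3) ray_point_D[OF rf'(1)]] .
  then have h: "hmp F F' (Phi z F') = hrel F `` {hrw F (r' 0, ?p)}"
    using hmp_class[OF F F' sub rf'(2)] Phi_Inr[OF F' r'_def] end_pt(2) by simp
  \<comment> \<open>The ray seen from \<open>F\<close> is the ray seen from \<open>F'\<close> with
    \<open>N\<close> edges in front; pulling back along them turns one \<open>ray_point\<close> into
    the other.\<close>
  have "hrw F (r' 0, ?p) = (r 0, iD (r 0, r (Suc 0)) (ray_point r))"
  proof (cases N)
    case 0
    then show ?thesis using N rf(2) by (simp add: hrw_in)
  next
    case (Suc n)
    have "r' 0 \<notin> F" using rf(3) N Suc by simp
    moreover have "fpath E F (r' 0) = redges r N" using fpath_redges[OF F rf(5), of n] N Suc by simp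
    moreover have "hchn (redges r N) ?p = iD (r 0, r (Suc 0)) (ray_point r)"
      using hchn_ray_point[OF rf(1), of N] N by simp
    moreover have "fst (hd (redges r N)) = r 0" using Suc by simp
    ultimately show ?thesis by (simp add: hrw_out)
  qed
  then show ?thesis using h Phi_Inr[OF F r_def] end_pt(2) by simp
qed

abbreviation "invl \<equiv> invlim V E Km Sg phi D S psi delta"

lemma topspace_invl:
  "x \<in> topspace invl \<longleftrightarrow> x \<in> extensional (subtrees V E) \<and> (\<forall>F\<in>subtrees V E. x F \<in> topspace (hKF F)) \<and>
    (\<forall>F\<in>subtrees V E. \<forall>F'\<in>subtrees V E. F \<subseteq> F' \<longrightarrow> hmp F F' (x F') = x F)"
  unfolding invlim_def topspace_subtopology topspace_product_topology PiE_def by auto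

lemma Phi_in_invl:
  assumes z: "z \<in> topspace tlim" shows "Phi z \<in> topspace invl"
proof -
  have "Phi z F \<in> topspace (hKF F)" if "F \<in> subtrees V E" for F
    using Phi_rep[OF that z] hclass_in by metis
  moreover have "Phi z \<in> extensional (subtrees V E)" by (simp add: Phi_def)
  ultimately show ?thesis using Phi_thread z unfolding topspace_invl by blast
qed

text \<open>Coordinates are determined from above, and every subtree lies in one that contains
  \<open>F0\<close>.\<close>

lemma thread_eq_Phi:
  assumes x: "x \<in> topspace invl" and z: "z \<in> topspace tlim" and F0: "F0 \<in> subtrees V E"
    and eq: "\<And>F. F \<in> subtrees V E \<Longrightarrow> F0 \<subseteq> F \<Longrightarrow> x F = Phi z F"
  shows "x = Phi z"
proof (rule extensionalityI[of _ "subtrees V E"])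
  show "x \<in> extensional (subtrees V E)" "Phi z \<in> extensional (subtrees V E)"
    using x Phi_in_invl[OF z] unfolding topspace_invl by auto
  fix F assume F: "F \<in> subtrees V E"
  obtain F' where F': "F' \<in> subtrees V E" "F \<subseteq> F'" "F0 \<subseteq> F'"
    using subtree_extend_set[OF F subtreeD(1,3)[OF F0]] by blast
  have "x F = hmp F F' (x F')" using x F F' unfolding topspace_invl by simp
  also have "\<dots> = Phi z F" using eq F' Phi_thread[OF F F'(1,2) z] by simp
  finally show "x F = Phi z F" .
qed

text \<open>A point and an end are separated at a subtree where the point is settled, two points at
  a subtree containing both vertices, two ends by the edges that their coordinates select.\<close>

lemma Phi_inj:
  assumes z: "z \<in> topspace tlim" and z': "z' \<in> topspace tlim" and eq: "Phi z = Phi z'"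
  shows "z = z'"
proof -
  have mixed: False if s: "s \<in> V" "x \<in> mspace (Km s)" and xi: "xi \<in> tree_ends V E"
    and eq: "Phi (Inl (rel V `` {(s, x)})) = Phi (Inr xi)" for s x xi
  proof -
    obtain F where F: "F \<in> subtrees V E" "s \<in> F" "\<forall>w. E s w \<and> x \<in> Sg (s, w) \<longrightarrow> w \<in> F"
      using settled_ex[OF s(1)] by blast
    define r where "r = fray F xi"
    note rf = fray_facts[OF F(1) xi r_def]
    have "hrel F `` {(s, iK s x)} = hrel F `` {(r 0, iD (r 0, r (Suc 0)) (ray_point r))}"
      using Phi_Inl_in[OF F(1,2) s(2)] Phi_Inr[OF F(1) r_def] eq by simp
    then show False
      using hclass_iK_neq_iD[OF F(1,2) s(2) _ rf(2) ray_E[OF rf(1)] rf(3) ray_point_D[OF rf(1)]] F(3) by blast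
  qed
  from z show ?thesis
  proof (cases rule: tlim_cases)
    case (pt s x)
    note p1 = pt
    from z' show ?thesis
    proof (cases rule: tlim_cases)
      case (pt s' x')
      obtain F where F: "F \<in> subtrees V E" "s \<in> F" "s' \<in> F"
        using subtree_extend[OF subtree_singleton[OF p1(1)] pt(1)] by blast
      have FV: "F \<subseteq> V" by (rule subtreeD(3)[OF F(1)])
      have "hrel F `` {(s, iK s x)} = hrel F `` {(s', iK s' x')}"
        using Phi_Inl_in[OF F(1,2) p1(2)] Phi_Inl_in[OF F(1,3) pt(2)] eq pt(3) p1(3) by simp
      then consider "s = s'" "iK s x = iK s' x'"
        | y where "E s s'" "y \<in> Sg (s, s')" "iK s x = iK s y" "iK s' x' = iK s' (phi (s, s') y)"
        using hclass_eq_iff[OF FV F(2) iK_prt[OF F(2) FV p1(2)] F(3) iK_prt[OF F(3) FV pt(2)]] by blast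
      then show ?thesis
      proof cases
        case 1 then show ?thesis using iK_eq_iff[OF p1(1,2), of x'] pt p1 by simp
      next
        case 2
        have "x = y" using iK_eq_iff[OF p1(1,2) Sg_mspace[OF 2(1,2)]] 2 by simp
        moreover have "x' = phi (s, s') y"
          using iK_eq_iff[OF pt(1,2) Sg_mspace[OF E_sym[OF 2(1)] phi_in[OF 2(1,2)]]] 2 by simp
        ultimately show ?thesis using class_glue[OF 2(1,2) p1(1) pt(1)] pt(3) p1(3) by simp
      qed
    next
      case (end_pt xi) then show ?thesis using mixed[of s x xi] pt eq by simp
    qed
  next
    case (end_pt xi)
    note p1 = end_pt
    from z' show ?thesis
    proof (cases rule: tlim_cases)
      case (pt s x) then show ?thesis using mixed[of s x xi] p1 eq by simp
    next
      case (end_pt xi')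
      obtain t where t: "t \<in> V" using is_tree by (auto simp: is_tree_def)
      define r where "r = fray {t} xi"
      define r' where "r' = fray {t} xi'"
      note tt = subtree_singleton[OF t]
      note rf = fray_facts[OF tt p1(1) r_def]
      note rf' = fray_facts[OF tt end_pt(1) r'_def]
      \<comment> \<open>While the rays agree, their initial segments span the same subtree; equal
        coordinates there lie in \<open>\<Delta>\<close> of the same outgoing edge, so the next
        vertices agree too.\<close>
      have rr: "r n = r' n" for n
      proof (induction n rule: less_induct)
        case (less n)
        show ?case
        proof (cases n)
          case 0 then show ?thesis using rf(2) rf'(2) by simp
        next
          case (Suc m)
          let ?F = "{t} \<union> r ` {..m}"
          have F: "?F \<in> subtrees V E" and e: "exit_ray V E ?F (\<lambda>i. r (i + m))"
            using subtree_add_ray[OF tt rf(5)] by auto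
          have F': "{t} \<union> r' ` {..m} = ?F" using less Suc by auto
          have e': "exit_ray V E ?F (\<lambda>i. r' (i + m))"
            using subtree_add_ray(2)[OF tt rf'(5), of m] unfolding F' .
          have q: "(\<lambda>i. r (i + m)) = fray ?F xi" "(\<lambda>i. r' (i + m)) = fray ?F xi'"
            using fray_eq[OF F p1(1) shift_in_end[OF p1(1) rf(4)] e]
              fray_eq[OF F end_pt(1) shift_in_end[OF end_pt(1) rf'(4)] e'] by auto
          note g = fray_facts[OF F p1(1) q(1)]
          note g' = fray_facts[OF F end_pt(1) q(2)]
          have "Phi z ?F = Phi z' ?F" using eq by simp
          then have "r (Suc 0 + m) = r' (Suc 0 + m)"
            unfolding p1(2) end_pt(2) Phi_Inr[OF F q(1)] Phi_Inr[OF F q(2)]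
            using hclass_iD_eq[OF F g(2) ray_E[OF g(1)] g(3) ray_point_D[OF g(1)]
              g'(2) ray_E[OF g'(1)] g'(3) ray_point_D[OF g'(1)]] by blast
          then show ?thesis using Suc by simp
        qed
      qed
      then have "r = r'" by blast
      then have "a \<in> xi \<longleftrightarrow> a \<in> xi'" for a
        using tree_endsD(2)[OF p1(1) rf(4), of a] tree_endsD(2)[OF end_pt(1) rf'(4), of a] by simp
      then show ?thesis using p1 end_pt by blast
    qed
  qed
qed

section \<open>Every thread comes from a point of the limit\<close>

text \<open>A representative outside \<open>F\<close> is moved by \<open>hrw\<close> into some
  outgoing \<open>\<Delta>\<close>, which a settled point avoids. So the coordinate at
  \<open>F'\<close> has a representative in \<open>F\<close>, and there \<open>hrw\<close> changes
  nothing.\<close>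

lemma thread_settled:
  assumes x: "x \<in> topspace invl" and F: "F \<in> subtrees V E" and F': "F' \<in> subtrees V E" and sub: "F \<subseteq> F'"
    and s: "s \<in> F" "y \<in> mspace (Km s)" and settled: "\<And>w. E s w \<Longrightarrow> y \<in> Sg (s, w) \<Longrightarrow> w \<in> F"
    and xF: "x F = hrel F `` {(s, iK s y)}"
  shows "x F' = hrel F' `` {(s, iK s y)}"
proof -
  have FV: "F \<subseteq> V" "F' \<subseteq> V" using subtreeD(3) F F' by auto
  have "x F' \<in> topspace (hKF F')" using x F' unfolding topspace_invl by blast
  then obtain s' p' where sp: "s' \<in> F'" "p' \<in> prt F' s'" "x F' = hrel F' `` {(s', p')}"
    by (rule hclass_cases)
  have v: "valid F s' p'" by (rule valid_mono[OF F F' sub sp(1,2)])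
  have "hmp F F' (x F') = x F" using x F F' sub unfolding topspace_invl by blast
  then have eq: "hrel F `` {hrw F (s', p')} = hrel F `` {(s, iK s y)}"
    using hmp_class[OF F F' sub sp(1,2)] sp(3) xF by simp
  have sF': "s \<in> F'" using s(1) sub by blast
  have iKF: "iK s y \<in> prt F s" "iK s y \<in> prt F' s" using iK_prt s FV sF' by auto
  show ?thesis
  proof (cases "s' \<in> F")
    case True
    then have "p' \<in> prt F s'" using v by (simp add: valid_def)
    then have "s' = s \<and> p' = iK s y \<or> E s' s \<and> (\<exists>x\<in>Sg (s', s). p' = iK s' x \<and> iK s y = iK s (phi (s', s) x))"
      using eq hclass_eq_iff[OF FV(1) True _ s(1) iKF(1), of p'] hrw_in[OF True, of p'] by simp
    then show ?thesis
      using hclass_eq_iff[OF FV(2) sp(1,2) sF' iKF(2)] sp(3) by simp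
  next
    case False
    then have "s' \<in> V - F" "p' \<in> hKe (last (fpath E F s'))" using v by (auto simp: valid_def)
    then obtain u w d where "E u w" "u \<in> F" "w \<notin> F" "d \<in> mspace (D (u, w))"
      "hrw F (s', p') = (u, iD (u, w) d)" using hrw_out_cases[OF F] by metis
    then show ?thesis using eq hclass_iK_neq_iD[OF F s settled] by metis
  qed
qed

text \<open>\<open>hclass_iD_eq\<close> turns the thread condition from an equality of classes into
  one of representatives, whether \<open>u'\<close> already lies in \<open>F\<close> or
  \<open>hrw\<close> has to move it there.\<close>

lemma thread_consistent:
  assumes x: "x \<in> topspace invl" and F: "F \<in> subtrees V E" and F': "F' \<in> subtrees V E" and sub: "F \<subseteq> F'"
    and e: "u \<in> F" "E u w" "w \<notin> F" "d \<in> mspace (D (u, w))" "x F = hrel F `` {(u, iD (u, w) d)}"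
    and e': "u' \<in> F'" "E u' w'" "w' \<notin> F'" "d' \<in> mspace (D (u', w'))" "x F' = hrel F' `` {(u', iD (u', w') d')}"
  shows "u' \<in> F \<Longrightarrow> u = u' \<and> w = w'"
    and "u' \<notin> F \<Longrightarrow> (u, w) = hd (fpath E F u') \<and> iD (u, w) d = hchn (fpath E F u') (iD (u', w') d')"
proof -
  have p': "iD (u', w') d' \<in> prt F' u'" by (rule iD_prt[OF e'(1) subtreeD(3)[OF F'] e'(2-4)])
  have "hmp F F' (x F') = x F" using x F F' sub unfolding topspace_invl by blast
  then have eq: "hrel F `` {(u, iD (u, w) d)} = hrel F `` {hrw F (u', iD (u', w') d')}"
    using hmp_class[OF F F' sub e'(1) p'] e(5) e'(5) by simp
  show "u = u' \<and> w = w'" if u': "u' \<in> F"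
    using hclass_iD_eq[OF F e(1-4) u' e'(2) _ e'(4)] eq hrw_in[OF u', of "iD (u', w') d'"] e'(3) sub by auto
  assume u': "u' \<notin> F"
  then have "u' \<in> V - F" "iD (u', w') d' \<in> hKe (last (fpath E F u'))"
    using valid_mono[OF F F' sub e'(1) p'] by (auto simp: valid_def)
  then obtain a b c where abc: "hd (fpath E F u') = (a, b)" "E a b" "a \<in> F" "b \<notin> F" "c \<in> mspace (D (a, b))"
    "hrw F (u', iD (u', w') d') = (a, iD (a, b) c)" using hrw_out_cases[OF F] by metis
  then have "u = a \<and> w = b \<and> d = c" using eq hclass_iD_eq[OF F e(1-4) abc(3,2,4,5)] by simp
  then show "(u, w) = hd (fpath E F u') \<and> iD (u, w) d = hchn (fpath E F u') (iD (u', w') d')"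
    using abc hrw_out[OF u'] by simp
qed

lemma unsettled_thread:
  assumes x: "x \<in> topspace invl"
    and unsettled: "\<And>F. F \<in> subtrees V E \<Longrightarrow> \<exists>u w d. u \<in> F \<and> E u w \<and> w \<notin> F \<and> d \<in> mspace (D (u, w)) \<and>
      x F = hrel F `` {(u, iD (u, w) d)}"
  shows "\<exists>xi\<in>tree_ends V E. x = Phi (Inr xi)"
proof -
  have "\<forall>F\<in>subtrees V E. \<exists>u w d. u \<in> F \<and> E u w \<and> w \<notin> F \<and> d \<in> mspace (D (u, w)) \<and>
      x F = hrel F `` {(u, iD (u, w) d)}" using unsettled by blast
  then obtain u w d where uwd: "\<forall>F\<in>subtrees V E. u F \<in> F \<and> E (u F) (w F) \<and> w F \<notin> F \<and>
      d F \<in> mspace (D (u F, w F)) \<and> x F = hrel F `` {(u F, iD (u F, w F) (d F))}" by metis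
  have con1: "u F = u F' \<and> w F = w F'"
    if "F \<in> subtrees V E" "F' \<in> subtrees V E" "F \<subseteq> F'" "u F' \<in> F" for F F'
    using thread_consistent(1)[OF x that(1-3)] uwd that by blast
  have con2: "(u F, w F) = hd (fpath E F (u F')) \<and> iD (u F, w F) (d F) = hchn (fpath E F (u F')) (iD (u F', w F') (d F'))"
    if "F \<in> subtrees V E" "F' \<in> subtrees V E" "F \<subseteq> F'" "u F' \<notin> F" for F F'
    using thread_consistent(2)[OF x that(1-3)] uwd that by blast
  obtain t where t: "t \<in> V" using is_tree by (auto simp: is_tree_def)
  \<comment> \<open>Follow the thread: each step adds the far vertex of the edge whose
    \<open>\<Delta>\<close> contains the coordinate at the current subtree. The added vertices form
    the ray.\<close>
  define Fs where "Fs = rec_nat {t} (\<lambda>_ F. insert (w F) F)"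
  have Fs0: "Fs 0 = {t}" and FsS: "Fs (Suc n) = insert (w (Fs n)) (Fs n)" for n by (simp_all add: Fs_def)
  define r where "r n = (case n of 0 \<Rightarrow> t | Suc m \<Rightarrow> w (Fs m))" for n
  have r0: "r 0 = t" and rS: "r (Suc n) = w (Fs n)" for n by (simp_all add: r_def)
  have Fs: "Fs n \<in> subtrees V E" for n
  proof (induction n)
    case 0 then show ?case using subtree_singleton[OF t] by (simp add: Fs0)
  next
    case (Suc n) then show ?case unfolding FsS using uwd by (intro subtree_insert[of "Fs n" "u (Fs n)"]) auto
  qed
  have Fs_eq: "Fs n = r ` {..n}" for n
    by (induction n) (auto simp: Fs0 FsS r0 rS atMost_Suc)
  \<comment> \<open>The next edge starts at the vertex just added: if it started earlier,
    consistency would make it the previous edge, whose far vertex is no longer outside.\<close>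
  have u: "u (Fs n) = r n" for n
  proof (cases n)
    case 0 then show ?thesis using uwd Fs[of 0] by (auto simp: Fs0 r0)
  next
    case (Suc m)
    have "u (Fs n) \<notin> Fs m"
    proof
      assume "u (Fs n) \<in> Fs m"
      then have "w (Fs m) = w (Fs n)" using con1[OF Fs Fs, of m n] by (auto simp: Suc FsS)
      then show False using uwd Fs[of n] by (auto simp: Suc FsS)
    qed
    then show ?thesis using uwd Fs[of n] by (auto simp: Suc FsS rS)
  qed
  have rE: "E (r n) (r (Suc n))" for n using uwd Fs[of n] u[of n] rS[of n] by auto
  have new: "r (Suc n) \<notin> r ` {..n}" for n using uwd Fs[of n] unfolding rS Fs_eq by auto
  have "r m \<noteq> r n" if mn: "m < n" for m n
  proof -
    obtain k where "n = Suc (m + k)" using less_imp_Suc_add[OF mn] by blast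
    moreover have "r m \<in> r ` {..m + k}" by simp
    ultimately show ?thesis using new[of "m + k"] by metis
  qed
  then have "inj r" by (metis injI linorder_neqE_nat)
  then have ray: "is_ray V E r" using rE E_V by (auto simp: is_ray_def)
  then obtain xi where xi: "xi \<in> tree_ends V E" "r \<in> xi" using ray_end by blast
  \<comment> \<open>Let \<open>N\<close> be the last visit of the ray to \<open>F\<close>. If
    \<open>u F\<close> were outside \<open>Fs N\<close>, consistency would send the path from
    \<open>Fs N\<close> to \<open>u F\<close> through \<open>r (Suc N)\<close>; but this path stays
    in \<open>F\<close>.\<close>
  have dir_big: "(u F, w F) = (fray F xi 0, fray F xi (Suc 0))" if F: "F \<in> subtrees V E" "t \<in> F" for F
  proof -
    obtain N where N: "exit_ray V E F (\<lambda>n. r (n + N))" "\<forall>i. 0 \<le> i \<and> i \<le> N \<longrightarrow> r i \<in> F"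
      using exit_ray_shift[OF ray F(1), of 0] F(2) r0 by auto
    have fr: "fray F xi = (\<lambda>n. r (n + N))" by (rule fray_eq[OF F(1) xi(1) shift_in_end[OF xi] N(1)])
    have sub: "Fs N \<subseteq> F" using N(2) by (auto simp: Fs_eq)
    have eN: "u (Fs N) = r N" "w (Fs N) = r (Suc N)" using u rS by auto
    have rSN: "r (Suc N) \<notin> F" using N(1) by (auto simp: exit_ray_def)
    have "u F \<in> Fs N"
    proof (rule ccontr)
      assume nin: "u F \<notin> Fs N"
      have uF: "u F \<in> F - Fs N" using uwd F nin by auto
      have "hd (fpath E (Fs N) (u F)) = (r N, r (Suc N))" using con2[OF Fs F(1) sub nin] eN by simp
      moreover have "fpath E (Fs N) (u F) \<noteq> []" using fpath_hd(1)[OF Fs] uF subtreeD(3)[OF F(1)] by auto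
      ultimately have "r (Suc N) \<in> snd ` set (fpath E (Fs N) (u F))" by (metis hd_in_set image_eqI snd_conv)
      then show False using fpath_in[OF sub Fs F(1) uF] rSN by blast
    qed
    then show ?thesis using con1[OF Fs F(1) sub] eN fr by simp
  qed
  \<comment> \<open>A subtree without \<open>t\<close> is compared with a larger one containing
    \<open>t\<close>.\<close>
  have dir: "(u F, w F) = (fray F xi 0, fray F xi (Suc 0))" if F: "F \<in> subtrees V E" for F
  proof -
    obtain F' where F': "F' \<in> subtrees V E" "F \<subseteq> F'" "t \<in> F'" using subtree_extend[OF F t] by blast
    note rf = fray_facts[OF F xi(1) refl]
    obtain N where N: "fray F' xi = (\<lambda>n. fray F xi (n + N))" using fray_shift[OF F F'(1,2) xi(1)] by metis
    have e': "u F' = fray F xi N" "w F' = fray F xi (Suc N)" using dir_big[OF F'(1,3)] N by auto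
    show ?thesis
    proof (cases N)
      case 0 then show ?thesis using con1[OF F F'(1,2)] e' rf(2) by simp
    next
      case (Suc n)
      then have "u F' \<notin> F" using e' rf(3) by simp
      moreover have "fpath E F (u F') = redges (fray F xi) (Suc n)" using fpath_redges[OF F rf(5)] e' Suc by simp
      ultimately show ?thesis using con2[OF F F'(1,2)] by simp
    qed
  qed
  \<comment> \<open>Comparing \<open>F\<close> with \<open>F\<close> extended by \<open>n\<close>
    steps of the ray shows that \<open>d F\<close> lies in the \<open>n\<close>-th image; this holds
    for all \<open>n\<close>.\<close>
  have dpt: "d F = ray_point (fray F xi)" if F: "F \<in> subtrees V E" for F
  proof -
    define q where "q = fray F xi"
    note rf = fray_facts[OF F xi(1) q_def]
    show ?thesis unfolding q_def[symmetric]
    proof (rule ray_point_eq[OF rf(1)])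
      fix n
      have uw: "u F = q 0" "w F = q (Suc 0)" using dir[OF F] by (auto simp: q_def)
      show "d F \<in> ray_image q n"
      proof (cases n)
        case 0 then show ?thesis using uwd F uw by (auto simp: ray_image_0)
      next
        case (Suc m)
        define F' where "F' = F \<union> q ` {..n}"
        have F': "F' \<in> subtrees V E" "exit_ray V E F' (\<lambda>i. q (i + n))"
          using subtree_add_ray[OF F rf(5)] by (auto simp: F'_def)
        have fr: "fray F' xi = (\<lambda>i. q (i + n))" by (rule fray_eq[OF F'(1) xi(1) shift_in_end[OF xi(1) rf(4)] F'(2)])
        have uw': "u F' = q n" "w F' = q (Suc n)" using dir[OF F'(1)] fr by auto
        have dF': "d F' \<in> mspace (D (q n, q (Suc n)))" using uwd F' uw' by auto
        have nin: "u F' \<notin> F" using uw' rf(3) Suc by simp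
        have fp: "fpath E F (u F') = redges q n" using fpath_redges[OF F rf(5)] uw' Suc by simp
        have "iD (q 0, q (Suc 0)) (d F) = hchn (redges q n) (iD (q n, q (Suc n)) (d F'))"
          using con2[OF F F'(1) _ nin] fp uw uw' by (auto simp: F'_def)
        also have "\<dots> = iD (q 0, q (Suc 0)) (dg (redges q (Suc n)) (d F'))"
          using hchn_dg[of "redges q n"] by (simp add: Suc redges_Suc[of q "Suc m"] dg_snoc)
        finally have "iD (q 0, q (Suc 0)) (d F) = iD (q 0, q (Suc 0)) (dg (redges q (Suc n)) (d F'))" .
        moreover have "dg (redges q (Suc n)) (d F') \<in> mspace (D (q 0, q (Suc 0)))"
          using dg_in[OF epath_redges[OF rf(1), of n], of "d F'"] dF' by simp
        moreover have "d F \<in> mspace (D (q 0, q (Suc 0)))" using uwd F uw by metis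
        ultimately have "d F = dg (redges q (Suc n)) (d F')"
          using iD_eq_iff[OF ray_E[OF rf(1)] ray_E[OF rf(1)]] by blast
        then show ?thesis using dF' by (auto simp: ray_image_def)
      qed
    qed
  qed
  have "x F = Phi (Inr xi) F" if F: "F \<in> subtrees V E" for F
    using Phi_Inr[OF F refl] uwd F dir[OF F] dpt[OF F] by simp
  then have "x = Phi (Inr xi)"
    using thread_eq_Phi[OF x Inr_in_tlim[OF xi(1)] subtree_singleton[OF t]] by blast
  then show ?thesis using xi(1) by blast
qed

lemma Phi_surj:
  assumes x: "x \<in> topspace invl"
  shows "\<exists>z\<in>topspace tlim. x = Phi z"
proof (cases "\<exists>F s y. F \<in> subtrees V E \<and> s \<in> F \<and> y \<in> mspace (Km s) \<and> (\<forall>w. E s w \<and> y \<in> Sg (s, w) \<longrightarrow> w \<in> F) \<and>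
      x F = hrel F `` {(s, iK s y)}")
  case True
  then obtain F s y where F: "F \<in> subtrees V E" "s \<in> F" "y \<in> mspace (Km s)"
    "\<forall>w. E s w \<and> y \<in> Sg (s, w) \<longrightarrow> w \<in> F" "x F = hrel F `` {(s, iK s y)}" by blast
  have sV: "s \<in> V" using F subtreeD(3) by blast
  note z = Inl_in_tlim[OF sV F(3)]
  have "x = Phi (Inl (rel V `` {(s, y)}))"
  proof (rule thread_eq_Phi[OF x z F(1)])
    fix F' assume F': "F' \<in> subtrees V E" "F \<subseteq> F'"
    have "x F' = hrel F' `` {(s, iK s y)}"
      by (rule thread_settled[OF x F(1) F' F(2,3) _ F(5)]) (use F(4) in blast)
    then show "x F' = Phi (Inl (rel V `` {(s, y)})) F'" using Phi_Inl_in[OF F'(1) _ F(3)] F(2) F' by auto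
  qed
  then show ?thesis using z by blast
next
  case False
  have "\<exists>u w d. u \<in> F \<and> E u w \<and> w \<notin> F \<and> d \<in> mspace (D (u, w)) \<and> x F = hrel F `` {(u, iD (u, w) d)}"
    if F: "F \<in> subtrees V E" for F
  proof -
    have "x F \<in> topspace (hKF F)" using x F unfolding topspace_invl by blast
    then obtain s p where sp: "s \<in> F" "p \<in> prt F s" "x F = hrel F `` {(s, p)}" by (rule hclass_cases)
    consider y where "y \<in> mspace (Km s)" "p = iK s y"
      | w d where "E s w" "w \<notin> F" "d \<in> mspace (D (s, w))" "p = iD (s, w) d"
      using sp(2) prt_iff[OF sp(1) subtreeD(3)[OF F]] by blast
    then show ?thesis
    proof cases
      case 1
      \<comment> \<open>An unsettled point of \<open>K\<^sub>s\<close> lies on some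
        \<open>Sg (s, w)\<close> with \<open>w\<close> outside \<open>F\<close>, so it can be
        rewritten as a point of \<open>\<Delta>\<close>.\<close>
      then obtain w where w: "E s w" "y \<in> Sg (s, w)" "w \<notin> F" using False F sp by blast
      have "iD (s, w) (inv_into (S (s, w)) (psi (s, w)) y) = iK s y" by (rule iK_inv_psi[OF w(1,2)])
      moreover have "inv_into (S (s, w)) (psi (s, w)) y \<in> mspace (D (s, w))"
        using inv_psi(1)[OF w(1,2)] S_sub[OF w(1)] by blast
      ultimately show ?thesis using sp w 1 by metis
    next
      case 2 then show ?thesis using sp by blast
    qed
  qed
  then obtain xi where "xi \<in> tree_ends V E" "x = Phi (Inr xi)" using unsettled_thread[OF x] by blast
  then show ?thesis using Inr_in_tlim by blast
qed

section \<open>Continuity of the inverse map\<close>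

text \<open>The subset of \<open>hat K\<^sub>F\<close> that corresponds to \<open>G(U)\<close>.\<close>
definition hat_mem :: "'v set \<Rightarrow> ('v \<times> 'a) set set \<Rightarrow> 'v \<times> ('v, 'a) pt \<Rightarrow> bool" where
  "hat_mem F U r \<longleftrightarrow> (\<exists>x\<in>mspace (Km (fst r)). snd r = iK (fst r) x \<and> rel F `` {(fst r, x)} \<in> U) \<or>
    (\<exists>w d. E (fst r) w \<and> w \<notin> F \<and> d \<in> mspace (D (fst r, w)) \<and> snd r = iD (fst r, w) d \<and> good F U (fst r, w))"

definition hat :: "'v set \<Rightarrow> ('v \<times> 'a) set set \<Rightarrow> ('v \<times> ('v, 'a) pt) set set" where
  "hat F U = (\<lambda>r. hrel F `` {r}) ` {r \<in> Sigma F (prt F). hat_mem F U r}"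

lemma hat_mem_iK:
  assumes F: "F \<subseteq> V" and s: "s \<in> F" "x \<in> mspace (Km s)"
  shows "hat_mem F U (s, iK s x) \<longleftrightarrow> rel F `` {(s, x)} \<in> U"
proof
  assume "hat_mem F U (s, iK s x)"
  then consider y where "y \<in> mspace (Km s)" "iK s x = iK s y" "rel F `` {(s, y)} \<in> U"
    | w d where "E s w" "w \<notin> F" "d \<in> mspace (D (s, w))" "iK s x = iD (s, w) d" "good F U (s, w)"
    unfolding hat_mem_def fst_conv snd_conv by blast
  then show "rel F `` {(s, x)} \<in> U"
  proof cases
    case 1 then show ?thesis using iK_eq_iff[of s x y] s F by auto
  next
    case 2
    then have "x \<in> Sg (s, w)" using iK_eq_iD_iff[OF 2(1) s(2) 2(3)] psi_in[OF 2(1)] by auto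
    then show ?thesis using 2(5) by (simp add: good_def)
  qed
next
  assume "rel F `` {(s, x)} \<in> U"
  then show "hat_mem F U (s, iK s x)" unfolding hat_mem_def using s by auto
qed

text \<open>A point of \<open>S (s, w)\<close> may also enter through its description in
  \<open>K\<^sub>s\<close>; saturation then makes the edge good.\<close>

lemma hat_mem_iD:
  assumes F: "F \<subseteq> V" and U: "sat F U" and s: "s \<in> F" "E s w" "w \<notin> F" "d \<in> mspace (D (s, w))"
  shows "hat_mem F U (s, iD (s, w) d) \<longleftrightarrow> good F U (s, w)"
proof
  assume "hat_mem F U (s, iD (s, w) d)"
  then consider y where "y \<in> mspace (Km s)" "iD (s, w) d = iK s y" "rel F `` {(s, y)} \<in> U"
    | w' d' where "E s w'" "d' \<in> mspace (D (s, w'))" "iD (s, w) d = iD (s, w') d'" "good F U (s, w')"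
    unfolding hat_mem_def fst_conv snd_conv by blast
  then show "good F U (s, w)"
  proof cases
    case 1
    have "y \<in> Sg (s, w)" using iK_eq_iD_iff[OF s(2) 1(1) s(4)] 1(2) psi_in[OF s(2)] by auto
    moreover have "(s, w) \<in> out_edges V E F" using s by (simp add: out_edges_iff)
    ultimately show ?thesis using satD[OF U, of "(s, w)" y] 1(3) by simp
  next
    case 2 then show ?thesis using iD_eq_iff[of s w w' d d'] s by simp
  qed
next
  assume "good F U (s, w)"
  then show "hat_mem F U (s, iD (s, w) d)" unfolding hat_mem_def using s by auto
qed

lemma hat_mem_glue:
  assumes F: "F \<subseteq> V" and r: "(r, r') \<in> hrel F"
  shows "hat_mem F U r \<longleftrightarrow> hat_mem F U r'"
proof -
  obtain s p s' p' where rr: "r = (s, p)" "r' = (s', p')" by (cases r; cases r')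
  then consider "r = r'" | x where "s \<in> F" "s' \<in> F" "E s s'" "x \<in> Sg (s, s')" "p = iK s x" "p' = iK s' (phi (s, s') x)"
    using r hrel_iff[OF F, of s p s' p'] by blast
  then show ?thesis
  proof cases
    case 2
    have "phi (s, s') x \<in> mspace (Km s')" using Sg_mspace[OF E_sym[OF 2(3)] phi_in[OF 2(3,4)]] .
    then show ?thesis
      using hat_mem_iK[OF F 2(1) Sg_mspace[OF 2(3,4)]] hat_mem_iK[OF F 2(2)] class_glue[OF 2(3,4,1,2)] 2 rr
      by simp
  qed simp
qed

lemma hat_class:
  assumes "F \<subseteq> V" "s \<in> F" "p \<in> prt F s"
  shows "hrel F `` {(s, p)} \<in> hat F U \<longleftrightarrow> hat_mem F U (s, p)"
  unfolding hat_def
  by (rule class_in_image[OF equiv_hrel hat_mem_glue[OF assms(1)]]) (use assms in simp_all)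

lemma psi_preimage:
  assumes E: "E u w" and U: "openin (mtopology_of (Km u)) U"
  shows "\<exists>W. openin (mtopology_of (D (u, w))) W \<and> (\<forall>d\<in>S (u, w). d \<in> W \<longleftrightarrow> psi (u, w) d \<in> U)"
proof -
  have "openin (subtopology (mtopology_of (D (u, w))) (S (u, w)))
      {d \<in> topspace (subtopology (mtopology_of (D (u, w))) (S (u, w))). psi (u, w) d \<in> U}"
    by (rule openin_continuous_map_preimage[OF psi_cont[OF E] U])
  then obtain W where W: "openin (mtopology_of (D (u, w))) W"
    "{d \<in> topspace (subtopology (mtopology_of (D (u, w))) (S (u, w))). psi (u, w) d \<in> U} = W \<inter> S (u, w)"
    unfolding openin_subtopology by blast
  have "d \<in> W \<longleftrightarrow> psi (u, w) d \<in> U" if "d \<in> S (u, w)" for d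
  proof -
    have "d \<in> topspace (subtopology (mtopology_of (D (u, w))) (S (u, w)))"
      using that S_sub[OF E] by auto
    then show ?thesis using W(2) that by blast
  qed
  then show ?thesis using W(1) by blast
qed

text \<open>On the piece at \<open>s\<close> the set is the trace of an open set of
  \<open>hat K\<^sub>s\<close> from \<open>hK_open\<close>, with \<open>A\<close> the neighbours of
  \<open>s\<close> inside \<open>F\<close>. Preimages under \<open>psi\<close> supply the required
  open sets over \<open>A\<close>.\<close>

lemma openin_hat:
  assumes F: "F \<in> subtrees V E" and U: "openin (KF F) U" "sat F U"
  shows "openin (hKF F) (hat F U)"
  unfolding openin_hKF
proof (intro conjI ballI)
  have FV: "F \<subseteq> V" by (rule subtreeD(3)[OF F])
  show "hat F U \<subseteq> Sigma F (prt F) // hrel F" by (auto simp: hat_def intro: quotientI)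
  fix s assume s: "s \<in> F"
  have sV: "s \<in> V" using s FV by auto
  let ?A = "{w \<in> F. E s w}"
  let ?U = "{x \<in> topspace (mtopology_of (Km s)). rel F `` {(s, x)} \<in> U}"
  have oU: "openin (mtopology_of (Km s)) ?U" using U(1) s unfolding openin_KF by blast
  have "\<forall>w\<in>?A. \<exists>W. openin (mtopology_of (D (s, w))) W \<and> (\<forall>d\<in>S (s, w). d \<in> W \<longleftrightarrow> psi (s, w) d \<in> ?U)"
    using psi_preimage[OF _ oU] by blast
  from bchoice[OF this] obtain W where
    W: "\<forall>w\<in>?A. openin (mtopology_of (D (s, w))) (W w) \<and> (\<forall>d\<in>S (s, w). d \<in> W w \<longleftrightarrow> psi (s, w) d \<in> ?U)" ..
  have good: "good F U (s, w) \<longleftrightarrow> Sg (s, w) \<subseteq> ?U" if "E s w" for w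
    using Sg_mspace[OF that] by (auto simp: good_def)
  have sat': "Sg (s, w) \<subseteq> ?U \<or> Sg (s, w) \<inter> ?U = {}" if w: "E s w" "w \<notin> ?A" for w
  proof (rule ccontr)
    assume neg: "\<not> ?thesis"
    then obtain x where "x \<in> Sg (s, w)" "rel F `` {(s, x)} \<in> U" by auto
    moreover have "(s, w) \<in> out_edges V E F" using w s by (simp add: out_edges_iff)
    ultimately have "good F U (s, w)" using satD[OF U(2), of "(s, w)" x] by simp
    then show False using neg good[OF w(1)] by blast
  qed
  have finA: "finite ?A" using subtreeD(1)[OF F] by simp
  obtain Q where Q: "openin (hK s) Q" "\<forall>x\<in>mspace (Km s). iK s x \<in> Q \<longleftrightarrow> x \<in> ?U"
    "\<forall>w d. E s w \<and> w \<notin> ?A \<and> d \<in> mspace (D (s, w)) \<longrightarrow> (iD (s, w) d \<in> Q \<longleftrightarrow> Sg (s, w) \<subseteq> ?U)"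
    using hK_open[OF sV finA _ oU, of W] W sat' by blast
  have "{p \<in> prt F s. hrel F `` {(s, p)} \<in> hat F U} = Q \<inter> prt F s"
  proof (intro equalityI subsetI)
    fix p assume p: "p \<in> {p \<in> prt F s. hrel F `` {(s, p)} \<in> hat F U}"
    then have "hat_mem F U (s, p)" using hat_class[OF FV s, of p U] by blast
    then consider x where "x \<in> mspace (Km s)" "p = iK s x" "rel F `` {(s, x)} \<in> U"
      | w d where "E s w" "w \<notin> F" "d \<in> mspace (D (s, w))" "p = iD (s, w) d" "good F U (s, w)"
      unfolding hat_mem_def fst_conv snd_conv by blast
    then have "p \<in> Q"
    proof cases
      case 1 then show ?thesis using Q(2) by simp
    next
      case 2 then show ?thesis using Q(3) good[OF 2(1)] by simp
    qed
    then show "p \<in> Q \<inter> prt F s" using p by simp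
  next
    fix p assume p: "p \<in> Q \<inter> prt F s"
    then consider x where "x \<in> mspace (Km s)" "p = iK s x"
      | w d where "E s w" "w \<notin> F" "d \<in> mspace (D (s, w))" "p = iD (s, w) d"
      using prt_iff[OF s FV] by blast
    then have "hat_mem F U (s, p)"
    proof cases
      case 1 then show ?thesis using Q(2) p hat_mem_iK[OF FV s 1(1)] by simp
    next
      case 2
      then have "Sg (s, w) \<subseteq> ?U" using Q(3) p by simp
      then show ?thesis using good[OF 2(1)] hat_mem_iD[OF FV U(2) s 2(1-3)] 2(4) by simp
    qed
    then show "p \<in> {p \<in> prt F s. hrel F `` {(s, p)} \<in> hat F U}" using hat_class[OF FV s, of p U] p by blast
  qed
  then show "openin (subtopology (hK s) (prt F s)) {p \<in> prt F s. hrel F `` {(s, p)} \<in> hat F U}"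
    using Q(1) by (auto simp: openin_subtopology)
qed

text \<open>The bridge between the two topologies; both continuity proofs use it.\<close>

lemma Phi_hat:
  assumes F: "F \<in> subtrees V E" and U: "sat F U" and z: "z \<in> topspace tlim"
  shows "Phi z F \<in> hat F U \<longleftrightarrow> z \<in> G F U"
  using z
proof (cases rule: tlim_cases)
  case (pt s x)
  have FV: "F \<subseteq> V" by (rule subtreeD(3)[OF F])
  have G: "z \<in> G F U \<longleftrightarrow> (if s \<in> F then rel F `` {(s, x)} \<in> U else good F U (hd (fpath E F s)))"
    using G_Inl[OF F U pt(1), of x] pt by simp
  have P: "Phi z F = hrel F `` {hrw F (s, iK s x)}" using Phi_Inl[OF F pt(1,2)] pt(3) by simp
  show ?thesis
  proof (cases "s \<in> F")
    case True
    then show ?thesis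
      using G P hat_class[OF FV True iK_prt[OF True FV pt(2)]] hat_mem_iK[OF FV True pt(2)]
      by (simp add: hrw_in)
  next
    case False
    then have "s \<in> V - F" "iK s x \<in> hKe (last (fpath E F s))"
      using valid_iK[OF F pt(1,2)] pt(1) by (auto simp: valid_def)
    then obtain u w d where uw: "hd (fpath E F s) = (u, w)" "E u w" "u \<in> F" "w \<notin> F" "d \<in> mspace (D (u, w))"
      "hrw F (s, iK s x) = (u, iD (u, w) d)" using hrw_out_cases[OF F] by metis
    then show ?thesis
      using G P hat_class[OF FV uw(3) iD_prt[OF uw(3) FV uw(2,4,5)]] hat_mem_iD[OF FV U uw(3,2,4,5)] False
      by simp
  qed
next
  case (end_pt xi)
  have FV: "F \<subseteq> V" by (rule subtreeD(3)[OF F])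
  define r where "r = fray F xi"
  note rf = fray_facts[OF F end_pt(1) r_def]
  note uw = rf(2) ray_E[OF rf(1)] rf(3) ray_point_D[OF rf(1)]
  show ?thesis
    using G_Inr[OF F end_pt(1), of U] end_pt(2) Phi_Inr[OF F r_def]
      hat_class[OF FV uw(1) iD_prt[OF uw(1) FV uw(2-4)]] hat_mem_iD[OF FV U uw]
    by (simp add: r_def)
qed

lemma continuous_map_inv_Phi:
  assumes inv: "\<And>x. x \<in> topspace invl \<Longrightarrow> f x \<in> topspace tlim \<and> Phi (f x) = x"
  shows "continuous_map invl tlim f"
proof (rule continuous_map_into_tlim)
  fix F U assume F: "F \<in> subtrees V E" and U: "openin (KF F) U" "sat F U"
  have "continuous_map invl (hKF F) (\<lambda>x. x F)"
    unfolding invlim_def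
    by (intro continuous_map_from_subtopology continuous_map_product_projection F)
  then have "openin invl {x \<in> topspace invl. x F \<in> hat F U}"
    using openin_hat[OF F U] by (rule openin_continuous_map_preimage)
  moreover have "x F \<in> hat F U \<longleftrightarrow> f x \<in> G F U" if "x \<in> topspace invl" for x
    using Phi_hat[OF F U(2), of "f x"] inv[OF that] by simp
  then have "{x \<in> topspace invl. x F \<in> hat F U} = {x \<in> topspace invl. f x \<in> G F U}" by blast
  ultimately show "openin invl {x \<in> topspace invl. f x \<in> G F U}" by simp
qed (use inv in blast)

section \<open>Continuity of the map\<close>

lemma open_edge_part:
  assumes F: "F \<in> subtrees V E" and W: "openin (hKF F) W" and u: "u \<in> F" "E u w" "w \<notin> F"
  shows "openin (mtopology_of (D (u, w))) {d \<in> mspace (D (u, w)). hrel F `` {(u, iD (u, w) d)} \<in> W}"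
proof -
  have FV: "F \<subseteq> V" by (rule subtreeD(3)[OF F])
  have "continuous_map (mtopology_of (D (u, w))) (subtopology (hK u) (prt F u)) (iD (u, w))"
    using iD_cont[OF u(2)] iD_prt[OF u(1) FV u(2,3)] by (auto simp: continuous_map_in_subtopology)
  moreover have "openin (subtopology (hK u) (prt F u)) {p \<in> prt F u. hrel F `` {(u, p)} \<in> W}"
    using W u(1) unfolding openin_hKF by blast
  ultimately have "openin (mtopology_of (D (u, w)))
      {d \<in> topspace (mtopology_of (D (u, w))). iD (u, w) d \<in> {p \<in> prt F u. hrel F `` {(u, p)} \<in> W}}"
    by (rule openin_continuous_map_preimage)
  also have "{d \<in> topspace (mtopology_of (D (u, w))). iD (u, w) d \<in> {p \<in> prt F u. hrel F `` {(u, p)} \<in> W}} =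
      {d \<in> mspace (D (u, w)). hrel F `` {(u, iD (u, w) d)} \<in> W}"
    using iD_prt[OF u(1) FV u(2,3)] by auto
  finally show ?thesis .
qed

text \<open>Continuity of the bonding map on one piece. \<open>Q\<close> is described only at valid
  \<open>p\<close>, where each \<open>delta\<close> is applied inside its domain.\<close>

lemma hrw_open:
  assumes F: "F \<in> subtrees V E" and W: "openin (hKF F) W" and s: "s \<in> V"
  shows "\<exists>Q. openin (hK s) Q \<and> (\<forall>p. valid F s p \<longrightarrow> (p \<in> Q \<longleftrightarrow> hrel F `` {hrw F (s, p)} \<in> W))"
proof (cases "s \<in> F")
  case True
  then obtain Q where "openin (hK s) Q" "{p \<in> prt F s. hrel F `` {(s, p)} \<in> W} = Q \<inter> prt F s"
    using W unfolding openin_hKF openin_subtopology by blast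
  then show ?thesis using True by (intro exI[of _ Q]) (auto simp: valid_def hrw_in)
next
  case False
  let ?es = "fpath E F s"
  have sV: "s \<in> V - F" using s False by simp
  have ex: "exit_path E F ?es s" by (rule fpath_exit[OF F sV])
  have ep: "epath E ?es" by (rule exit_path_epath[OF ex])
  note hd = fpath_hd[OF F sV]
  obtain u w where uw: "hd ?es = (u, w)" by (cases "hd ?es")
  have o: "u \<in> F" "E u w" "w \<notin> F" using hd(2) uw by (auto simp: out_edges_iff)
  obtain v where v: "last ?es = (v, s)" "E v s"
  proof -
    obtain F' where "F' \<in> subtrees V E" "F \<subseteq> F'" "s \<in> F'" using subtree_extend[OF F s] by blast
    then show ?thesis using that last_edge_fst[OF F] False by blast
  qed
  let ?O = "{d \<in> mspace (D (u, w)). hrel F `` {(u, iD (u, w) d)} \<in> W}"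
  have oO: "openin (mtopology_of (D (u, w))) ?O" by (rule open_edge_part[OF F W o])
  have "continuous_map (mtopology_of (D (v, s))) (mtopology_of (D (u, w))) (dg ?es)"
    using dg_cont[OF ep] v uw by simp
  then have cont: "continuous_map (subtopology (hK s) (hKe (v, s))) (mtopology_of (D (u, w))) (dg ?es \<circ> delta (v, s))"
    by (rule continuous_map_compose[OF delta_cont[OF v(2)]])
  have ts: "topspace (subtopology (hK s) (hKe (v, s))) = hKe (v, s)"
    by (auto simp: hatKe_def)
  have "openin (subtopology (hK s) (hKe (v, s))) {p \<in> hKe (v, s). (dg ?es \<circ> delta (v, s)) p \<in> ?O}"
    using openin_continuous_map_preimage[OF cont oO] unfolding ts .
  then obtain Q where Q: "openin (hK s) Q" "{p \<in> hKe (v, s). (dg ?es \<circ> delta (v, s)) p \<in> ?O} = Q \<inter> hKe (v, s)"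
    unfolding openin_subtopology by blast
  have "p \<in> Q \<longleftrightarrow> hrel F `` {hrw F (s, p)} \<in> W" if "valid F s p" for p
  proof -
    have p: "p \<in> hKe (v, s)" using that False v by (simp add: valid_def)
    then have "dg ?es (delta (v, s) p) \<in> mspace (D (u, w))"
      using dg_in[OF ep] delta_in[OF v(2)] v uw by simp
    moreover have "hrw F (s, p) = (u, iD (u, w) (dg ?es (delta (v, s) p)))"
      using hrw_out[OF False] hchn_dg[OF hd(1)] uw v by simp
    ultimately have "(dg ?es \<circ> delta (v, s)) p \<in> ?O \<longleftrightarrow> hrel F `` {hrw F (s, p)} \<in> W" by simp
    then show ?thesis using Q(2) p by blast
  qed
  then show ?thesis using Q(1) by blast
qed

text \<open>Packages the passage from a glue-invariant predicate to a saturated open set, needed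
  both near points and near ends.\<close>

lemma KF_open_class:
  assumes F: "F \<subseteq> V"
    and glue: "\<And>s s' x. s \<in> F \<Longrightarrow> s' \<in> F \<Longrightarrow> E s s' \<Longrightarrow> x \<in> Sg (s, s') \<Longrightarrow> P s x \<longleftrightarrow> P s' (phi (s, s') x)"
    and op: "\<And>s. s \<in> F \<Longrightarrow> openin (mtopology_of (Km s)) {x \<in> mspace (Km s). P s x}"
    and sat: "\<And>s w. s \<in> F \<Longrightarrow> E s w \<Longrightarrow> w \<notin> F \<Longrightarrow> (\<forall>x\<in>Sg (s, w). P s x) \<or> (\<forall>x\<in>Sg (s, w). \<not> P s x)"
  obtains U where "openin (KF F) U" "sat F U"
    "\<And>s x. s \<in> F \<Longrightarrow> x \<in> mspace (Km s) \<Longrightarrow> rel F `` {(s, x)} \<in> U \<longleftrightarrow> P s x"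
    "\<And>s w. s \<in> F \<Longrightarrow> E s w \<Longrightarrow> good F U (s, w) \<longleftrightarrow> (\<forall>x\<in>Sg (s, w). P s x)"
proof -
  let ?P = "\<lambda>r. P (fst r) (snd r)"
  define U where "U = (\<lambda>r. rel F `` {r}) ` {r \<in> raw F. ?P r}"
  have P: "?P r \<longleftrightarrow> ?P r'" if "(r, r') \<in> rel F" for r r'
    using that glue by (cases r; cases r') (auto simp: rel_iff)
  have cls: "rel F `` {(s, x)} \<in> U \<longleftrightarrow> P s x" if "s \<in> F" "x \<in> mspace (Km s)" for s x
  proof -
    have "rel F `` {(s, x)} \<in> U \<longleftrightarrow> ?P (s, x)"
      unfolding U_def by (rule class_in_image[OF equiv_rel]) (use P that in \<open>simp_all add: raw_iff\<close>)
    then show ?thesis by simp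
  qed
  have good: "good F U (s, w) \<longleftrightarrow> (\<forall>x\<in>Sg (s, w). P s x)" if "s \<in> F" "E s w" for s w
    using cls[OF that(1)] Sg_mspace[OF that(2)] by (simp add: good_def)
  have "openin (KF F) U"
    unfolding openin_KF
  proof (intro conjI ballI)
    show "U \<subseteq> raw F // rel F" by (auto simp: U_def intro: quotientI)
    fix s assume s: "s \<in> F"
    have "{x \<in> topspace (mtopology_of (Km s)). rel F `` {(s, x)} \<in> U} = {x \<in> mspace (Km s). P s x}"
      using cls[OF s] by auto
    then show "openin (mtopology_of (Km s)) {x \<in> topspace (mtopology_of (Km s)). rel F `` {(s, x)} \<in> U}"
      using op[OF s] by simp
  qed
  moreover have "sat F U"
    unfolding ts_saturated_def
  proof
    fix e assume e: "e \<in> out_edges V E F"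
    obtain s w where sw: "e = (s, w)" by (cases e)
    then have sF: "s \<in> F" "E s w" "w \<notin> F" using e by (auto simp: out_edges_iff)
    show "(\<forall>x\<in>Sg e. rel F `` {(fst e, x)} \<in> U) \<or> (\<forall>x\<in>Sg e. rel F `` {(fst e, x)} \<notin> U)"
      using sat[OF sF] cls[OF sF(1) Sg_mspace[OF sF(2)]] by (simp add: sw)
  qed
  ultimately show ?thesis using that cls good by blast
qed

lemma hmp_hat:
  assumes F: "F \<in> subtrees V E" and F': "F' \<in> subtrees V E" and sub: "F \<subseteq> F'" and c: "c \<in> hat F' U"
    and iK: "\<And>s x. s \<in> F' \<Longrightarrow> x \<in> mspace (Km s) \<Longrightarrow> rel F' `` {(s, x)} \<in> U \<Longrightarrow> hrel F `` {hrw F (s, iK s x)} \<in> W"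
    and iD: "\<And>s w d. s \<in> F' \<Longrightarrow> E s w \<Longrightarrow> w \<notin> F' \<Longrightarrow> d \<in> mspace (D (s, w)) \<Longrightarrow> good F' U (s, w) \<Longrightarrow>
      hrel F `` {hrw F (s, iD (s, w) d)} \<in> W"
  shows "hmp F F' c \<in> W"
proof -
  obtain s p where sp: "s \<in> F'" "p \<in> prt F' s" "hat_mem F' U (s, p)" "c = hrel F' `` {(s, p)}"
    using c unfolding hat_def by auto
  have h: "hmp F F' c = hrel F `` {hrw F (s, p)}" using hmp_class[OF F F' sub sp(1,2)] sp(4) by simp
  consider x where "x \<in> mspace (Km s)" "p = iK s x" "rel F' `` {(s, x)} \<in> U"
    | w d where "E s w" "w \<notin> F'" "d \<in> mspace (D (s, w))" "p = iD (s, w) d" "good F' U (s, w)"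
    using sp(3) unfolding hat_mem_def fst_conv snd_conv by blast
  then show ?thesis using h iK[OF sp(1)] iD[OF sp(1)] by cases auto
qed

lemma Phi_nbhd_point:
  assumes F: "F \<in> subtrees V E" and W: "openin (hKF F) W" and s0: "s0 \<in> V" "x0 \<in> mspace (Km s0)"
    and z: "Phi (Inl (rel V `` {(s0, x0)})) F \<in> W"
  shows "\<exists>F' U. F' \<in> subtrees V E \<and> F \<subseteq> F' \<and> openin (KF F') U \<and> sat F' U \<and>
    Inl (rel V `` {(s0, x0)}) \<in> G F' U \<and> (\<forall>c\<in>hat F' U. hmp F F' c \<in> W)"
proof -
  \<comment> \<open>Once \<open>x0\<close> is settled in \<open>F'\<close>, it lies on no
    \<open>\<Sigma>\<^sub>e\<close> with \<open>e\<close> leaving \<open>F'\<close>, so removing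
    such sets does not remove \<open>x0\<close>.\<close>
  obtain F1 where F1: "F1 \<in> subtrees V E" "s0 \<in> F1" "\<forall>w. E s0 w \<and> x0 \<in> Sg (s0, w) \<longrightarrow> w \<in> F1"
    using settled_ex[OF s0(1)] by blast
  obtain F' where F': "F' \<in> subtrees V E" "F \<subseteq> F'" "F1 \<subseteq> F'"
    using subtree_extend_set[OF F subtreeD(1,3)[OF F1(1)]] by blast
  have FV': "F' \<subseteq> V" by (rule subtreeD(3)[OF F'(1)])
  define bad where "bad s w \<longleftrightarrow> (\<exists>d\<in>mspace (D (s, w)). hrel F `` {hrw F (s, iD (s, w) d)} \<notin> W)" for s w
  define P where "P s x \<longleftrightarrow> hrel F `` {hrw F (s, iK s x)} \<in> W \<and>
    (\<forall>w. E s w \<and> w \<notin> F' \<and> x \<in> Sg (s, w) \<longrightarrow> \<not> bad s w)" for s x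
  have valid_iD: "valid F s (iD (s, w) d)" if "s \<in> F'" "E s w" "w \<notin> F'" "d \<in> mspace (D (s, w))" for s w d
    using valid_mono[OF F F'(1,2) that(1) iD_prt[OF that(1) FV' that(2-4)]] .
  have glue: "P s x \<longleftrightarrow> P s' (phi (s, s') x)" if sF: "s \<in> F'" "s' \<in> F'" and E: "E s s'" and x: "x \<in> Sg (s, s')" for s s' x
  proof -
    have "\<not> (E s w \<and> w \<notin> F' \<and> x \<in> Sg (s, w))" for w
      using Sg_disj[OF E _ x, of w] sF by auto
    moreover have "\<not> (E s' w \<and> w \<notin> F' \<and> phi (s, s') x \<in> Sg (s', w))" for w
      using Sg_disj[OF E_sym[OF E] _ phi_in[OF E x], of w] sF by auto
    ultimately show ?thesis unfolding P_def using hclass_glue[OF F E x] by metis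
  qed
  have op: "openin (mtopology_of (Km s)) {x \<in> mspace (Km s). P s x}" if s: "s \<in> F'" for s
  proof -
    have sV: "s \<in> V" using s FV' by auto
    obtain Q where Q: "openin (hK s) Q" "\<forall>p. valid F s p \<longrightarrow> (p \<in> Q \<longleftrightarrow> hrel F `` {hrw F (s, p)} \<in> W)"
      using hrw_open[OF F W sV] by blast
    have QK: "iK s x \<in> Q \<longleftrightarrow> hrel F `` {hrw F (s, iK s x)} \<in> W" if "x \<in> mspace (Km s)" for x
      using Q(2) valid_iK[OF F sV that] by blast
    show ?thesis
    proof (subst openin_subopen, intro ballI)
      fix y assume "y \<in> {x \<in> mspace (Km s). P s x}"
      then have y: "y \<in> mspace (Km s)" "P s y" by auto
      then have "iK s y \<in> Q" using QK by (simp add: P_def)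
      then obtain U A where UA: "openin (mtopology_of (Km s)) U" "y \<in> U" "finite A"
        "\<forall>w d. E s w \<and> w \<notin> A \<and> Sg (s, w) \<inter> U \<noteq> {} \<and> d \<in> mspace (D (s, w)) \<longrightarrow> iD (s, w) d \<in> Q"
        using hK_nbhd[OF sV Q(1) y(1)] by blast
      \<comment> \<open>Near \<open>y\<close> only the finite set \<open>A\<close> can contribute
        bad neighbours: for \<open>w\<close> outside \<open>A\<close>, a set
        \<open>Sg (s, w)\<close> meeting \<open>U\<close> has its \<open>\<Delta>\<close> in
        \<open>Q\<close>. The finite union of closed sets to be removed is closed.\<close>
      let ?B = "{w \<in> A. E s w \<and> w \<notin> F' \<and> bad s w}"
      let ?T = "U \<inter> {x \<in> topspace (mtopology_of (Km s)). iK s x \<in> Q} - (\<Union>w\<in>?B. Sg (s, w))"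
      have "openin (mtopology_of (Km s)) {x \<in> topspace (mtopology_of (Km s)). iK s x \<in> Q}"
        by (rule openin_continuous_map_preimage[OF iK_cont[OF sV] Q(1)])
      moreover have "closedin (mtopology_of (Km s)) (\<Union>w\<in>?B. Sg (s, w))"
        by (intro closedin_Union) (use UA(3) Sg_closed in auto)
      ultimately have "openin (mtopology_of (Km s)) ?T" using UA(1) by (intro openin_diff openin_Int)
      moreover have "y \<in> ?T" using UA(2) y QK by (auto simp: P_def)
      moreover have "?T \<subseteq> {x \<in> mspace (Km s). P s x}"
      proof
        fix x assume x: "x \<in> ?T"
        then have xm: "x \<in> mspace (Km s)" by simp
        have "\<not> bad s w" if w: "E s w" "w \<notin> F'" "x \<in> Sg (s, w)" for w
        proof (cases "w \<in> A")
          case True then show ?thesis using x w by auto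
        next
          case False
          then have "iD (s, w) d \<in> Q" if "d \<in> mspace (D (s, w))" for d using UA(4) w x that by blast
          then show ?thesis using Q(2) valid_iD[OF s w(1,2)] by (auto simp: bad_def)
        qed
        then show "x \<in> {x \<in> mspace (Km s). P s x}" using xm x QK[OF xm] by (auto simp: P_def)
      qed
      ultimately show "\<exists>T. openin (mtopology_of (Km s)) T \<and> y \<in> T \<and> T \<subseteq> {x \<in> mspace (Km s). P s x}" by blast
    qed
  qed
  have good_P: "P s x" if s: "s \<in> F'" "E s w" "w \<notin> F'" "\<not> bad s w" "x \<in> Sg (s, w)" for s w x
  proof -
    \<comment> \<open>A point of \<open>\<Sigma>\<close> is itself a point of
      \<open>\<Delta>\<close>, so if the edge is not bad its image lies in \<open>W\<close>. Thus
      \<open>P\<close> holds on all of \<open>Sg (s, w)\<close> or nowhere on it.\<close>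
    let ?d = "inv_into (S (s, w)) (psi (s, w)) x"
    have "?d \<in> mspace (D (s, w))" using inv_psi(1)[OF s(2,5)] S_sub[OF s(2)] by blast
    then have "hrel F `` {hrw F (s, iK s x)} \<in> W"
      using s(4) iK_inv_psi[OF s(2,5)] by (auto simp: bad_def)
    then show ?thesis using Sg_disj[OF s(2) _ s(5)] s(4) by (auto simp: P_def)
  qed
  have sat: "(\<forall>x\<in>Sg (s, w). P s x) \<or> (\<forall>x\<in>Sg (s, w). \<not> P s x)" if s: "s \<in> F'" "E s w" "w \<notin> F'" for s w
  proof (cases "bad s w")
    case True then show ?thesis using s by (auto simp: P_def)
  next
    case False then show ?thesis using good_P[OF s] by blast
  qed
  obtain U where U: "openin (KF F') U" "sat F' U"
    "\<And>s x. s \<in> F' \<Longrightarrow> x \<in> mspace (Km s) \<Longrightarrow> rel F' `` {(s, x)} \<in> U \<longleftrightarrow> P s x"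
    "\<And>s w. s \<in> F' \<Longrightarrow> E s w \<Longrightarrow> good F' U (s, w) \<longleftrightarrow> (\<forall>x\<in>Sg (s, w). P s x)"
    using KF_open_class[OF FV' glue op sat] by blast
  have s0F: "s0 \<in> F'" using F1 F' by blast
  have "P s0 x0" using z Phi_Inl[OF F s0] F1(3) F'(3) by (auto simp: P_def)
  then have "Inl (rel V `` {(s0, x0)}) \<in> G F' U"
    using G_Inl[OF F'(1) U(2) s0(1), of x0] U(3)[OF s0F s0(2)] s0 s0F by simp
  moreover have "hmp F F' c \<in> W" if c: "c \<in> hat F' U" for c
  proof (rule hmp_hat[OF F F'(1,2) c])
    fix s x assume "s \<in> F'" "x \<in> mspace (Km s)" "rel F' `` {(s, x)} \<in> U"
    then show "hrel F `` {hrw F (s, iK s x)} \<in> W" using U(3) by (simp add: P_def)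
  next
    fix s w d assume s: "s \<in> F'" "E s w" "w \<notin> F'" and d: "d \<in> mspace (D (s, w))" and "good F' U (s, w)"
    then have "\<forall>x\<in>Sg (s, w). P s x" using U(4) by simp
    \<comment> \<open>A point of the nonempty \<open>Sg (s, w)\<close> satisfying \<open>P\<close>
      certifies that the edge is not bad.\<close>
    moreover obtain x where "x \<in> Sg (s, w)" using Sg_nonempty[OF s(2)] by blast
    ultimately have "\<not> bad s w" using s by (auto simp: P_def)
    then show "hrel F `` {hrw F (s, iD (s, w) d)} \<in> W" using d by (auto simp: bad_def)
  qed
  ultimately show ?thesis using F' U(1,2) by blast
qed

lemma Phi_nbhd_end:
  assumes F: "F \<in> subtrees V E" and W: "openin (hKF F) W" and xi: "xi \<in> tree_ends V E"
    and z: "Phi (Inr xi) F \<in> W"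
  shows "\<exists>F' U. F' \<in> subtrees V E \<and> F \<subseteq> F' \<and> openin (KF F') U \<and> sat F' U \<and>
    Inr xi \<in> G F' U \<and> (\<forall>c\<in>hat F' U. hmp F F' c \<in> W)"
proof -
  define r where "r = fray F xi"
  note rf = fray_facts[OF F xi r_def]
  let ?O = "{d \<in> mspace (D (r 0, r (Suc 0))). hrel F `` {(r 0, iD (r 0, r (Suc 0)) d)} \<in> W}"
  have "openin (mtopology_of (D (r 0, r (Suc 0)))) ?O" by (rule open_edge_part[OF F W rf(2) ray_E[OF rf(1)] rf(3)])
  moreover have "ray_point r \<in> ?O" using z Phi_Inr[OF F r_def] ray_point_D[OF rf(1)] by simp
  ultimately obtain n where n: "ray_image r n \<subseteq> ?O" using ray_point_nbhd[OF rf(1)] by blast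
  \<comment> \<open>\<open>t\<close> is the far end of the edge \<open>e\<^sub>n\<close>, so the
    part of \<open>hat K\<^sub>t\<close> away from \<open>r n\<close> is mapped by
    \<open>delta\<close> into \<open>\<Delta>(e\<^sub>n)\<close> and from there into
    \<open>?O\<close>.\<close>
  define t where "t = r (Suc n)"
  define F' where "F' = F \<union> r ` {..Suc n}"
  have F': "F' \<in> subtrees V E" "exit_ray V E F' (\<lambda>i. r (i + Suc n))"
    unfolding F'_def by (rule subtree_add_ray[OF F rf(5)])+
  have FV': "F' \<subseteq> V" by (rule subtreeD(3)[OF F'(1)])
  have sub: "F \<subseteq> F'" by (auto simp: F'_def)
  have tF: "t \<in> F'" "t \<notin> F" using rf(3) by (auto simp: F'_def t_def)
  have tV: "t \<in> V" using tF FV' by auto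
  have rn: "r n \<in> F'" "E t (r n)" "E (r n) t" using ray_E[OF rf(1), of n] E_sym by (auto simp: F'_def t_def)
  have fr: "fray F' xi = (\<lambda>i. r (i + Suc n))"
    by (rule fray_eq[OF F'(1) xi shift_in_end[OF xi rf(4)] F'(2)])
  \<comment> \<open>All of \<open>K\<^sub>t\<close> except the sets \<open>\<Sigma>\<close> facing
    \<open>F'\<close>. With these removed, \<open>P\<close> is false on both sides of every gluing
    inside \<open>F'\<close>, hence invariant.\<close>
  define P where "P s x \<longleftrightarrow> s = t \<and> (\<forall>w\<in>F'. E t w \<longrightarrow> x \<notin> Sg (t, w))" for s x
  have glue: "P s x \<longleftrightarrow> P s' (phi (s, s') x)" if "s \<in> F'" "s' \<in> F'" and "E s s'" and "x \<in> Sg (s, s')" for s s' x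
    using that phi_in E_sym E_irrefl by (auto simp: P_def)
  have op: "openin (mtopology_of (Km s)) {x \<in> mspace (Km s). P s x}" if "s \<in> F'" for s
  proof (cases "s = t")
    case True
    let ?B = "{w \<in> F'. E t w}"
    have "closedin (mtopology_of (Km t)) (\<Union>w\<in>?B. Sg (t, w))"
      by (intro closedin_Union) (use subtreeD(1)[OF F'(1)] Sg_closed in auto)
    then have "openin (mtopology_of (Km t)) (topspace (mtopology_of (Km t)) - (\<Union>w\<in>?B. Sg (t, w)))"
      by (intro openin_diff openin_topspace)
    moreover have "topspace (mtopology_of (Km t)) - (\<Union>w\<in>?B. Sg (t, w)) = {x \<in> mspace (Km s). P s x}"
      using True by (auto simp: P_def)
    ultimately show ?thesis using True by simp
  qed (simp add: P_def)
  have out_P: "P t x" if "E t w" "w \<notin> F'" "x \<in> Sg (t, w)" for w x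
    using Sg_disj[OF that(1) _ that(3)] that(2) by (auto simp: P_def)
  have sat: "(\<forall>x\<in>Sg (s, w). P s x) \<or> (\<forall>x\<in>Sg (s, w). \<not> P s x)" if s: "s \<in> F'" "E s w" "w \<notin> F'" for s w
  proof (cases "s = t")
    case True then show ?thesis using out_P s by blast
  qed (simp add: P_def)
  obtain U where U: "openin (KF F') U" "sat F' U"
    "\<And>s x. s \<in> F' \<Longrightarrow> x \<in> mspace (Km s) \<Longrightarrow> rel F' `` {(s, x)} \<in> U \<longleftrightarrow> P s x"
    "\<And>s w. s \<in> F' \<Longrightarrow> E s w \<Longrightarrow> good F' U (s, w) \<longleftrightarrow> (\<forall>x\<in>Sg (s, w). P s x)"
    using KF_open_class[OF FV' glue op sat] by blast
  have e: "E t (r (Suc (Suc n)))" "r (Suc (Suc n)) \<notin> F'"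
    using ray_E[OF rf(1), of "Suc n"] F'(2) by (auto simp: t_def exit_ray_def dest: spec[of _ 1])
  have "good F' U (t, r (Suc (Suc n)))" using U(4)[OF tF(1) e(1)] out_P[OF e] by blast
  then have "Inr xi \<in> G F' U" using G_Inr[OF F'(1) xi, of U] fr by (simp add: t_def)
  moreover have W': "hrel F `` {hrw F (t, p)} \<in> W" if p: "p \<in> prt F' t" for p
  proof -
    have fp: "fpath E F t = redges r (Suc n)" unfolding t_def by (rule fpath_redges[OF F rf(5)])
    have "valid F t p" by (rule valid_mono[OF F F'(1) sub tF(1) p])
    then have "p \<in> hKe (r n, t)" using tF fp by (simp add: valid_def t_def)
    then have "dg (redges r (Suc n)) (delta (r n, t) p) \<in> ray_image r n"
      using delta_in[OF rn(3)] by (auto simp: ray_image_def t_def)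
    then have "dg (redges r (Suc n)) (delta (r n, t) p) \<in> ?O" using n by blast
    moreover have "hrw F (t, p) = (r 0, iD (r 0, r (Suc 0)) (dg (redges r (Suc n)) (delta (r n, t) p)))"
      using hrw_out[OF tF(2)] fp hchn_dg[of "redges r (Suc n)" p] by (simp add: t_def)
    ultimately show ?thesis by simp
  qed
  have "hmp F F' c \<in> W" if c: "c \<in> hat F' U" for c
  proof (rule hmp_hat[OF F F'(1) sub c])
    fix s x assume "s \<in> F'" "x \<in> mspace (Km s)" "rel F' `` {(s, x)} \<in> U"
    then show "hrel F `` {hrw F (s, iK s x)} \<in> W"
      using U(3)[of s x] W' iK_prt[OF tF(1) FV'] by (auto simp: P_def)
  next
    fix s w d assume s: "s \<in> F'" "E s w" "w \<notin> F'" and d: "d \<in> mspace (D (s, w))" and "good F' U (s, w)"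
    then have "\<forall>x\<in>Sg (s, w). P s x" using U(4) by simp
    then have "s = t" using Sg_nonempty[OF s(2)] by (auto simp: P_def)
    then show "hrel F `` {hrw F (s, iD (s, w) d)} \<in> W" using W' iD_prt[OF s(1) FV' s(2,3) d] by simp
  qed
  ultimately show ?thesis using F'(1) sub U(1,2) by blast
qed

lemma Phi_cont: "continuous_map tlim invl Phi"
proof -
  have "continuous_map tlim (hKF F) (\<lambda>z. Phi z F)" if F: "F \<in> subtrees V E" for F
    unfolding continuous_map
  proof (intro conjI allI impI)
    show "(\<lambda>z. Phi z F) ` topspace tlim \<subseteq> topspace (hKF F)"
      using Phi_in_invl F unfolding topspace_invl by blast
    fix W assume W: "openin (hKF F) W"
    show "openin tlim {z \<in> topspace tlim. Phi z F \<in> W}"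
    proof (subst openin_subopen, intro ballI)
      fix z assume "z \<in> {z \<in> topspace tlim. Phi z F \<in> W}"
      then have z: "z \<in> topspace tlim" "Phi z F \<in> W" by auto
      have "\<exists>F' U. F' \<in> subtrees V E \<and> F \<subseteq> F' \<and> openin (KF F') U \<and> sat F' U \<and>
          z \<in> G F' U \<and> (\<forall>c\<in>hat F' U. hmp F F' c \<in> W)"
        using z(1)
      proof (cases rule: tlim_cases)
        case (pt s x) then show ?thesis using Phi_nbhd_point[OF F W pt(1,2)] z(2) by simp
      next
        case (end_pt xi) then show ?thesis using Phi_nbhd_end[OF F W end_pt(1)] z(2) by simp
      qed
      then obtain F' U where U: "F' \<in> subtrees V E" "F \<subseteq> F'" "openin (KF F') U" "sat F' U" "z \<in> G F' U"
        "\<forall>c\<in>hat F' U. hmp F F' c \<in> W" by blast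
      have op: "openin tlim (G F' U)" by (rule openin_G[OF U(1,3,4)])
      \<comment> \<open>Membership in \<open>G F' U\<close> is read off at \<open>F'\<close> by
        \<open>Phi_hat\<close> and carried down to \<open>F\<close> by the bonding map.\<close>
      have "G F' U \<subseteq> {z \<in> topspace tlim. Phi z F \<in> W}"
      proof
        fix z' assume z': "z' \<in> G F' U"
        then have zt: "z' \<in> topspace tlim" using openin_subset[OF op] by blast
        then have "hmp F F' (Phi z' F') \<in> W" using Phi_hat[OF U(1,4) zt] z' U(6) by blast
        then show "z' \<in> {z \<in> topspace tlim. Phi z F \<in> W}" using Phi_thread[OF F U(1,2) zt] zt by simp
      qed
      then show "\<exists>T. openin tlim T \<and> z \<in> T \<and> T \<subseteq> {z \<in> topspace tlim. Phi z F \<in> W}" using op U(5) by blast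
    qed
  qed
  moreover have "Phi ` topspace tlim \<subseteq> extensional (subtrees V E)" by (auto simp: Phi_def)
  ultimately have "continuous_map tlim (product_topology hKF (subtrees V E)) Phi"
    unfolding continuous_map_componentwise by blast
  moreover have "Phi z \<in> {x. \<forall>F1\<in>subtrees V E. \<forall>F2\<in>subtrees V E. F1 \<subseteq> F2 \<longrightarrow> hmp F1 F2 (x F2) = x F1}"
    if "z \<in> topspace tlim" for z using Phi_thread that by blast
  ultimately show ?thesis unfolding invlim_def continuous_map_in_subtopology by blast
qed

theorem invlim_homeomorphic_lim:
  "\<exists>\<Psi>. homeomorphic_map invl tlim \<Psi> \<and> (\<forall>x\<in>topspace invl. \<Psi> x \<in> topspace tlim \<and> Phi (\<Psi> x) = x)"
proof -
  let ?Psi = "inv_into (topspace tlim) Phi"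
  have inj: "inj_on Phi (topspace tlim)" by (rule inj_onI) (rule Phi_inj)
  have inv: "?Psi x \<in> topspace tlim \<and> Phi (?Psi x) = x" if "x \<in> topspace invl" for x
  proof -
    have "x \<in> Phi ` topspace tlim" using Phi_surj[OF that] by blast
    then show ?thesis by (simp add: inv_into_into f_inv_into_f)
  qed
  have "homeomorphic_maps invl tlim ?Psi Phi"
    unfolding homeomorphic_maps_def
    using continuous_map_inv_Phi[OF inv] Phi_cont inv inj by (simp add: inv_into_f_f)
  then show ?thesis using inv homeomorphic_maps_imp_map by blast
qed

end

text \<open>Stabilization at \<open>y\<close> is expressed by a subtree \<open>F0\<close> above
  which all coordinates are the class of \<open>y\<close>. For other threads the corresponding end
  is pinned down by requiring, for every \<open>F\<close>, that the coordinate lie in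
  \<open>\<Delta>\<^sub>e\<close> for an edge \<open>e\<close> leaving \<open>F\<close> towards
  it.\<close>

theorem theorem2:
  fixes V :: "'v set" and E :: "'v \<Rightarrow> 'v \<Rightarrow> bool"
    and Km :: "'v \<Rightarrow> 'a metric" and Sg :: "'v edge \<Rightarrow> 'a set" and phi :: "'v edge \<Rightarrow> 'a \<Rightarrow> 'a"
    and D :: "'v edge \<Rightarrow> 'a metric" and S :: "'v edge \<Rightarrow> 'a set" and psi :: "'v edge \<Rightarrow> 'a \<Rightarrow> 'a"
    and delta :: "'v edge \<Rightarrow> ('v, 'a) pt \<Rightarrow> 'a"
  assumes tree: "is_tree V E" and ctbl: "countable V"
    and K_compact: "\<forall>t\<in>V. compact_space (mtopology_of (Km t))"
    and Sg_compact: "\<forall>e\<in>oedges V E. Sg e \<noteq> {} \<and> compactin (mtopology_of (Km (fst e))) (Sg e)"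
    and phi_homeo: "\<forall>e\<in>oedges V E.
        homeomorphic_map (subtopology (mtopology_of (Km (fst e))) (Sg e))
                         (subtopology (mtopology_of (Km (snd e))) (Sg (rev_e e))) (phi e)
        \<and> (\<forall>x\<in>Sg e. phi (rev_e e) (phi e x) = x)"
    and Sg_disjoint: "\<forall>t\<in>V. \<forall>e\<in>nbr_edges V E t. \<forall>e'\<in>nbr_edges V E t. e \<noteq> e' \<longrightarrow> Sg e \<inter> Sg e' = {}"
    and Sg_null: "\<forall>t\<in>V. null_family (Km t) (nbr_edges V E t) Sg"
    and D_compact: "\<forall>e\<in>oedges V E. compact_space (mtopology_of (D e)) \<and> compactin (mtopology_of (D e)) (S e)"
    and psi_homeo: "\<forall>e\<in>oedges V E.
        homeomorphic_map (subtopology (mtopology_of (D e)) (S e))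
                         (subtopology (mtopology_of (Km (fst e))) (Sg e)) (psi e)"
    and delta_cont: "\<forall>e\<in>oedges V E.
        continuous_map (subtopology (hatK E Km Sg D S psi (snd e)) (hatKe E Km Sg D S psi e))
                       (mtopology_of (D e)) (delta e)
        \<and> (\<forall>x\<in>Sg (rev_e e). delta e (incK E Km Sg D S psi (snd e) x)
                              = inv_into (S e) (psi e) (phi (rev_e e) x))"
    and is_fine: "ext_fine V E Km Sg D S psi delta"
  shows "\<exists>\<Psi>. homeomorphic_map (invlim V E Km Sg phi D S psi delta)
                 (ts_lim V E (\<lambda>t. mtopology_of (Km t)) Sg phi) \<Psi>
          \<and> (\<forall>x\<in>topspace (invlim V E Km Sg phi D S psi delta). \<forall>F0 t y.
               F0 \<in> subtrees V E \<and> t \<in> F0 \<and> y \<in> mspace (Km t) \<and>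
               (\<forall>F\<in>subtrees V E. F0 \<subseteq> F \<longrightarrow>
                   x F = hatKF_rel E Km Sg phi D S psi F `` {(t, incK E Km Sg D S psi t y)})
               \<longrightarrow> \<Psi> x = Inl (ts_rel V E (\<lambda>t. mtopology_of (Km t)) Sg phi `` {(t, y)}))
          \<and> (\<forall>x\<in>topspace (invlim V E Km Sg phi D S psi delta).
               \<not> (\<exists>F0 t y. F0 \<in> subtrees V E \<and> t \<in> F0 \<and> y \<in> mspace (Km t) \<and>
                   (\<forall>F\<in>subtrees V E. F0 \<subseteq> F \<longrightarrow>
                      x F = hatKF_rel E Km Sg phi D S psi F `` {(t, incK E Km Sg D S psi t y)}))
               \<longrightarrow> (\<exists>xi\<in>tree_ends V E. \<Psi> x = Inr xi \<and>
                      (\<forall>F\<in>subtrees V E. \<exists>e\<in>out_edges V E F. exits_to_end F e xi \<and>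
                         (\<exists>y\<in>mspace (D e).
                            x F = hatKF_rel E Km Sg phi D S psi F `` {(fst e, incD E Km Sg D S psi e y)}))))"
proof -
  have tr: "tree V E" using tree by unfold_locales
  have oed: "(u, w) \<in> oedges V E" if "E u w" for u w using tree.oedges_iff[OF tr] that by simp
  interpret extended_system V E Km Sg phi D S psi delta
  proof unfold_locales
    show "is_tree V E" by (rule tree)
  next
    fix u w assume E: "E u w"
    note o = oed[OF E]
    have E': "E w u" using tree.E_sym[OF tr E] .
    note o' = oed[OF E']
    have uV: "u \<in> V" using tree.E_V[OF tr E] by simp
    have cpt: "compactin (mtopology_of (Km u)) (Sg (u, w))" "Sg (u, w) \<noteq> {}" using Sg_compact o by auto
    have haus: "Hausdorff_space (mtopology_of m)" for m :: "'a metric"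
      unfolding mtopology_of_def by (rule Metric_space.Hausdorff_space_mtopology) simp
    show "Sg (u, w) \<subseteq> topspace (mtopology_of (Km u))" using compactin_subset_topspace[OF cpt(1)] .
    show "Sg (u, w) \<noteq> {}" by (rule cpt(2))
    show "closedin (mtopology_of (Km u)) (Sg (u, w))" by (rule compactin_imp_closedin[OF haus cpt(1)])
    have cpt': "compactin (mtopology_of (Km w)) (Sg (w, u))" using Sg_compact o' by auto
    have cS: "compactin (mtopology_of (D (u, w))) (S (u, w))" using D_compact o by blast
    have hphi: "homeomorphic_map (subtopology (mtopology_of (Km u)) (Sg (u, w)))
        (subtopology (mtopology_of (Km w)) (Sg (w, u))) (phi (u, w))"
      using phi_homeo o by (auto simp: rev_e_def)
    have hpsi: "homeomorphic_map (subtopology (mtopology_of (D (u, w))) (S (u, w)))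
        (subtopology (mtopology_of (Km u)) (Sg (u, w))) (psi (u, w))"
      using psi_homeo o by auto
    have tops: "topspace (subtopology (mtopology_of (Km u)) (Sg (u, w))) = Sg (u, w)"
      "topspace (subtopology (mtopology_of (Km w)) (Sg (w, u))) = Sg (w, u)"
      "topspace (subtopology (mtopology_of (D (u, w))) (S (u, w))) = S (u, w)"
      using compactin_subset_topspace[OF cpt(1)] compactin_subset_topspace[OF cpt'] compactin_subset_topspace[OF cS]
      by auto
    show "compact_space (mtopology_of (D (u, w)))" using D_compact o by blast
    show "S (u, w) \<subseteq> mspace (D (u, w))" using compactin_subset_topspace[OF cS] by simp
    show "bij_betw (psi (u, w)) (S (u, w)) (Sg (u, w))"
      using homeomorphic_imp_injective_map[OF hpsi] homeomorphic_imp_surjective_map[OF hpsi]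
      unfolding tops bij_betw_def by blast
    show "continuous_map (subtopology (mtopology_of (D (u, w))) (S (u, w))) (mtopology_of (Km u)) (psi (u, w))"
      using homeomorphic_imp_continuous_map[OF hpsi] unfolding continuous_map_in_subtopology by blast
    show "continuous_map (subtopology (hatK E Km Sg D S psi w) (hatKe E Km Sg D S psi (u, w)))
        (mtopology_of (D (u, w))) (delta (u, w))"
      using delta_cont o by auto
    fix x
    show "phi (u, w) x \<in> Sg (w, u)" if "x \<in> Sg (u, w)"
      using homeomorphic_imp_surjective_map[OF hphi] that unfolding tops by blast
    show "phi (w, u) (phi (u, w) x) = x" if "x \<in> Sg (u, w)"
      using phi_homeo o that by (auto simp: rev_e_def)
    show "delta (u, w) (incK E Km Sg D S psi w x) = inv_into (S (u, w)) (psi (u, w)) (phi (w, u) x)" if "x \<in> Sg (w, u)"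
      using delta_cont o that by (auto simp: rev_e_def)
  next
    fix u w w' x assume "E u w" "E u w'" and x: "x \<in> Sg (u, w)" "x \<in> Sg (u, w')"
    then have "u \<in> V" "(u, w) \<in> nbr_edges V E u" "(u, w') \<in> nbr_edges V E u"
      using oed tree.E_V[OF tr] by (auto simp: nbr_edges_def)
    then show "w = w'" using Sg_disjoint x by blast
  next
    show "ext_fine V E Km Sg D S psi delta" by (rule is_fine)
  qed
  obtain \<Psi> where hom: "homeomorphic_map invl tlim \<Psi>"
    and inv: "\<forall>x\<in>topspace invl. \<Psi> x \<in> topspace tlim \<and> Phi (\<Psi> x) = x"
    using invlim_homeomorphic_lim by blast
  have stable: "\<Psi> x = Inl (rel V `` {(t, y)})"
    if x: "x \<in> topspace invl" and F0: "F0 \<in> subtrees V E" "t \<in> F0" "y \<in> mspace (Km t)"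
      and st: "\<forall>F\<in>subtrees V E. F0 \<subseteq> F \<longrightarrow> x F = hrel F `` {(t, iK t y)}" for x F0 t y
  proof -
    have tV: "t \<in> V" using F0 subtreeD(3) by blast
    note z = Inl_in_tlim[OF tV F0(3)]
    have "x = Phi (Inl (rel V `` {(t, y)}))"
    proof (rule thread_eq_Phi[OF x z F0(1)])
      fix F assume F: "F \<in> subtrees V E" "F0 \<subseteq> F"
      then show "x F = Phi (Inl (rel V `` {(t, y)})) F" using st Phi_Inl_in[OF F(1) _ F0(3)] F0(2) by auto
    qed
    then show ?thesis using Phi_inj[OF _ z, of "\<Psi> x"] inv x by simp
  qed
  have unstable: "\<exists>xi\<in>tree_ends V E. \<Psi> x = Inr xi \<and>
      (\<forall>F\<in>subtrees V E. \<exists>e\<in>out_edges V E F. exits_to_end F e xi \<and>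
        (\<exists>y\<in>mspace (D e). x F = hrel F `` {(fst e, iD e y)}))"
    if x: "x \<in> topspace invl" and ns: "\<not> (\<exists>F0 t y. F0 \<in> subtrees V E \<and> t \<in> F0 \<and> y \<in> mspace (Km t) \<and>
      (\<forall>F\<in>subtrees V E. F0 \<subseteq> F \<longrightarrow> x F = hrel F `` {(t, iK t y)}))" for x
  proof -
    have z: "\<Psi> x \<in> topspace tlim" "Phi (\<Psi> x) = x" using inv x by auto
    from z(1) show ?thesis
    proof (cases rule: tlim_cases)
      case (pt s y)
      have "x F = hrel F `` {(s, iK s y)}" if "F \<in> subtrees V E" "{s} \<subseteq> F" for F
        using Phi_Inl_in[of F s y] that pt z(2) by simp
      then have "\<forall>F\<in>subtrees V E. {s} \<subseteq> F \<longrightarrow> x F = hrel F `` {(s, iK s y)}" by simp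
      \<comment> \<open>If the image were a point of \<open>K\<^sub>s\<close>, the thread would
        stabilize from \<open>{s}\<close> on.\<close>
      then have False
        using ns[unfolded not_ex, rule_format, of "{s}" s y] subtree_singleton[OF pt(1)] pt(2) by simp
      then show ?thesis ..
    next
      case (end_pt xi)
      have "\<exists>e\<in>out_edges V E F. exits_to_end F e xi \<and> (\<exists>y\<in>mspace (D e). x F = hrel F `` {(fst e, iD e y)})"
        if F: "F \<in> subtrees V E" for F
      proof -
        define r where "r = fray F xi"
        note rf = fray_facts[OF F end_pt(1) r_def]
        let ?e = "(r 0, r (Suc 0))"
        have "?e \<in> out_edges V E F" using fray_edge[OF F end_pt(1)] by (simp add: r_def)
        moreover have "exits_to_end F ?e xi" using exits_to_end_iff[OF F end_pt(1), of ?e] rf(2) by (simp add: r_def)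
        moreover have "x F = hrel F `` {(fst ?e, iD ?e (ray_point r))}" using Phi_Inr[OF F r_def] end_pt(2) z(2) by simp
        ultimately show ?thesis using ray_point_D[OF rf(1)] by blast
      qed
      then show ?thesis using end_pt by blast
    qed
  qed
  show ?thesis
    using hom stable unstable by (intro exI[of _ \<Psi>] conjI ballI allI impI) auto
qed

end
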